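(* Let $(G,\omega,\mu)$ be a weighted, stochastically complete, infinite graph with $\lambda_1(G)>0$. Let $u_0\in\ell^\infty(G)$, $u_0\ge 0$, $u_0\not\equiv 0$ in $G$. Let $f:[0,+\infty)\to[0,+\infty)$ be locally Lipschitz. Assume that $f\ge h$ on $[0,+\infty)$, where $h$ is increasing and convex in $[0,+\infty)$ and $h(0)=0$. Moreover, suppose that $$\int_1^{+\infty}\frac{1}{h(s)}\,ds<+\infty,$$ and that $h'(0)>\lambda_1(G)$, where $h'(0)$ is the (right) derivative of $h$ at $0$. Then any solution $u$ of the problem $u_t=\Delta u+f(u)$ in $G\times(0,T)$, $u=u_0$ in $G\times\{0\}$, blows up in finite time; that is, when $u$ is continued to its maximal interval of existence, there exists $\tau\in(0,+\infty)$ such that $\lim_{t\to\tau^-}\|u(t)\|_{\ell^\infty(G)}=+\infty$.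
   Context: Weighted infinite graph: $G$ is a countably infinite set, $\mu:G\to(0,+\infty)$ is the node measure, and $\omega:G\times G\to[0,+\infty)$ is the edge weight, with $\omega(x,y)=\omega(y,x)$, $\omega(x,x)=0$ and $\sum_{y\in G}\omega(x,y)<\infty$ for all $x,y\in G$. Write $x\sim y$ if $\omega(x,y)>0$. The graph is always assumed locally finite (each $x$ has only finitely many $y\sim x$), connected (any two distinct vertices are joined by a finite path $x_0\sim x_1\sim\dots\sim x_n$) and undirected. Laplacian: $\Delta g(x)=\frac1{\mu(x)}\sum_{y\in G}[g(y)-g(x)]\,\omega(x,y)$ for $g:G\to\mathbb R$. $\ell^\infty(G)$ is the space of bounded functions on $G$ with the sup norm. $p:G\times G\times(0,+\infty)\to(0,+\infty)$ is the (minimal) heat kernel of the heat semigroup $e^{t\Delta}$: $(e^{t\Delta}u_0)(x)=\sum_{y\in G}p(x,y,t)u_0(y)\mu(y)$. It is symmetric in $(x,y)$, satisfies the semigroup identity $p(x,y,t+s)=\sum_{z}p(x,z,t)p(z,y,s)\mu(z)$, and $\sum_{y}p(x,y,t)\mu(y)\le1$. The graph is stochastically complete if $\sum_{y\in G}p(x,y,t)\mu(y)=1$ for all $x\in G$, $t>0$. $\lambda_1(G)=\inf\operatorname{spec}(-\Delta)$ is the infimum of the spectrum of $-\Delta$, realized as the self-adjoint operator on $\ell^2(G,\mu)$ generating the minimal heat semigroup. A known fact: $\lim_{t\to+\infty}\frac{\log p(x,y,t)}{t}=-\lambda_1(G)$ for all $x,y\in G$. Solutions are mild: a (nonnegative)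 function $u\in L^\infty((0,\tau),\ell^\infty(G))$ is a mild solution on $G\times(0,\tau)$ if $$u(x,t)=\sum_{y\in G}p(x,y,t)u_0(y)\mu(y)+\int_0^t\sum_{y\in G}p(x,y,t-s)f(u(y,s))\mu(y)\,ds$$ for all $x\in G$, $t\in(0,\tau)$. A mild solution on $G\times(0,+\infty)$ is called global. On its maximal interval of existence $(0,\tau)$, a solution is required to be a mild solution on $(0,\tau')$ for every $\tau'<\tau$. *)

theory Defs
  imports "HOL-Analysis.Analysis"
begin

text \<open>The vertex set of the graph is the whole type \<open>'a\<close>.\<close>

locale weighted_graph =
  fixes \<mu> :: "'a \<Rightarrow> real" and \<omega> :: "'a \<Rightarrow> 'a \<Rightarrow> real"
  assumes vertices_countable: "countable (UNIV :: 'a set)"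
    and vertices_infinite: "infinite (UNIV :: 'a set)"
    and measure_pos: "\<mu> x > 0"
    and weight_nonneg: "\<omega> x y \<ge> 0"
    and weight_sym: "\<omega> x y = \<omega> y x"
    and weight_irrefl: "\<omega> x x = 0"
    and weight_summable: "\<omega> x summable_on UNIV"
    and locally_finite: "finite {y. \<omega> x y > 0}"
    and graph_connected: "(\<lambda>a b. \<omega> a b > 0)\<^sup>*\<^sup>* x y"

definition laplacian :: "('a \<Rightarrow> real) \<Rightarrow> ('a \<Rightarrow> 'a \<Rightarrow> real) \<Rightarrow> ('a \<Rightarrow> real) \<Rightarrow> 'a \<Rightarrow> real" where
  "laplacian \<mu> \<omega> g x = (1 / \<mu> x) * (\<Sum>\<^sub>\<infinity>y. (g y - g x) * \<omega> x y)"


subsection \<open>The minimal heat kernel\<close>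

text \<open>The minimal heat kernel is obtained by exhaustion. For a finite set \<open>\<Omega>\<close> of vertices the
  Laplacian with Dirichlet conditions outside \<open>\<Omega>\<close> is an operator on a finite-dimensional space, and
  the Dirichlet heat kernel \<open>p\<^sub>\<Omega>(x,y,t)\<close> is \<open>(exp(t \<Delta>\<^sub>\<Omega>) (\<delta>\<^sub>y / \<mu>(y)))(x)\<close>, written as the exponential
  series. It is nondecreasing in \<open>\<Omega>\<close> and bounded by \<open>1 / \<mu>(y)\<close>, so its limit along any exhaustion of
  the graph by finite sets is the supremum over all finite sets.\<close>

definition dirichlet_laplacian ::
    "('a \<Rightarrow> real) \<Rightarrow> ('a \<Rightarrow> 'a \<Rightarrow> real) \<Rightarrow> 'a set \<Rightarrow> ('a \<Rightarrow> real) \<Rightarrow> 'a \<Rightarrow> real" where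
  "dirichlet_laplacian \<mu> \<omega> \<Omega> g x =
     (if x \<in> \<Omega> then laplacian \<mu> \<omega> (\<lambda>z. if z \<in> \<Omega> then g z else 0) x else 0)"

definition dirichlet_heat_kernel ::
    "('a \<Rightarrow> real) \<Rightarrow> ('a \<Rightarrow> 'a \<Rightarrow> real) \<Rightarrow> 'a set \<Rightarrow> 'a \<Rightarrow> 'a \<Rightarrow> real \<Rightarrow> real" where
  "dirichlet_heat_kernel \<mu> \<omega> \<Omega> x y t =
     (\<Sum>n. t ^ n / fact n *
        ((dirichlet_laplacian \<mu> \<omega> \<Omega> ^^ n) (\<lambda>z. if z = y then 1 / \<mu> y else 0)) x)"

definition heat_kernel ::
    "('a \<Rightarrow> real) \<Rightarrow> ('a \<Rightarrow> 'a \<Rightarrow> real) \<Rightarrow> 'a \<Rightarrow> 'a \<Rightarrow> real \<Rightarrow> real" where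
  "heat_kernel \<mu> \<omega> x y t =
     (SUP \<Omega> \<in> {\<Omega>. finite \<Omega> \<and> x \<in> \<Omega> \<and> y \<in> \<Omega>}. dirichlet_heat_kernel \<mu> \<omega> \<Omega> x y t)"

definition heat_semigroup ::
    "('a \<Rightarrow> real) \<Rightarrow> ('a \<Rightarrow> 'a \<Rightarrow> real) \<Rightarrow> real \<Rightarrow> ('a \<Rightarrow> real) \<Rightarrow> 'a \<Rightarrow> real" where
  "heat_semigroup \<mu> \<omega> t g x = (\<Sum>\<^sub>\<infinity>y. heat_kernel \<mu> \<omega> x y t * g y * \<mu> y)"

definition stochastically_complete :: "('a \<Rightarrow> real) \<Rightarrow> ('a \<Rightarrow> 'a \<Rightarrow> real) \<Rightarrow> bool" where
  "stochastically_complete \<mu> \<omega> \<longleftrightarrow>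
     (\<forall>x. \<forall>t>0. ((\<lambda>y. heat_kernel \<mu> \<omega> x y t * \<mu> y) has_sum 1) UNIV)"


subsection \<open>The bottom of the spectrum\<close>

definition ell2 :: "('a \<Rightarrow> real) \<Rightarrow> ('a \<Rightarrow> real) set" where
  "ell2 \<mu> = {g. (\<lambda>x. (g x)\<^sup>2 * \<mu> x) summable_on UNIV}"

definition ell2_norm :: "('a \<Rightarrow> real) \<Rightarrow> ('a \<Rightarrow> real) \<Rightarrow> real" where
  "ell2_norm \<mu> g = sqrt (\<Sum>\<^sub>\<infinity>x. (g x)\<^sup>2 * \<mu> x)"

text \<open>The graph of the self-adjoint operator \<open>-\<Delta>\<close> on \<open>\<ell>\<^sup>2(G,\<mu>)\<close>, that is, of minus the
  infinitesimal generator of the heat semigroup: \<open>(g, k)\<close> belongs to it iff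
  \<open>(P\<^sub>t g - g) / t \<rightarrow> -k\<close> in \<open>\<ell>\<^sup>2(G,\<mu>)\<close> as \<open>t \<rightarrow> 0+\<close>.\<close>

definition neg_generator ::
    "('a \<Rightarrow> real) \<Rightarrow> ('a \<Rightarrow> 'a \<Rightarrow> real) \<Rightarrow> (('a \<Rightarrow> real) \<times> ('a \<Rightarrow> real)) set" where
  "neg_generator \<mu> \<omega> =
     {(g, k). g \<in> ell2 \<mu> \<and> k \<in> ell2 \<mu> \<and>
        (\<forall>t>0. heat_semigroup \<mu> \<omega> t g \<in> ell2 \<mu>) \<and>
        ((\<lambda>t. ell2_norm \<mu> (\<lambda>x. (heat_semigroup \<mu> \<omega> t g x - g x) / t + k x)) \<longlongrightarrow> 0)
          (at_right 0)}"

text \<open>Operators are given by their graphs \<open>A\<close>. The Hilbert space is real; since the operator below is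
  self-adjoint, its spectrum is real and is not changed by complexification.\<close>

definition resolvent_set ::
    "('a \<Rightarrow> real) \<Rightarrow> (('a \<Rightarrow> real) \<times> ('a \<Rightarrow> real)) set \<Rightarrow> real set" where
  "resolvent_set \<mu> A =
     {z. (\<forall>r \<in> ell2 \<mu>. \<exists>!g. \<exists>k. (g, k) \<in> A \<and> (\<forall>x. k x - z * g x = r x)) \<and>
         (\<exists>C. \<forall>(g, k) \<in> A. ell2_norm \<mu> g \<le> C * ell2_norm \<mu> (\<lambda>x. k x - z * g x))}"

definition spectrum ::
    "('a \<Rightarrow> real) \<Rightarrow> (('a \<Rightarrow> real) \<times> ('a \<Rightarrow> real)) set \<Rightarrow> real set" where
  "spectrum \<mu> A = - resolvent_set \<mu> A"

definition lambda1 :: "('a \<Rightarrow> real) \<Rightarrow> ('a \<Rightarrow> 'a \<Rightarrow> real) \<Rightarrow> ereal" where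
  "lambda1 \<mu> \<omega> = (INF z \<in> spectrum \<mu> (neg_generator \<mu> \<omega>). ereal z)"


subsection \<open>Mild solutions\<close>

definition linf_norm :: "('a \<Rightarrow> real) \<Rightarrow> real" where
  "linf_norm g = (SUP x. \<bar>g x\<bar>)"

text \<open>Membership of \<open>u\<close> in \<open>L\<^sup>\<infinity>((0,\<tau>), \<ell>\<^sup>\<infinity>(G))\<close>. Measurability in time is understood vertex by
  vertex (weak-star measurability in \<open>\<ell>\<^sup>\<infinity>(G)\<close>, the dual of a separable \<open>\<ell>\<^sup>1\<close> space) and not in the
  sense of Bochner: the heat semigroup need not be strongly continuous on \<open>\<ell>\<^sup>\<infinity>(G)\<close>.\<close>

definition linf_linf :: "real \<Rightarrow> ('a \<Rightarrow> real \<Rightarrow> real) \<Rightarrow> bool" where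
  "linf_linf \<tau> u \<longleftrightarrow>
     (\<forall>x. u x \<in> borel_measurable (lebesgue_on {0<..<\<tau>})) \<and>
     (\<exists>M. AE t in lebesgue_on {0<..<\<tau>}. \<forall>x. \<bar>u x t\<bar> \<le> M)"

definition mild_solution ::
    "('a \<Rightarrow> real) \<Rightarrow> ('a \<Rightarrow> 'a \<Rightarrow> real) \<Rightarrow> (real \<Rightarrow> real) \<Rightarrow> ('a \<Rightarrow> real) \<Rightarrow> real \<Rightarrow>
      ('a \<Rightarrow> real \<Rightarrow> real) \<Rightarrow> bool" where
  "mild_solution \<mu> \<omega> f u0 \<tau> u \<longleftrightarrow>
     linf_linf \<tau> u \<and>
     (\<forall>x. \<forall>t\<in>{0<..<\<tau>}. u x t \<ge> 0) \<and>
     (\<forall>x. \<forall>t\<in>{0<..<\<tau>}.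
        u x t = (\<Sum>\<^sub>\<infinity>y. heat_kernel \<mu> \<omega> x y t * u0 y * \<mu> y) +
          (LINT s:{0<..<t}|lebesgue. (\<Sum>\<^sub>\<infinity>y. heat_kernel \<mu> \<omega> x y (t - s) * f (u y s) * \<mu> y)))"

text \<open>Solutions on \<open>(0,T)\<close>, with \<open>T = \<infinity>\<close> allowed. A mild solution on \<open>(0,T)\<close> is bounded there;
  this is only required on every \<open>(0,\<tau>)\<close> with \<open>\<tau> < T\<close>, so that a solution on its maximal interval
  of existence is a solution in this sense.\<close>

definition solution ::
    "('a \<Rightarrow> real) \<Rightarrow> ('a \<Rightarrow> 'a \<Rightarrow> real) \<Rightarrow> (real \<Rightarrow> real) \<Rightarrow> ('a \<Rightarrow> real) \<Rightarrow> ereal \<Rightarrow>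
      ('a \<Rightarrow> real \<Rightarrow> real) \<Rightarrow> bool" where
  "solution \<mu> \<omega> f u0 T u \<longleftrightarrow>
     0 < T \<and> (\<forall>\<tau>>0. ereal \<tau> < T \<longrightarrow> mild_solution \<mu> \<omega> f u0 \<tau> u)"

definition agree_before :: "ereal \<Rightarrow> ('a \<Rightarrow> real \<Rightarrow> real) \<Rightarrow> ('a \<Rightarrow> real \<Rightarrow> real) \<Rightarrow> bool" where
  "agree_before T u v \<longleftrightarrow> (\<forall>x t. 0 < t \<and> ereal t < T \<longrightarrow> u x t = v x t)"

definition maximal_solution ::
    "('a \<Rightarrow> real) \<Rightarrow> ('a \<Rightarrow> 'a \<Rightarrow> real) \<Rightarrow> (real \<Rightarrow> real) \<Rightarrow> ('a \<Rightarrow> real) \<Rightarrow> ereal \<Rightarrow>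
      ('a \<Rightarrow> real \<Rightarrow> real) \<Rightarrow> bool" where
  "maximal_solution \<mu> \<omega> f u0 T u \<longleftrightarrow>
     solution \<mu> \<omega> f u0 T u \<and>
     \<not> (\<exists>T' v. T < T' \<and> solution \<mu> \<omega> f u0 T' v \<and> agree_before T u v)"

end

theory Submission
  imports Defs
begin

text \<open>Fix a vertex \<open>x\<close> and a time \<open>T\<close> up to which a solution exists, and put
  \<open>\<Phi>(t) = (P\<^bsub>T-t\<^esub> u(t))(x)\<close>. Duhamel's formula, Jensen's inequality (here stochastic completeness
  enters) and \<open>f \<ge> h\<close> give \<open>\<Phi>' \<ge> h(\<Phi>)\<close>, so \<open>T\<close> is at most the time which the ODE \<open>y' = h(y)\<close> needs to
  go from \<open>\<Phi>(0) = (P\<^sub>T u\<^sub>0)(x)\<close> to infinity. Since \<open>h(s) \<ge> h'(0) s\<close>, this means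
  \<open>(P\<^sub>T u\<^sub>0)(x) \<le> C exp(-h'(0) T)\<close> with \<open>C\<close> independent of \<open>x\<close>. If solutions existed for all times, then the
  heat kernel would decay at rate \<open>h'(0)\<close>; by log-convexity of \<open>t \<mapsto> \<langle>P\<^sub>t g, g\<rangle>\<close> this improves to
  \<open>\<parallel>P\<^sub>t\<parallel> \<le> exp(-h'(0) t)\<close> on \<open>\<ell>\<^sup>2\<close>, so every \<open>z < h'(0)\<close> lies in the resolvent set (the resolvent is the
  Laplace transform of the semigroup), contradicting \<open>h'(0) > \<lambda>\<^sub>1\<close>. Hence the maximal existence time is finite,
  and the norm tends to infinity there because the local existence time depends only on the norm.\<close>

section \<open>The Dirichlet heat kernel\<close>

context weighted_graph
begin

text \<open>Two features of the setting shape the proof. The kernel is given only as a supremum of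
  finite-dimensional exponentials, so symmetry, the semigroup identity, positivity and time
  regularity all have to come from those exponentials. And the degrees may be unbounded, so the
  semigroup need not be continuous in time in the sup norm: regularity in time is obtained one
  vertex at a time, with Lipschitz constants proportional to \<open>deg x\<close>.

  The constant C of the decay estimate is \<open>exp (d * tail)\<close>, where \<open>d\<close> is
  h'(0) and \<open>tail\<close> is the integral of 1/h over [1,\<infinity>): climbing from a height
  a < 1 to 1 takes the comparison equation at most -ln a / d, and the rest takes at most
  \<open>tail\<close>. The kernel bound derived from it has a constant that depends on one of the
  two vertices, so it cannot simply be summed over the graph. Iterating \<phi>(t)^2 \<le> \<phi>(0)
  \<phi>(2t) along t, 2t, 4t, ... replaces that constant by \<phi>(0), because its 2^n-th root tends
  to 1. This is done for finitely supported functions and extended by a limit.\<close>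

definition deg :: "'a \<Rightarrow> real" where
  "deg x = (\<Sum>\<^sub>\<infinity>y. \<omega> x y) / \<mu> x"

text \<open>For \<open>c \<ge> deg\<close> the matrix of \<open>\<Delta> + c\<close> has nonnegative entries, and
  \<open>exp(t\<Delta>) = exp(-ct) exp(t(\<Delta> + c))\<close>; all order properties of the kernel are read off from this series.\<close>

definition shifted_laplacian :: "real \<Rightarrow> 'a \<Rightarrow> 'a \<Rightarrow> real" where
  "shifted_laplacian c x z = \<omega> x z / \<mu> x + (if x = z then c - deg x else 0)"

text \<open>Column \<open>y\<close> is divided by \<open>\<mu> y\<close>, so these are kernels with
  respect to \<mu> and turn out symmetric. The row index is not cut off at \<Omega>, hence the
  condition \<open>x \<in> \<Omega>\<close> in the lemmas below.\<close>

primrec shifted_power :: "real \<Rightarrow> 'a set \<Rightarrow> nat \<Rightarrow> 'a \<Rightarrow> 'a \<Rightarrow> real" where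
  "shifted_power c \<Omega> 0 x y = (if x = y then 1 / \<mu> y else 0)"
| "shifted_power c \<Omega> (Suc n) x y = (\<Sum>z\<in>\<Omega>. shifted_laplacian c x z * shifted_power c \<Omega> n z y)"

lemma measure_nonneg [simp]: "0 \<le> \<mu> x"
  using measure_pos[of x] by simp

lemma measure_nonzero [simp]: "\<mu> x \<noteq> 0"
  using measure_pos[of x] by simp

lemma deg_nonneg: "0 \<le> deg x"
  unfolding deg_def by (rule divide_nonneg_nonneg[OF infsum_nonneg[OF weight_nonneg] measure_nonneg])

lemma weight_pos_iff: "0 < \<omega> x y \<longleftrightarrow> \<omega> x y \<noteq> 0"
  using weight_nonneg[of x y] by linarith

text \<open>The diagonal entry -\<open>deg x\<close> counts all edges at \<open>x\<close>, also
  those leaving \<Omega>. This is where the Dirichlet condition enters the matrix.\<close>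

lemma laplacian_finite_support:
  assumes "finite \<Omega>" "x \<in> \<Omega>" "\<And>z. z \<notin> \<Omega> \<Longrightarrow> g z = 0"
  shows "laplacian \<mu> \<omega> g x = (\<Sum>z\<in>\<Omega>. shifted_laplacian 0 x z * g z)"
proof -
  let ?N = "{y. \<omega> x y > 0}"
  have "(\<Sum>\<^sub>\<infinity>y. (g y - g x) * \<omega> x y) = (\<Sum>\<^sub>\<infinity>y\<in>?N. (g y - g x) * \<omega> x y)"
    by (rule infsum_cong_neutral) (auto simp: weight_pos_iff)
  also have "\<dots> = (\<Sum>y\<in>?N. (g y - g x) * \<omega> x y)"
    using locally_finite by simp
  also have "\<dots> = (\<Sum>y\<in>?N. \<omega> x y * g y) - g x * (\<Sum>y\<in>?N. \<omega> x y)"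
    by (simp add: sum_subtractf sum_distrib_left algebra_simps)
  also have "(\<Sum>y\<in>?N. \<omega> x y) = \<mu> x * deg x"
  proof -
    have "(\<Sum>\<^sub>\<infinity>y. \<omega> x y) = (\<Sum>\<^sub>\<infinity>y\<in>?N. \<omega> x y)"
      by (rule infsum_cong_neutral) (auto simp: weight_pos_iff)
    thus ?thesis using locally_finite by (simp add: deg_def)
  qed
  also have "(\<Sum>y\<in>?N. \<omega> x y * g y) = (\<Sum>y\<in>?N \<union> \<Omega>. \<omega> x y * g y)"
    by (rule sum.mono_neutral_left) (use assms locally_finite weight_pos_iff in auto)
  also have "\<dots> = (\<Sum>y\<in>\<Omega>. \<omega> x y * g y)"
    by (rule sum.mono_neutral_right) (use assms locally_finite in auto)
  finally have "laplacian \<mu> \<omega> g x = (\<Sum>y\<in>\<Omega>. \<omega> x y / \<mu> x * g y) - deg x * g x"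
    by (simp add: laplacian_def diff_divide_distrib sum_divide_distrib)
  also have "deg x * g x = (\<Sum>z\<in>\<Omega>. if x = z then deg x * g z else 0)"
    using assms by simp
  finally show ?thesis
    by (simp add: shifted_laplacian_def sum_subtractf[symmetric] algebra_simps)
      (intro sum.cong, auto simp: algebra_simps)
qed

lemma dirichlet_laplacian_power:
  assumes "finite \<Omega>" "y \<in> \<Omega>"
  shows "(dirichlet_laplacian \<mu> \<omega> \<Omega> ^^ n) (\<lambda>z. if z = y then 1 / \<mu> y else 0) x =
           (if x \<in> \<Omega> then shifted_power 0 \<Omega> n x y else 0)"
proof (induction n arbitrary: x)
  case 0
  then show ?case using assms by auto
next
  case (Suc n)
  show ?case
  proof (cases "x \<in> \<Omega>")
    case True
    have "(dirichlet_laplacian \<mu> \<omega> \<Omega> ^^ Suc n) (\<lambda>z. if z = y then 1 / \<mu> y else 0) x =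
      laplacian \<mu> \<omega> (\<lambda>z. if z \<in> \<Omega> then shifted_power 0 \<Omega> n z y else 0) x"
      using True by (auto simp: dirichlet_laplacian_def Suc intro!: arg_cong[where f="\<lambda>g. laplacian \<mu> \<omega> g x"])
    also have "\<dots> = (\<Sum>z\<in>\<Omega>. shifted_laplacian 0 x z * (if z \<in> \<Omega> then shifted_power 0 \<Omega> n z y else 0))"
      by (rule laplacian_finite_support) (use True assms in auto)
    finally show ?thesis using True by simp
  qed (simp add: dirichlet_laplacian_def)
qed

lemma sum_shifted_laplacian_add:
  assumes "finite \<Omega>" "x \<in> \<Omega>"
  shows "(\<Sum>z\<in>\<Omega>. shifted_laplacian (c + e) x z * g z) =
    (\<Sum>z\<in>\<Omega>. shifted_laplacian c x z * g z) + e * g x"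
proof -
  have "e * g x = (\<Sum>z\<in>\<Omega>. if x = z then e * g z else 0)"
    using assms by simp
  thus ?thesis
    by (simp add: shifted_laplacian_def sum.distrib[symmetric])
      (intro sum.cong, auto simp: algebra_simps)
qed

text \<open>Coefficient form of exp(t(A + e)) = exp(tA) exp(te), valid since e commutes with A.
  Multiplying by \<open>Suc n\<close> plays the role of differentiating the series; the product rule
  then does the induction step without binomial coefficients.\<close>

lemma shifted_power_add:
  assumes "finite \<Omega>" "x \<in> \<Omega>"
  shows "shifted_power (c + e) \<Omega> n x y / fact n =
    (\<Sum>k\<le>n. shifted_power c \<Omega> k x y / fact k * (e ^ (n - k) / fact (n - k)))"
  using assms(2)
proof (induction n arbitrary: x)
  case 0
  then show ?case by simp
next
  case (Suc n)
  define a where "a k z = shifted_power c \<Omega> k z y / fact k" for k z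
  define w where "w k = e ^ k / fact k" for k
  have IH: "shifted_power (c + e) \<Omega> n z y / fact n = (\<Sum>k\<le>n. a k z * w (n - k))" if "z \<in> \<Omega>" for z
    using Suc.IH[OF that] by (simp add: a_def w_def)
  have Sa: "(\<Sum>z\<in>\<Omega>. shifted_laplacian c x z * a k z) = real (Suc k) * a (Suc k) x" for k
    by (simp add: a_def sum_divide_distrib[symmetric] divide_simps del: of_nat_Suc)
  have Sw: "e * w k = real (Suc k) * w (Suc k)" for k
    by (simp add: w_def divide_simps del: of_nat_Suc)
  have "real (Suc n) * (shifted_power (c + e) \<Omega> (Suc n) x y / fact (Suc n)) =
      (\<Sum>z\<in>\<Omega>. shifted_laplacian (c + e) x z * (shifted_power (c + e) \<Omega> n z y / fact n))"
    by (simp add: sum_divide_distrib[symmetric] divide_simps del: of_nat_Suc)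
  also have "\<dots> = (\<Sum>z\<in>\<Omega>. shifted_laplacian (c + e) x z * (\<Sum>k\<le>n. a k z * w (n - k)))"
    by (intro sum.cong) (simp_all add: IH)
  also have "\<dots> = (\<Sum>z\<in>\<Omega>. shifted_laplacian c x z * (\<Sum>k\<le>n. a k z * w (n - k)))
      + e * (\<Sum>k\<le>n. a k x * w (n - k))"
    by (rule sum_shifted_laplacian_add) (use assms Suc in auto)
  also have "(\<Sum>z\<in>\<Omega>. shifted_laplacian c x z * (\<Sum>k\<le>n. a k z * w (n - k))) =
      (\<Sum>k\<le>n. (\<Sum>z\<in>\<Omega>. shifted_laplacian c x z * a k z) * w (n - k))"
    by (simp add: sum_distrib_left sum_distrib_right mult.assoc) (rule sum.swap)
  also have "\<dots> = (\<Sum>k\<le>n. real (Suc k) * a (Suc k) x * w (Suc n - Suc k))"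
    by (simp add: Sa del: of_nat_Suc)
  also have "\<dots> = (\<Sum>k\<le>Suc n. real k * a k x * w (Suc n - k))"
    by (subst sum.atMost_Suc_shift) simp
  also have "e * (\<Sum>k\<le>n. a k x * w (n - k)) = (\<Sum>k\<le>n. a k x * (e * w (n - k)))"
    by (simp add: sum_distrib_left mult_ac)
  also have "\<dots> = (\<Sum>k\<le>n. real (Suc n - k) * a k x * w (Suc n - k))"
    by (intro sum.cong) (simp_all add: Sw Suc_diff_le)
  also have "\<dots> = (\<Sum>k\<le>Suc n. real (Suc n - k) * a k x * w (Suc n - k))"
    by simp
  \<comment> \<open>The weights \<open>k\<close> and \<open>Suc n - k\<close> of the two sums add up
    to the factor \<open>Suc n\<close>, which is cancelled at the end.\<close>
  also have "(\<Sum>k\<le>Suc n. real k * a k x * w (Suc n - k)) + \<dots> =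
      (\<Sum>k\<le>Suc n. real (Suc n) * (a k x * w (Suc n - k)))"
    unfolding sum.distrib[symmetric]
    by (intro sum.cong refl) (simp add: of_nat_diff algebra_simps)
  also have "\<dots> = real (Suc n) * (\<Sum>k\<le>Suc n. a k x * w (Suc n - k))"
    by (simp only: sum_distrib_left)
  finally show ?case
    unfolding a_def w_def using mult_left_cancel[of "real (Suc n)"] of_nat_neq_0 by blast
qed

text \<open>Any shift above all degrees in \<Omega> would serve; unlike a maximum, the sum is also
  defined and nonnegative for empty \<Omega>.\<close>

definition degree_bound :: "'a set \<Rightarrow> real" where
  "degree_bound \<Omega> = (\<Sum>x\<in>\<Omega>. deg x)"

lemma deg_le_degree_bound: "finite \<Omega> \<Longrightarrow> x \<in> \<Omega> \<Longrightarrow> deg x \<le> degree_bound \<Omega>"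
  unfolding degree_bound_def by (rule member_le_sum) (auto simp: deg_nonneg)

lemma degree_bound_nonneg: "0 \<le> degree_bound \<Omega>"
  unfolding degree_bound_def by (simp add: sum_nonneg deg_nonneg)

lemma sum_weight_le: "finite \<Omega> \<Longrightarrow> (\<Sum>z\<in>\<Omega>. \<omega> x z) \<le> \<mu> x * deg x"
  unfolding deg_def using finite_sum_le_infsum[of "\<omega> x" UNIV \<Omega>] weight_summable weight_nonneg
  by auto

lemma shifted_laplacian_nonneg: "deg x \<le> c \<Longrightarrow> 0 \<le> shifted_laplacian c x z"
  by (auto simp: shifted_laplacian_def weight_nonneg)

text \<open>Rows of the full matrix sum to exactly \<open>c\<close>; the deficit is the weight of
  the edges leaving \<Omega>.\<close>

lemma sum_shifted_laplacian_le:
  assumes "finite \<Omega>" "x \<in> \<Omega>"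
  shows "(\<Sum>z\<in>\<Omega>. shifted_laplacian c x z) \<le> c"
proof -
  have "(\<Sum>z\<in>\<Omega>. \<omega> x z) / \<mu> x \<le> deg x"
    using sum_weight_le[OF assms(1), of x] measure_pos[of x] by (simp add: divide_simps mult.commute)
  thus ?thesis
    using assms by (simp add: shifted_laplacian_def sum.distrib sum_divide_distrib[symmetric])
qed

section \<open>Nonnegative powers of the shifted Laplacian and the kernel series\<close>

context
  fixes \<Omega> :: "'a set" and c :: real
  assumes fin: "finite \<Omega>" and c: "\<And>x. x \<in> \<Omega> \<Longrightarrow> deg x \<le> c" and c0: "0 \<le> c"
begin

lemma shifted_power_nonneg: "x \<in> \<Omega> \<Longrightarrow> 0 \<le> shifted_power c \<Omega> n x y"
  by (induction n arbitrary: x) (auto intro!: sum_nonneg mult_nonneg_nonneg shifted_laplacian_nonneg c)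

lemma shifted_power_le: "x \<in> \<Omega> \<Longrightarrow> shifted_power c \<Omega> n x y \<le> c ^ n / \<mu> y"
proof (induction n arbitrary: x)
  case (Suc n)
  have "shifted_power c \<Omega> (Suc n) x y \<le> (\<Sum>z\<in>\<Omega>. shifted_laplacian c x z * (c ^ n / \<mu> y))"
    unfolding shifted_power.simps by (intro sum_mono mult_left_mono shifted_laplacian_nonneg c Suc)
  also have "\<dots> \<le> c * (c ^ n / \<mu> y)"
    unfolding sum_distrib_right[symmetric]
    by (intro mult_right_mono sum_shifted_laplacian_le fin Suc.prems) (use c0 in auto)
  finally show ?case by simp
qed simp

lemma shifted_power_mass: "x \<in> \<Omega> \<Longrightarrow> (\<Sum>y\<in>\<Omega>. shifted_power c \<Omega> n x y * \<mu> y) \<le> c ^ n"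
proof (induction n arbitrary: x)
  case 0
  have "(\<Sum>y\<in>\<Omega>. (if x = y then 1 / \<mu> y else 0) * \<mu> y) = (\<Sum>y\<in>\<Omega>. (if x = y then 1 else 0))"
    by (intro sum.cong) auto
  then show ?case using 0 fin by simp
next
  case (Suc n)
  have "(\<Sum>y\<in>\<Omega>. shifted_power c \<Omega> (Suc n) x y * \<mu> y) =
      (\<Sum>z\<in>\<Omega>. shifted_laplacian c x z * (\<Sum>y\<in>\<Omega>. shifted_power c \<Omega> n z y * \<mu> y))"
    by (simp add: sum_distrib_left sum_distrib_right mult.assoc) (rule sum.swap)
  also have "\<dots> \<le> (\<Sum>z\<in>\<Omega>. shifted_laplacian c x z * c ^ n)"
    by (intro sum_mono mult_left_mono shifted_laplacian_nonneg c Suc)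
  also have "\<dots> \<le> c * c ^ n"
    unfolding sum_distrib_right[symmetric]
    by (intro mult_right_mono sum_shifted_laplacian_le fin Suc.prems) (use c0 in auto)
  finally show ?case by simp
qed

lemma shifted_power_semigroup:
  "x \<in> \<Omega> \<Longrightarrow> shifted_power c \<Omega> (m + n) x y =
    (\<Sum>z\<in>\<Omega>. shifted_power c \<Omega> m x z * shifted_power c \<Omega> n z y * \<mu> z)"
proof (induction m arbitrary: x)
  case 0
  have "(\<Sum>z\<in>\<Omega>. (if x = z then 1 / \<mu> z else 0) * shifted_power c \<Omega> n z y * \<mu> z) =
      (\<Sum>z\<in>\<Omega>. if x = z then shifted_power c \<Omega> n z y else 0)"
    by (intro sum.cong) auto
  then show ?case using 0 fin by simp
next
  case (Suc m)
  have "shifted_power c \<Omega> (Suc m + n) x y = (\<Sum>w\<in>\<Omega>. shifted_laplacian c x w *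
     (\<Sum>z\<in>\<Omega>. shifted_power c \<Omega> m w z * shifted_power c \<Omega> n z y * \<mu> z))"
    using Suc.IH by simp
  also have "\<dots> = (\<Sum>z\<in>\<Omega>. (\<Sum>w\<in>\<Omega>. shifted_laplacian c x w * shifted_power c \<Omega> m w z) *
      shifted_power c \<Omega> n z y * \<mu> z)"
    by (simp add: sum_distrib_left sum_distrib_right mult.assoc) (rule sum.swap)
  finally show ?case by simp
qed

lemma shifted_power_one:
  assumes "x \<in> \<Omega>" "y \<in> \<Omega>"
  shows "shifted_power c \<Omega> 1 x y = shifted_laplacian c x y / \<mu> y"
proof -
  have "(\<Sum>z\<in>\<Omega>. shifted_laplacian c x z * (if z = y then 1 / \<mu> y else 0)) =
     (\<Sum>z\<in>\<Omega>. if z = y then shifted_laplacian c x z / \<mu> y else 0)"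
    by (intro sum.cong) auto
  thus ?thesis using assms fin by simp
qed

text \<open>The first power is symmetric because the measure is divided out in both variables. In
  the induction one factor is split off at the left end and put back at the right end.\<close>

lemma shifted_power_sym:
  "x \<in> \<Omega> \<Longrightarrow> y \<in> \<Omega> \<Longrightarrow> shifted_power c \<Omega> n x y = shifted_power c \<Omega> n y x"
proof (induction n arbitrary: x y)
  case (Suc n)
  have one: "shifted_power c \<Omega> 1 x z = shifted_power c \<Omega> 1 z x" if "x \<in> \<Omega>" "z \<in> \<Omega>" for x z
    using that by (simp only: shifted_power_one) (auto simp: shifted_laplacian_def weight_sym mult.commute)
  have "shifted_power c \<Omega> (1 + n) x y =
      (\<Sum>z\<in>\<Omega>. shifted_power c \<Omega> 1 x z * shifted_power c \<Omega> n z y * \<mu> z)"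
    using Suc.prems by (intro shifted_power_semigroup)
  also have "\<dots> = (\<Sum>z\<in>\<Omega>. shifted_power c \<Omega> n y z * shifted_power c \<Omega> 1 z x * \<mu> z)"
    by (intro sum.cong refl) (use one Suc in \<open>simp del: shifted_power.simps\<close>)
  also have "\<dots> = shifted_power c \<Omega> (n + 1) y x"
    using Suc.prems by (intro shifted_power_semigroup[symmetric])
  finally show ?case by simp
qed simp

lemma summable_shifted_power:
  assumes "x \<in> \<Omega>"
  shows "summable (\<lambda>n. norm (t ^ n / fact n * shifted_power c \<Omega> n x y))"
proof (rule summable_comparison_test')
  show "summable (\<lambda>n. inverse (fact n) * (\<bar>t\<bar> * c) ^ n * (1 / \<mu> y))"
    by (intro summable_mult2 summable_exp)
  show "norm (norm (t ^ n / fact n * shifted_power c \<Omega> n x y)) \<le>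
      inverse (fact n) * (\<bar>t\<bar> * c) ^ n * (1 / \<mu> y)" if "n \<ge> 0" for n
  proof -
    have "\<bar>t\<bar> ^ n / fact n * shifted_power c \<Omega> n x y \<le> \<bar>t\<bar> ^ n / fact n * (c ^ n / \<mu> y)"
      by (intro mult_left_mono shifted_power_le assms) auto
    thus ?thesis
      using shifted_power_nonneg[OF assms, of n y]
      by (simp add: abs_mult power_abs power_mult_distrib field_simps)
  qed
qed

text \<open>Cauchy product of the shifted series with the series of exp(-ct). The defining series
  has terms of no fixed sign; after the shift all terms are nonnegative for t \<ge> 0.\<close>

lemma dirichlet_heat_kernel_eq:
  assumes "x \<in> \<Omega>" "y \<in> \<Omega>"
  shows "dirichlet_heat_kernel \<mu> \<omega> \<Omega> x y t =
    exp (- c * t) * (\<Sum>n. t ^ n / fact n * shifted_power c \<Omega> n x y)"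
proof -
  have "(\<lambda>n. \<Sum>k\<le>n. (t ^ k / fact k * shifted_power c \<Omega> k x y) *
      ((- c * t) ^ (n - k) /\<^sub>R fact (n - k))) sums
      ((\<Sum>n. t ^ n / fact n * shifted_power c \<Omega> n x y) * (\<Sum>n. (- c * t) ^ n /\<^sub>R fact n))"
    by (rule Cauchy_product_sums[OF summable_shifted_power[OF assms(1)] summable_norm_exp])
  moreover have "(\<Sum>k\<le>n. (t ^ k / fact k * shifted_power c \<Omega> k x y) *
      ((- c * t) ^ (n - k) /\<^sub>R fact (n - k))) = t ^ n / fact n * shifted_power 0 \<Omega> n x y" for n
  proof -
    have "t ^ n / fact n * shifted_power 0 \<Omega> n x y =
        t ^ n * (shifted_power (c + (- c)) \<Omega> n x y / fact n)"
      by simp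
    also have "\<dots> = t ^ n * (\<Sum>k\<le>n. shifted_power c \<Omega> k x y / fact k * ((- c) ^ (n - k) / fact (n - k)))"
      by (subst shifted_power_add[OF fin assms(1)]) simp
    also have "\<dots> = (\<Sum>k\<le>n. (t ^ k / fact k * shifted_power c \<Omega> k x y) *
      ((- c * t) ^ (n - k) /\<^sub>R fact (n - k)))"
    proof (unfold sum_distrib_left, intro sum.cong refl)
      fix k assume "k \<in> {..n}"
      hence t: "t ^ n = t ^ k * t ^ (n - k)" by (simp add: power_add[symmetric])
      show "t ^ n * (shifted_power c \<Omega> k x y / fact k * ((- c) ^ (n - k) / fact (n - k))) =
        (t ^ k / fact k * shifted_power c \<Omega> k x y) * ((- c * t) ^ (n - k) /\<^sub>R fact (n - k))"
        unfolding t power_mult_distrib by (simp add: divide_simps)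
    qed
    finally show ?thesis ..
  qed
  ultimately have "(\<lambda>n. t ^ n / fact n * shifted_power 0 \<Omega> n x y) sums
      ((\<Sum>n. t ^ n / fact n * shifted_power c \<Omega> n x y) * exp (- c * t))"
    by (simp add: exp_def)
  thus ?thesis
    unfolding dirichlet_heat_kernel_def dirichlet_laplacian_power[OF fin assms(2)]
    using assms by (simp add: sums_iff mult.commute)
qed

end

abbreviation "dirichlet_kernel \<equiv> dirichlet_heat_kernel \<mu> \<omega>"

context
  fixes \<Omega> :: "'a set" and c :: real
  assumes fin: "finite \<Omega>" and c: "\<And>x. x \<in> \<Omega> \<Longrightarrow> deg x \<le> c" and c0: "0 \<le> c"
begin

text \<open>All terms being nonnegative, one of them is a lower bound: \<open>n = 0\<close> gives
  the on-diagonal estimate, \<open>n = 1\<close> positivity across an edge.\<close>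

lemma dirichlet_kernel_ge_term:
  assumes "x \<in> \<Omega>" "y \<in> \<Omega>" "0 \<le> t"
  shows "exp (- c * t) * (t ^ n / fact n * shifted_power c \<Omega> n x y) \<le> dirichlet_kernel \<Omega> x y t"
proof -
  have "(\<Sum>i\<in>{n}. t ^ i / fact i * shifted_power c \<Omega> i x y) \<le>
      (\<Sum>i. t ^ i / fact i * shifted_power c \<Omega> i x y)"
    using summable_norm_cancel[OF summable_shifted_power[OF fin c c0 assms(1)]]
      shifted_power_nonneg[OF fin c c0 assms(1)] assms(3)
    by (intro sum_le_suminf) (auto intro!: mult_nonneg_nonneg)
  hence "exp (- c * t) * (\<Sum>i\<in>{n}. t ^ i / fact i * shifted_power c \<Omega> i x y) \<le>
      exp (- c * t) * (\<Sum>i. t ^ i / fact i * shifted_power c \<Omega> i x y)"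
    by (rule mult_left_mono) simp
  thus ?thesis
    by (simp add: dirichlet_heat_kernel_eq[OF fin c c0 assms(1,2)])
qed

end

context
  fixes \<Omega> :: "'a set"
  assumes fin: "finite \<Omega>"
begin

private abbreviation (input) "c \<equiv> degree_bound \<Omega>"

lemmas kernel_facts = fin deg_le_degree_bound[OF fin] degree_bound_nonneg[of \<Omega>]

lemma dirichlet_kernel_nonneg:
  assumes "x \<in> \<Omega>" "y \<in> \<Omega>" "0 \<le> t"
  shows "0 \<le> dirichlet_kernel \<Omega> x y t"
  by (rule order_trans[OF _ dirichlet_kernel_ge_term[OF kernel_facts, where n = 0]])
    (use assms in \<open>auto\<close>)

lemma dirichlet_kernel_sym:
  assumes "x \<in> \<Omega>" "y \<in> \<Omega>"
  shows "dirichlet_kernel \<Omega> x y t = dirichlet_kernel \<Omega> y x t"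
  using assms
  by (simp add: dirichlet_heat_kernel_eq[OF kernel_facts] shifted_power_sym[OF kernel_facts, of x y])

text \<open>The n-th power has row mass at most c^n, so the series sums to at most exp(ct), which
  the prefactor cancels.\<close>

lemma dirichlet_kernel_mass:
  assumes "x \<in> \<Omega>" "0 \<le> t"
  shows "(\<Sum>y\<in>\<Omega>. dirichlet_kernel \<Omega> x y t * \<mu> y) \<le> 1"
proof -
  note summ = summable_norm_cancel[OF summable_shifted_power[OF kernel_facts assms(1)]]
  have "(\<Sum>y\<in>\<Omega>. dirichlet_kernel \<Omega> x y t * \<mu> y) =
      exp (- c * t) * (\<Sum>y\<in>\<Omega>. \<Sum>n. t ^ n / fact n * shifted_power c \<Omega> n x y * \<mu> y)"
    using assms summ
    by (simp add: dirichlet_heat_kernel_eq[OF kernel_facts] sum_distrib_left mult.assoc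
        suminf_mult2[symmetric])
      (simp add: suminf_mult2 mult.assoc)
  also have "(\<Sum>y\<in>\<Omega>. \<Sum>n. t ^ n / fact n * shifted_power c \<Omega> n x y * \<mu> y) =
      (\<Sum>n. \<Sum>y\<in>\<Omega>. t ^ n / fact n * shifted_power c \<Omega> n x y * \<mu> y)"
    by (rule suminf_sum[symmetric]) (intro summable_mult2 summ)
  also have "\<dots> \<le> (\<Sum>n. (c * t) ^ n /\<^sub>R fact n)"
  proof (rule suminf_le)
    fix n
    have "(\<Sum>y\<in>\<Omega>. t ^ n / fact n * shifted_power c \<Omega> n x y * \<mu> y) =
        t ^ n / fact n * (\<Sum>y\<in>\<Omega>. shifted_power c \<Omega> n x y * \<mu> y)"
      by (simp add: sum_distrib_left mult.assoc)
    also have "\<dots> \<le> t ^ n / fact n * c ^ n"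
      by (intro mult_left_mono shifted_power_mass[OF kernel_facts]) (use assms in auto)
    finally show "(\<Sum>y\<in>\<Omega>. t ^ n / fact n * shifted_power c \<Omega> n x y * \<mu> y) \<le> (c * t) ^ n /\<^sub>R fact n"
      by (simp add: power_mult_distrib field_simps)
    show "summable (\<lambda>n. (c * t) ^ n /\<^sub>R fact n)"
      by (rule summable_exp_generic)
  qed (intro summable_sum summable_mult2 summ)
  also have "\<dots> = exp (c * t)"
    by (simp add: exp_def)
  finally show ?thesis
    by (simp add: exp_minus field_simps)
qed

lemma dirichlet_kernel_le:
  assumes "x \<in> \<Omega>" "y \<in> \<Omega>" "0 \<le> t"
  shows "dirichlet_kernel \<Omega> x y t \<le> 1 / \<mu> y"
proof -
  have "(\<Sum>y\<in>{y}. dirichlet_kernel \<Omega> x y t * \<mu> y) \<le> (\<Sum>y\<in>\<Omega>. dirichlet_kernel \<Omega> x y t * \<mu> y)"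
    by (rule sum_mono2) (use assms fin dirichlet_kernel_nonneg in auto)
  also note dirichlet_kernel_mass[OF assms(1,3)]
  finally show ?thesis by (simp add: measure_pos field_simps)
qed

text \<open>In the product of the two series the sum over \<open>z\<close> collapses by
  \<open>shifted_power_semigroup\<close> to something independent of \<open>k\<close>, leaving the
  binomial expansion of (s + t)^n.\<close>

lemma dirichlet_kernel_semigroup:
  assumes "x \<in> \<Omega>" "y \<in> \<Omega>"
  shows "dirichlet_kernel \<Omega> x y (s + t) =
    (\<Sum>z\<in>\<Omega>. dirichlet_kernel \<Omega> x z s * dirichlet_kernel \<Omega> z y t * \<mu> z)"
proof -
  define a where "a z n = s ^ n / fact n * shifted_power c \<Omega> n x z" for z n
  define b where "b z n = t ^ n / fact n * shifted_power c \<Omega> n z y" for z n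
  have "(\<lambda>n. \<Sum>z\<in>\<Omega>. (\<Sum>k\<le>n. a z k * b z (n - k)) * \<mu> z) sums
      (\<Sum>z\<in>\<Omega>. (suminf (a z) * suminf (b z)) * \<mu> z)"
    unfolding a_def b_def
    by (intro sums_sum sums_mult2 Cauchy_product_sums summable_shifted_power[OF kernel_facts] assms)
  moreover have "(\<Sum>z\<in>\<Omega>. (\<Sum>k\<le>n. a z k * b z (n - k)) * \<mu> z) =
      (s + t) ^ n / fact n * shifted_power c \<Omega> n x y" for n
  proof -
    have "(\<Sum>z\<in>\<Omega>. (\<Sum>k\<le>n. a z k * b z (n - k)) * \<mu> z) =
        (\<Sum>k\<le>n. s ^ k / fact k * (t ^ (n - k) / fact (n - k)) *
          (\<Sum>z\<in>\<Omega>. shifted_power c \<Omega> k x z * shifted_power c \<Omega> (n - k) z y * \<mu> z))"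
      unfolding a_def b_def sum_distrib_right sum_distrib_left
      by (subst sum.swap) (simp add: mult_ac)
    also have "\<dots> = (\<Sum>k\<le>n. s ^ k / fact k * (t ^ (n - k) / fact (n - k)) * shifted_power c \<Omega> n x y)"
      by (intro sum.cong refl, subst shifted_power_semigroup[OF kernel_facts assms(1), symmetric]) auto
    also have "\<dots> = (\<Sum>k\<le>n. of_nat (n choose k) * s ^ k * t ^ (n - k)) / fact n * shifted_power c \<Omega> n x y"
      unfolding sum_distrib_right[symmetric] sum_divide_distrib
      by (intro arg_cong2[where f="(*)"] sum.cong refl) (simp add: binomial_fact)
    finally show ?thesis by (simp add: binomial_ring)
  qed
  ultimately have "(\<Sum>n. (s + t) ^ n / fact n * shifted_power c \<Omega> n x y) =
      (\<Sum>z\<in>\<Omega>. (suminf (a z) * suminf (b z)) * \<mu> z)"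
    by (simp add: sums_iff)
  moreover have "dirichlet_kernel \<Omega> x z s = exp (- c * s) * suminf (a z)"
    "dirichlet_kernel \<Omega> z y t = exp (- c * t) * suminf (b z)" if "z \<in> \<Omega>" for z
    using that assms unfolding a_def b_def by (simp_all add: dirichlet_heat_kernel_eq[OF kernel_facts])
  ultimately show ?thesis
    using assms
    by (simp add: dirichlet_heat_kernel_eq[OF kernel_facts, of x y] sum_distrib_left exp_add[symmetric]
        exp_diff exp_minus divide_inverse mult_ac distrib_left[symmetric] cong: sum.cong)
      (simp add: exp_add distrib_right mult_ac)
qed

end

section \<open>Monotonicity in the domain\<close>

lemma shifted_power_mono:
  assumes "finite \<Omega>'" "\<Omega> \<subseteq> \<Omega>'" "\<And>x. x \<in> \<Omega>' \<Longrightarrow> deg x \<le> c" "0 \<le> c" "x \<in> \<Omega>"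
  shows "shifted_power c \<Omega> n x y \<le> shifted_power c \<Omega>' n x y"
  using assms(5)
proof (induction n arbitrary: x)
  case (Suc n)
  have "(\<Sum>z\<in>\<Omega>. shifted_laplacian c x z * shifted_power c \<Omega> n z y) \<le>
     (\<Sum>z\<in>\<Omega>. shifted_laplacian c x z * shifted_power c \<Omega>' n z y)"
    by (intro sum_mono mult_left_mono Suc.IH shifted_laplacian_nonneg) (use assms Suc in auto)
  also have "\<dots> \<le> (\<Sum>z\<in>\<Omega>'. shifted_laplacian c x z * shifted_power c \<Omega>' n z y)"
    by (intro sum_mono2 mult_nonneg_nonneg shifted_laplacian_nonneg
        shifted_power_nonneg[OF assms(1,3,4)])
      (use assms Suc in auto)
  finally show ?case by simp
qed simp

text \<open>Both kernels are expanded with the same shift, the one of the larger set, so that the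
  prefactors agree and the series compare term by term.\<close>

lemma dirichlet_kernel_mono:
  assumes "finite \<Omega>'" "\<Omega> \<subseteq> \<Omega>'" "x \<in> \<Omega>" "y \<in> \<Omega>" "0 \<le> t"
  shows "dirichlet_kernel \<Omega> x y t \<le> dirichlet_kernel \<Omega>' x y t"
proof -
  let ?c = "degree_bound \<Omega>'"
  have fin: "finite \<Omega>" using assms finite_subset by blast
  note facts' = assms(1) deg_le_degree_bound[OF assms(1)] degree_bound_nonneg[of \<Omega>']
  have facts: "\<And>x. x \<in> \<Omega> \<Longrightarrow> deg x \<le> ?c" using facts'(2) assms(2) by blast
  have "(\<Sum>n. t ^ n / fact n * shifted_power ?c \<Omega> n x y) \<le>
      (\<Sum>n. t ^ n / fact n * shifted_power ?c \<Omega>' n x y)"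
    by (intro suminf_le mult_left_mono shifted_power_mono assms facts'
        summable_norm_cancel[OF summable_shifted_power[OF fin facts facts'(3)]]
        summable_norm_cancel[OF summable_shifted_power[OF facts']]) (use assms in auto)
  hence "exp (- ?c * t) * (\<Sum>n. t ^ n / fact n * shifted_power ?c \<Omega> n x y) \<le>
      exp (- ?c * t) * (\<Sum>n. t ^ n / fact n * shifted_power ?c \<Omega>' n x y)"
    by (rule mult_left_mono) simp
  moreover have "x \<in> \<Omega>'" "y \<in> \<Omega>'" using assms by auto
  ultimately show ?thesis
    using dirichlet_heat_kernel_eq[OF fin facts facts'(3) assms(3,4)]
      dirichlet_heat_kernel_eq[OF facts'] by simp
qed

section \<open>The heat kernel\<close>

abbreviation "hk \<equiv> heat_kernel \<mu> \<omega>"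

lemma bdd_above_dirichlet_kernel:
  "0 \<le> t \<Longrightarrow> bdd_above ((\<lambda>\<Omega>. dirichlet_kernel \<Omega> x y t) ` {\<Omega>. finite \<Omega> \<and> x \<in> \<Omega> \<and> y \<in> \<Omega>})"
  by (rule bdd_aboveI2[where M = "1 / \<mu> y"]) (auto intro: dirichlet_kernel_le)

lemma dirichlet_kernel_le_kernel:
  "finite \<Omega> \<Longrightarrow> x \<in> \<Omega> \<Longrightarrow> y \<in> \<Omega> \<Longrightarrow> 0 \<le> t \<Longrightarrow> dirichlet_kernel \<Omega> x y t \<le> hk x y t"
  unfolding heat_kernel_def by (rule cSUP_upper[OF _ bdd_above_dirichlet_kernel]) auto

lemma eventually_superset: "finite F \<Longrightarrow> eventually (\<lambda>\<Omega>. finite \<Omega> \<and> F \<subseteq> \<Omega>) (finite_subsets_at_top UNIV)"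
  unfolding eventually_finite_subsets_at_top by (intro exI[of _ F]) auto

text \<open>Monotonicity turns the supremum into a limit along the finite sets, through which
  identities and inequalities for finite sets pass.\<close>

lemma dirichlet_kernel_tendsto:
  assumes "0 \<le> t"
  shows "((\<lambda>\<Omega>. dirichlet_kernel \<Omega> x y t) \<longlongrightarrow> hk x y t) (finite_subsets_at_top UNIV)"
proof (rule order_tendstoI)
  fix a assume "a < hk x y t"
  then obtain \<Omega>0 where \<Omega>0: "finite \<Omega>0" "x \<in> \<Omega>0" "y \<in> \<Omega>0" "a < dirichlet_kernel \<Omega>0 x y t"
    unfolding heat_kernel_def
    using less_cSUP_iff[OF _ bdd_above_dirichlet_kernel[OF assms, of x y], of a] by auto
  show "\<forall>\<^sub>F \<Omega> in finite_subsets_at_top UNIV. a < dirichlet_kernel \<Omega> x y t"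
    using eventually_superset[OF \<Omega>0(1)]
  proof eventually_elim
    case (elim \<Omega>)
    show ?case
      by (rule less_le_trans[OF \<Omega>0(4) dirichlet_kernel_mono]) (use elim \<Omega>0 assms in auto)
  qed
next
  fix a assume a: "hk x y t < a"
  show "\<forall>\<^sub>F \<Omega> in finite_subsets_at_top UNIV. dirichlet_kernel \<Omega> x y t < a"
    using eventually_superset[of "{x, y}", simplified]
    by (rule eventually_mono) (auto intro: le_less_trans[OF dirichlet_kernel_le_kernel a] assms)
qed

lemma kernel_nonneg: "0 \<le> t \<Longrightarrow> 0 \<le> hk x y t"
  by (rule order_trans[OF dirichlet_kernel_nonneg dirichlet_kernel_le_kernel, of "{x, y}" x y t]) auto

lemma kernel_le:
  assumes "0 \<le> t" shows "hk x y t \<le> 1 / \<mu> y"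
  unfolding heat_kernel_def
proof (rule cSUP_least)
  show "{\<Omega>. finite \<Omega> \<and> x \<in> \<Omega> \<and> y \<in> \<Omega>} \<noteq> {}"
    using finite.emptyI by (auto intro!: exI[of _ "{x, y}"])
qed (use assms dirichlet_kernel_le in auto)

lemma kernel_sym:
  assumes "0 \<le> t"
  shows "hk x y t = hk y x t"
proof (rule tendsto_unique[OF finite_subsets_at_top_neq_bot dirichlet_kernel_tendsto[OF assms]])
  show "((\<lambda>\<Omega>. dirichlet_kernel \<Omega> x y t) \<longlongrightarrow> hk y x t) (finite_subsets_at_top UNIV)"
    using dirichlet_kernel_tendsto[OF assms, of y x]
    by (rule Lim_transform_eventually)
      (use eventually_superset[of "{x, y}"] in \<open>auto elim!: eventually_mono simp: dirichlet_kernel_sym[of _ x y]\<close>)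
qed

text \<open>Two inequalities. A sum over a fixed finite \<open>F\<close> is bounded by the Dirichlet
  identity on larger sets, dropping nonnegative terms; conversely, the Dirichlet identity on
  \<Omega> is bounded termwise by the full kernels.\<close>

lemma kernel_semigroup:
  assumes "0 \<le> s" "0 \<le> t"
  shows "((\<lambda>z. hk x z s * hk z y t * \<mu> z) has_sum hk x y (s + t)) UNIV"
proof -
  let ?f = "\<lambda>z. hk x z s * hk z y t * \<mu> z"
  have nonneg: "0 \<le> ?f z" for z
    using assms by (simp add: kernel_nonneg)
  have le: "sum ?f F \<le> hk x y (s + t)" if F: "finite F" for F
  proof (rule tendsto_le[OF finite_subsets_at_top_neq_bot tendsto_const])
    show "((\<lambda>\<Omega>. \<Sum>z\<in>F. dirichlet_kernel \<Omega> x z s * dirichlet_kernel \<Omega> z y t * \<mu> z) \<longlongrightarrow> sum ?f F)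
        (finite_subsets_at_top UNIV)"
      by (intro tendsto_intros dirichlet_kernel_tendsto assms)
    have "finite (insert x (insert y F))" using F by simp
    from eventually_superset[OF this]
    show "\<forall>\<^sub>F \<Omega> in finite_subsets_at_top UNIV.
       (\<Sum>z\<in>F. dirichlet_kernel \<Omega> x z s * dirichlet_kernel \<Omega> z y t * \<mu> z) \<le> hk x y (s + t)"
    proof eventually_elim
      case (elim \<Omega>)
      have "(\<Sum>z\<in>F. dirichlet_kernel \<Omega> x z s * dirichlet_kernel \<Omega> z y t * \<mu> z) \<le>
         (\<Sum>z\<in>\<Omega>. dirichlet_kernel \<Omega> x z s * dirichlet_kernel \<Omega> z y t * \<mu> z)"
        using elim assms by (intro sum_mono2) (auto intro!: mult_nonneg_nonneg dirichlet_kernel_nonneg)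
      also have "\<dots> = dirichlet_kernel \<Omega> x y (s + t)"
        using elim by (intro dirichlet_kernel_semigroup[symmetric]) auto
      also have "\<dots> \<le> hk x y (s + t)"
        using elim assms by (intro dirichlet_kernel_le_kernel) auto
      finally show ?case .
    qed
  qed
  have summ: "?f summable_on UNIV"
    by (rule nonneg_bdd_above_summable_on[OF nonneg])
      (auto intro!: bdd_aboveI2[where M="hk x y (s + t)"] le)
  have "infsum ?f UNIV \<le> hk x y (s + t)"
    by (rule infsum_le_finite_sums[OF summ le])
  moreover have "hk x y (s + t) \<le> infsum ?f UNIV"
  proof (rule tendsto_le[OF finite_subsets_at_top_neq_bot tendsto_const dirichlet_kernel_tendsto])
    show "\<forall>\<^sub>F \<Omega> in finite_subsets_at_top UNIV. dirichlet_kernel \<Omega> x y (s + t) \<le> infsum ?f UNIV"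
      using eventually_superset[of "{x, y}", simplified]
    proof eventually_elim
      case (elim \<Omega>)
      have "dirichlet_kernel \<Omega> x y (s + t) =
          (\<Sum>z\<in>\<Omega>. dirichlet_kernel \<Omega> x z s * dirichlet_kernel \<Omega> z y t * \<mu> z)"
        using elim by (intro dirichlet_kernel_semigroup) auto
      also have "\<dots> \<le> sum ?f \<Omega>"
        using elim assms
        by (intro sum_mono mult_mono dirichlet_kernel_le_kernel mult_nonneg_nonneg
            kernel_nonneg dirichlet_kernel_nonneg) auto
      also have "\<dots> \<le> infsum ?f UNIV"
        using elim nonneg by (intro finite_sum_le_infsum[OF summ]) auto
      finally show ?case .
    qed
  qed (use assms in auto)
  ultimately have "infsum ?f UNIV = hk x y (s + t)"
    by (rule antisym)
  thus ?thesis
    using has_sum_infsum[OF summ] by simp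
qed

lemma kernel_semigroup_ge:
  assumes "0 \<le> s" "0 \<le> t"
  shows "hk x z s * hk z y t * \<mu> z \<le> hk x y (s + t)"
proof -
  have "(\<Sum>z\<in>{z}. hk x z s * hk z y t * \<mu> z) \<le> hk x y (s + t)"
    by (rule finite_sum_le_has_sum[OF kernel_semigroup[OF assms]])
      (auto intro!: mult_nonneg_nonneg kernel_nonneg assms)
  thus ?thesis by simp
qed

text \<open>On the one-point set the Dirichlet semigroup is multiplication by
  exp(-\<open>deg x\<close> t), the probability of not yet having left \<open>x\<close>. All
  small-time estimates below start from this.\<close>

lemma exp_deg_le_kernel:
  assumes "0 \<le> t"
  shows "exp (- deg x * t) \<le> hk x x t * \<mu> x"
proof -
  have "exp (- deg x * t) * (t ^ 0 / fact 0 * shifted_power (deg x) {x} 0 x x) \<le> dirichlet_kernel {x} x x t"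
    by (rule dirichlet_kernel_ge_term) (use assms deg_nonneg in auto)
  also have "\<dots> \<le> hk x x t"
    by (rule dirichlet_kernel_le_kernel) (use assms in auto)
  finally show ?thesis
    using measure_pos[of x] by (simp add: divide_simps)
qed

text \<open>Positivity holds on the diagonal and across an edge, the latter from the linear term on
  a two-point set. It is chained along a path by the semigroup inequality, halving the time at each
  step.\<close>

lemma kernel_pos:
  assumes "0 < t"
  shows "0 < hk x y t"
proof -
  have diag: "0 < hk x x s" if "0 < s" for x s
  proof -
    have "0 < hk x x s * \<mu> x"
      using that by (intro less_le_trans[OF _ exp_deg_le_kernel]) auto
    thus ?thesis using measure_pos[of x] by (simp add: zero_less_mult_iff)
  qed
  have edge: "0 < hk x y s" if "0 < \<omega> x y" "0 < s" for x y s
  proof -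
    have xy: "x \<noteq> y" using that weight_irrefl[of x] by auto
    let ?c = "degree_bound {x, y}"
    have c: "\<And>z. z \<in> {x, y} \<Longrightarrow> deg z \<le> ?c" by (rule deg_le_degree_bound) auto
    have "shifted_power ?c {x, y} 1 x y = shifted_laplacian ?c x y / \<mu> y"
      by (rule shifted_power_one[OF _ c degree_bound_nonneg]) auto
    hence pos: "0 < shifted_power ?c {x, y} 1 x y"
      using xy that measure_pos by (simp add: shifted_laplacian_def)
    have "0 < exp (- ?c * s) * (s ^ 1 / fact 1 * shifted_power ?c {x, y} 1 x y)"
      using that pos by simp
    also have "\<dots> \<le> dirichlet_kernel {x, y} x y s"
      by (rule dirichlet_kernel_ge_term[OF _ c degree_bound_nonneg]) (use that in auto)
    also have "\<dots> \<le> hk x y s"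
      by (rule dirichlet_kernel_le_kernel) (use that in auto)
    finally show ?thesis .
  qed
  have "(\<lambda>a b. \<omega> a b > 0)\<^sup>*\<^sup>* x y" by (rule graph_connected)
  thus ?thesis using assms
  proof (induction arbitrary: t rule: rtranclp_induct)
    case base
    thus ?case by (rule diag)
  next
    case (step y z)
    have "0 < hk x y (t/2) * hk y z (t/2) * \<mu> y"
      using step.IH[of "t/2"] edge[OF step.hyps(2), of "t/2"] step.prems measure_pos by simp
    also have "\<dots> \<le> hk x z (t/2 + t/2)"
      by (rule kernel_semigroup_ge) (use step.prems in auto)
    finally show ?case by simp
  qed
qed

end

section \<open>The heat semigroup on bounded functions\<close>

lemma summable_on_real_bound:
  fixes f g :: "'b \<Rightarrow> real"
  assumes "g summable_on A" "\<And>x. x \<in> A \<Longrightarrow> \<bar>f x\<bar> \<le> g x"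
  shows "f summable_on A" "\<bar>infsum f A\<bar> \<le> infsum g A"
proof -
  have abs: "(\<lambda>x. \<bar>f x\<bar>) summable_on A"
    by (rule summable_on_comparison_test[OF assms(1)]) (use assms in auto)
  show summ: "f summable_on A"
    using abs summable_on_iff_abs_summable_on_real[of f A] by simp
  have "\<bar>infsum f A\<bar> \<le> (\<Sum>\<^sub>\<infinity>x\<in>A. \<bar>f x\<bar>)"
    using norm_infsum_bound[of f A] abs by simp
  also have "\<dots> \<le> infsum g A"
    by (rule infsum_mono[OF abs assms])
  finally show "\<bar>infsum f A\<bar> \<le> infsum g A" .
qed

lemma infsum_diff_real:
  fixes f g :: "'b \<Rightarrow> real"
  assumes "f summable_on A" "g summable_on A"
  shows "(\<Sum>\<^sub>\<infinity>x\<in>A. f x - g x) = infsum f A - infsum g A"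
  using infsum_add[of f A "\<lambda>x. - g x"] assms
  by (simp add: infsum_uminus summable_on_uminus)

lemma has_sum_diff_real:
  fixes f g :: "'b \<Rightarrow> real"
  assumes "(f has_sum a) A" "(g has_sum b) A"
  shows "((\<lambda>x. f x - g x) has_sum (a - b)) A"
  using has_sum_add[OF assms(1), of "\<lambda>x. - g x" "- b"] assms(2)
  by (simp add: has_sum_uminus)

text \<open>Dominated convergence and measurability of limits concern sequences, while
  \<open>has_sum\<close> is a limit along finite sets. For countable index sets a cofinal sequence
  connects the two.\<close>

lemma exhaustion_sequence:
  assumes "countable (UNIV :: 'b set)"
  obtains \<Omega> :: "nat \<Rightarrow> 'b set" where "\<And>n. finite (\<Omega> n)"
    "filterlim \<Omega> (finite_subsets_at_top UNIV) sequentially"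
proof
  let ?\<Omega> = "\<lambda>n. from_nat_into (UNIV :: 'b set) ` {..<n}"
  show "finite (?\<Omega> n)" for n by simp
  show "filterlim ?\<Omega> (finite_subsets_at_top UNIV) sequentially"
    unfolding filterlim_finite_subsets_at_top
  proof safe
    fix X :: "'b set" assume "finite X"
    hence "eventually (\<lambda>n. \<forall>x\<in>X. to_nat_on UNIV x < n) sequentially"
      by (intro eventually_ball_finite) (auto intro: eventually_gt_at_top)
    thus "eventually (\<lambda>n. finite (?\<Omega> n) \<and> X \<subseteq> ?\<Omega> n \<and> ?\<Omega> n \<subseteq> UNIV) sequentially"
    proof eventually_elim
      case (elim n)
      have "x \<in> ?\<Omega> n" if "x \<in> X" for x
        using elim that assms from_nat_into_to_nat_on[of "UNIV :: 'b set" x]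
        by (intro image_eqI[of _ _ "to_nat_on UNIV x"]) auto
      thus ?case by auto
    qed
  qed
qed

lemma has_sum_imp_exhaustion:
  assumes "(f has_sum s) UNIV" "filterlim \<Omega> (finite_subsets_at_top UNIV) sequentially"
  shows "(\<lambda>n. sum f (\<Omega> n)) \<longlonglongrightarrow> s"
  using assms unfolding has_sum_def by (rule filterlim_compose)

lemma borel_measurable_infsum:
  fixes F :: "'b \<Rightarrow> 'c \<Rightarrow> real"
  assumes "countable (UNIV :: 'b set)"
    and meas: "\<And>y. F y \<in> borel_measurable M"
    and summ: "\<And>t. t \<in> space M \<Longrightarrow> (\<lambda>y. F y t) summable_on UNIV"
  shows "(\<lambda>t. \<Sum>\<^sub>\<infinity>y. F y t) \<in> borel_measurable M"
proof -
  obtain \<Omega> :: "nat \<Rightarrow> 'b set" where \<Omega>: "\<And>n. finite (\<Omega> n)"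
    "filterlim \<Omega> (finite_subsets_at_top UNIV) sequentially"
    using exhaustion_sequence[OF assms(1)] by blast
  show ?thesis
  proof (rule borel_measurable_LIMSEQ_metric)
    show "(\<lambda>t. \<Sum>y\<in>\<Omega> n. F y t) \<in> borel_measurable M" for n
      by (intro borel_measurable_sum meas)
    show "(\<lambda>n. \<Sum>y\<in>\<Omega> n. F y t) \<longlonglongrightarrow> (\<Sum>\<^sub>\<infinity>y. F y t)" if "t \<in> space M" for t
      by (rule has_sum_imp_exhaustion[OF has_sum_infsum[OF summ[OF that]] \<Omega>(2)])
  qed
qed

text \<open>The single function \<open>w\<close> bounds all finite sums of absolute values. It
  dominates the partial sums and also makes the integrals absolutely summable.\<close>

lemma has_sum_lebesgue_integral:
  fixes F :: "'b \<Rightarrow> 'c \<Rightarrow> real"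
  assumes cnt: "countable (UNIV :: 'b set)"
    and meas: "\<And>y. F y \<in> borel_measurable M"
    and w: "integrable M w"
    and bound: "\<And>A t. t \<in> space M \<Longrightarrow> finite A \<Longrightarrow> (\<Sum>y\<in>A. \<bar>F y t\<bar>) \<le> w t"
  shows "((\<lambda>y. \<integral>t. F y t \<partial>M) has_sum (\<integral>t. (\<Sum>\<^sub>\<infinity>y. F y t) \<partial>M)) UNIV"
    and "integrable M (\<lambda>t. \<Sum>\<^sub>\<infinity>y. F y t)"
proof -
  obtain \<Omega> :: "nat \<Rightarrow> 'b set" where \<Omega>: "\<And>n. finite (\<Omega> n)"
    "filterlim \<Omega> (finite_subsets_at_top UNIV) sequentially"
    using exhaustion_sequence[OF cnt] by blast
  have int: "integrable M (F y)" for y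
    by (rule Bochner_Integration.integrable_bound[OF w meas])
      (use bound[of _ "{y}"] in \<open>auto intro!: AE_I2 intro: order_trans[OF _ abs_ge_self]\<close>)
  have "(\<lambda>y. \<bar>F y t\<bar>) summable_on UNIV" if "t \<in> space M" for t
    by (rule nonneg_bdd_above_summable_on)
      (auto intro!: bdd_aboveI2[where M="w t"] bound that)
  hence summ: "(\<lambda>y. F y t) summable_on UNIV" if "t \<in> space M" for t
    using that summable_on_iff_abs_summable_on_real[of "\<lambda>y. F y t" UNIV] by simp
  have lim: "(\<lambda>n. \<Sum>y\<in>\<Omega> n. F y t) \<longlonglongrightarrow> (\<Sum>\<^sub>\<infinity>y. F y t)" if "t \<in> space M" for t
    by (rule has_sum_imp_exhaustion[OF has_sum_infsum[OF summ[OF that]] \<Omega>(2)])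
  have meas_inf: "(\<lambda>t. \<Sum>\<^sub>\<infinity>y. F y t) \<in> borel_measurable M"
    by (rule borel_measurable_infsum[OF cnt meas summ])
  have meas_n: "(\<lambda>t. \<Sum>y\<in>\<Omega> n. F y t) \<in> borel_measurable M" for n
    by (intro borel_measurable_sum meas)
  have ae_lim: "AE t in M. (\<lambda>n. \<Sum>y\<in>\<Omega> n. F y t) \<longlonglongrightarrow> (\<Sum>\<^sub>\<infinity>y. F y t)"
    using lim by (intro AE_I2)
  have ae_bound: "AE t in M. norm (\<Sum>y\<in>\<Omega> n. F y t) \<le> w t" for n
    using bound[OF _ \<Omega>(1)] by (auto intro!: AE_I2 intro: order_trans[OF sum_abs])
  note dct = meas_inf meas_n w ae_lim ae_bound
  show "integrable M (\<lambda>t. \<Sum>\<^sub>\<infinity>y. F y t)"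
    by (rule integrable_dominated_convergence[OF dct])
  have "(\<lambda>n. \<integral>t. (\<Sum>y\<in>\<Omega> n. F y t) \<partial>M) \<longlonglongrightarrow> (\<integral>t. (\<Sum>\<^sub>\<infinity>y. F y t) \<partial>M)"
    by (rule integral_dominated_convergence[OF dct])
  hence lim1: "(\<lambda>n. \<Sum>y\<in>\<Omega> n. \<integral>t. F y t \<partial>M) \<longlonglongrightarrow> (\<integral>t. (\<Sum>\<^sub>\<infinity>y. F y t) \<partial>M)"
    using int by simp
  \<comment> \<open>A limit along one exhaustion identifies the value of a sum but not its
    existence; the latter comes from this bound over arbitrary finite sets.\<close>
  have "(\<Sum>y\<in>A. \<bar>\<integral>t. F y t \<partial>M\<bar>) \<le> (\<integral>t. w t \<partial>M)" if "finite A" for A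
  proof -
    have "(\<Sum>y\<in>A. \<bar>\<integral>t. F y t \<partial>M\<bar>) \<le> (\<Sum>y\<in>A. \<integral>t. \<bar>F y t\<bar> \<partial>M)"
      using integral_norm_bound[of M] by (intro sum_mono) simp
    also have "\<dots> = (\<integral>t. (\<Sum>y\<in>A. \<bar>F y t\<bar>) \<partial>M)"
      using int by (simp add: Bochner_Integration.integral_sum)
    also have "\<dots> \<le> (\<integral>t. w t \<partial>M)"
      using int w bound that by (intro integral_mono) auto
    finally show ?thesis .
  qed
  hence "(\<lambda>y. \<bar>\<integral>t. F y t \<partial>M\<bar>) summable_on UNIV"
    by (intro nonneg_bdd_above_summable_on bdd_aboveI2[where M="\<integral>t. w t \<partial>M"]) auto
  hence "(\<lambda>y. \<integral>t. F y t \<partial>M) summable_on UNIV"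
    using summable_on_iff_abs_summable_on_real[of "\<lambda>y. \<integral>t. F y t \<partial>M" UNIV] by simp
  hence hs: "((\<lambda>y. \<integral>t. F y t \<partial>M) has_sum (\<Sum>\<^sub>\<infinity>y. \<integral>t. F y t \<partial>M)) UNIV"
    by (rule has_sum_infsum)
  from has_sum_imp_exhaustion[OF this \<Omega>(2)] lim1
  have "(\<Sum>\<^sub>\<infinity>y. \<integral>t. F y t \<partial>M) = (\<integral>t. (\<Sum>\<^sub>\<infinity>y. F y t) \<partial>M)"
    by (rule LIMSEQ_unique)
  with hs show "((\<lambda>y. \<integral>t. F y t \<partial>M) has_sum (\<integral>t. (\<Sum>\<^sub>\<infinity>y. F y t) \<partial>M)) UNIV"
    by simp
qed

section \<open>The semigroup under stochastic completeness and its regularity in time\<close>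

locale complete_weighted_graph = weighted_graph +
  assumes complete: "stochastically_complete \<mu> \<omega>"
begin

abbreviation "P \<equiv> heat_semigroup \<mu> \<omega>"

lemma kernel_mass: "0 < t \<Longrightarrow> ((\<lambda>y. hk x y t * \<mu> y) has_sum 1) UNIV"
  using complete unfolding stochastically_complete_def by blast

lemma kernel_mass_infsum: "0 < t \<Longrightarrow> (\<Sum>\<^sub>\<infinity>y. hk x y t * \<mu> y) = 1"
  using kernel_mass by (rule infsumI)

lemma kernel_mass_summable: "0 < t \<Longrightarrow> (\<lambda>y. hk x y t * \<mu> y) summable_on UNIV"
  using kernel_mass has_sum_imp_summable by blast

lemma P_bounded:
  assumes "0 < t" "\<And>y. \<bar>g y\<bar> \<le> C"
  shows P_summable: "(\<lambda>y. hk x y t * g y * \<mu> y) summable_on UNIV"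
    and P_abs_le: "\<bar>P t g x\<bar> \<le> C"
proof -
  have summ: "(\<lambda>y. C * (hk x y t * \<mu> y)) summable_on UNIV"
    by (intro summable_on_cmult_right kernel_mass_summable assms)
  have le: "\<bar>hk x y t * g y * \<mu> y\<bar> \<le> C * (hk x y t * \<mu> y)" for y
  proof -
    have "\<bar>hk x y t * g y * \<mu> y\<bar> = \<bar>g y\<bar> * (hk x y t * \<mu> y)"
      using kernel_nonneg[of t x y] assms(1) by (simp add: abs_mult)
    also have "\<dots> \<le> C * (hk x y t * \<mu> y)"
      using kernel_nonneg[of t x y] assms by (intro mult_right_mono mult_nonneg_nonneg) auto
    finally show ?thesis .
  qed
  show "(\<lambda>y. hk x y t * g y * \<mu> y) summable_on UNIV"
    by (rule summable_on_real_bound(1)[OF summ le])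
  show "\<bar>P t g x\<bar> \<le> C"
    using summable_on_real_bound(2)[OF summ le] assms(1)
    unfolding heat_semigroup_def by (simp add: infsum_cmult_right' kernel_mass_infsum)
qed

lemma P_nonneg: "0 \<le> t \<Longrightarrow> (\<And>y. 0 \<le> g y) \<Longrightarrow> 0 \<le> P t g x"
  unfolding heat_semigroup_def by (intro infsum_nonneg mult_nonneg_nonneg kernel_nonneg) auto

lemma P_diff:
  assumes "(\<lambda>y. hk x y t * g y * \<mu> y) summable_on UNIV" "(\<lambda>y. hk x y t * k y * \<mu> y) summable_on UNIV"
  shows "P t (\<lambda>y. g y - k y) x = P t g x - P t k x"
  unfolding heat_semigroup_def using infsum_diff_real[OF assms] by (simp add: algebra_simps)

lemma P_add:
  assumes "(\<lambda>y. hk x y t * g y * \<mu> y) summable_on UNIV" "(\<lambda>y. hk x y t * k y * \<mu> y) summable_on UNIV"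
  shows "P t (\<lambda>y. g y + k y) x = P t g x + P t k x"
  unfolding heat_semigroup_def using infsum_add[OF assms] by (simp add: algebra_simps)

lemma P_const: "0 < t \<Longrightarrow> P t (\<lambda>y. C) x = C"
  unfolding heat_semigroup_def
  using infsum_cmult_right'[of C "\<lambda>y. hk x y t * \<mu> y" UNIV]
  by (simp add: kernel_mass_infsum mult.assoc mult.left_commute[of C])

lemma P_cmult: "P t (\<lambda>y. C * g y) x = C * P t g x"
  unfolding heat_semigroup_def infsum_cmult_right'[symmetric] by (simp add: mult_ac)

text \<open>Both \<open>p(x,\<cdot>,t+h)\<close> and \<open>p(x,\<cdot>,t)\<close> dominate \<open>a p(x,\<cdot>,t)\<close> with \<open>a = p(x,x,h) \<mu>(x)\<close>, so they differ by
  at most \<open>2(1 - a)\<close> in \<open>\<ell>\<^sup>1\<close>.\<close>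

lemma kernel_diff:
  assumes "0 < t" "0 \<le> h"
  shows kernel_diff_summable: "(\<lambda>y. \<bar>hk x y (t + h) - hk x y t\<bar> * \<mu> y) summable_on UNIV"
    and kernel_diff_infsum: "(\<Sum>\<^sub>\<infinity>y. \<bar>hk x y (t + h) - hk x y t\<bar> * \<mu> y) \<le> 2 * deg x * h"
proof -
  define a where "a = hk x x h * \<mu> x"
  have a1: "a \<le> 1"
    using kernel_le[of h x x] measure_pos[of x] assms by (simp add: a_def field_simps)
  have a2: "1 - a \<le> deg x * h"
    using exp_deg_le_kernel[of h x] exp_ge_add_one_self[of "- deg x * h"] assms
    by (simp add: a_def)
  let ?f = "\<lambda>y. (hk x y (t + h) * \<mu> y - a * (hk x y t * \<mu> y)) + (1 - a) * (hk x y t * \<mu> y)"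
  have th: "0 < t + h" using assms by simp
  \<comment> \<open>Stochastic completeness gives both kernels mass exactly 1, so each of the two
    excesses has mass \<open>1 - a\<close>.\<close>
  have hs: "(?f has_sum ((1 - a * 1) + (1 - a) * 1)) UNIV"
    by (intro has_sum_add has_sum_cmult_right kernel_mass[OF assms(1)] has_sum_diff_real kernel_mass[OF th])
  have le: "\<bar>\<bar>hk x y (t + h) - hk x y t\<bar> * \<mu> y\<bar> \<le> ?f y" for y
  proof -
    have "a * hk x y t \<le> hk x y (t + h)"
      using kernel_semigroup_ge[of h t x x y] assms by (simp add: a_def add.commute mult_ac)
    moreover have "a * hk x y t \<le> hk x y t"
      using mult_right_mono[OF a1 kernel_nonneg[of t x y]] assms by simp
    ultimately have "\<bar>hk x y (t + h) - hk x y t\<bar> \<le>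
        (hk x y (t + h) - a * hk x y t) + (1 - a) * hk x y t"
      by (simp add: left_diff_distrib)
    hence "\<bar>hk x y (t + h) - hk x y t\<bar> * \<mu> y \<le>
        ((hk x y (t + h) - a * hk x y t) + (1 - a) * hk x y t) * \<mu> y"
      by (rule mult_right_mono) simp
    thus ?thesis by (simp add: algebra_simps abs_mult)
  qed
  note bound = summable_on_real_bound[OF has_sum_imp_summable[OF hs] le]
  show "(\<lambda>y. \<bar>hk x y (t + h) - hk x y t\<bar> * \<mu> y) summable_on UNIV"
    by (rule bound(1))
  have "(\<Sum>\<^sub>\<infinity>y. \<bar>hk x y (t + h) - hk x y t\<bar> * \<mu> y) \<le> (1 - a * 1) + (1 - a) * 1"
    using bound(2) infsumI[OF hs] by simp
  thus "(\<Sum>\<^sub>\<infinity>y. \<bar>hk x y (t + h) - hk x y t\<bar> * \<mu> y) \<le> 2 * deg x * h"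
    using a2 by simp
qed

lemma P_lipschitz_aux:
  assumes "0 < t" "0 \<le> h" "\<And>y. \<bar>g y\<bar> \<le> C"
  shows "\<bar>P (t + h) g x - P t g x\<bar> \<le> 2 * C * deg x * h"
proof -
  have C: "0 \<le> C" using assms(3)[of x] by simp
  have th: "0 < t + h" using assms by simp
  have "P (t + h) g x - P t g x = (\<Sum>\<^sub>\<infinity>y. (hk x y (t + h) - hk x y t) * g y * \<mu> y)" (is "_ = ?D")
    unfolding heat_semigroup_def
    by (subst infsum_diff_real[symmetric])
      (rule P_summable[OF th assms(3)], rule P_summable[OF assms(1,3)], simp add: left_diff_distrib)
  hence "\<bar>P (t + h) g x - P t g x\<bar> = \<bar>?D\<bar>" by simp
  also have "\<dots> \<le> (\<Sum>\<^sub>\<infinity>y. C * (\<bar>hk x y (t + h) - hk x y t\<bar> * \<mu> y))"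
  proof (rule summable_on_real_bound(2))
    show "(\<lambda>y. C * (\<bar>hk x y (t + h) - hk x y t\<bar> * \<mu> y)) summable_on UNIV"
      by (intro summable_on_cmult_right kernel_diff_summable assms)
    fix y
    show "\<bar>(hk x y (t + h) - hk x y t) * g y * \<mu> y\<bar> \<le> C * (\<bar>hk x y (t + h) - hk x y t\<bar> * \<mu> y)"
      using mult_right_mono[OF assms(3)[of y], of "\<bar>hk x y (t + h) - hk x y t\<bar> * \<mu> y"]
      by (simp add: abs_mult mult_ac)
  qed
  also have "\<dots> \<le> C * (2 * deg x * h)"
    unfolding infsum_cmult_right' by (intro mult_left_mono kernel_diff_infsum assms C)
  finally show ?thesis by (simp add: mult_ac)
qed

lemma P_lipschitz:
  assumes "0 < s" "0 < t" "\<And>y. \<bar>g y\<bar> \<le> C"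
  shows "\<bar>P s g x - P t g x\<bar> \<le> 2 * C * deg x * \<bar>s - t\<bar>"
proof (cases "s \<le> t")
  case True
  thus ?thesis using P_lipschitz_aux[OF assms(1) _ assms(3), where h = "t - s" and x = x] by (simp add: abs_minus_commute)
next
  case False
  thus ?thesis using P_lipschitz_aux[OF assms(2) _ assms(3), where h = "s - t" and x = x] by simp
qed

lemma P_continuous:
  assumes "\<And>y. \<bar>g y\<bar> \<le> C"
  shows "continuous_on {0<..} (\<lambda>t. P t g x)"
proof (rule lipschitz_on_continuous_on)
  have C: "0 \<le> C" using assms[of x] by simp
  show "(2 * C * deg x)-lipschitz_on {0<..} (\<lambda>t. P t g x)"
    by (rule lipschitz_onI) (use assms C deg_nonneg in \<open>auto simp: dist_real_def intro!: P_lipschitz\<close>)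
qed

lemma kernel_eq_P: "hk x y t = P t (\<lambda>z. if z = y then 1 / \<mu> y else 0) x"
proof -
  have "P t (\<lambda>z. if z = y then 1 / \<mu> y else 0) x = (\<Sum>\<^sub>\<infinity>z\<in>{y}. hk x z t * (if z = y then 1 / \<mu> y else 0) * \<mu> z)"
    unfolding heat_semigroup_def by (rule infsum_cong_neutral) auto
  thus ?thesis by simp
qed

lemma kernel_continuous: "continuous_on {0<..} (hk x y)"
proof -
  have "continuous_on {0<..} (\<lambda>t. P t (\<lambda>z. if z = y then 1 / \<mu> y else 0) x)"
    by (rule P_continuous[where C = "1 / \<mu> y"]) auto
  thus ?thesis by (simp add: kernel_eq_P[symmetric])
qed

text \<open>Fubini for a double series. Absolute summability is passed in as hypotheses on the
  absolute value of \<open>g\<close>, so that bounded and square-summable functions share this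
  proof.\<close>

lemma P_P:
  assumes st: "0 < s" "0 < t"
    and summ: "\<And>z. (\<lambda>y. hk z y t * \<bar>g y\<bar> * \<mu> y) summable_on UNIV"
    and summ2: "(\<lambda>z. hk x z s * P t (\<lambda>y. \<bar>g y\<bar>) z * \<mu> z) summable_on UNIV"
  shows "P s (P t g) x = P (s + t) g x"
proof -
  let ?G = "\<lambda>z y. hk x z s * hk z y t * \<mu> z * (g y * \<mu> y)"
  have G: "\<bar>?G z y\<bar> = hk x z s * \<mu> z * (hk z y t * \<bar>g y\<bar> * \<mu> y)" for z y
    using st kernel_nonneg by (simp add: abs_mult mult_ac)
  have "(\<lambda>x. norm (case x of (z, y) \<Rightarrow> ?G z y)) summable_on (UNIV \<times> UNIV)"
    unfolding Infinite_Sum.abs_summable_on_Sigma_iff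
  proof (intro conjI ballI)
    show "(\<lambda>y. norm (case (z, y) of (z, y) \<Rightarrow> ?G z y)) summable_on UNIV" for z
      unfolding split real_norm_def G by (intro summable_on_cmult_right summ)
    have eq: "(\<Sum>\<^sub>\<infinity>y. norm (case (z, y) of (z, y) \<Rightarrow> ?G z y)) = hk x z s * P t (\<lambda>y. \<bar>g y\<bar>) z * \<mu> z" for z
      unfolding split real_norm_def G heat_semigroup_def infsum_cmult_right' by simp
    show "(\<lambda>z. norm (\<Sum>\<^sub>\<infinity>y. norm (case (z, y) of (z, y) \<Rightarrow> ?G z y))) summable_on UNIV"
      unfolding eq
      using summ2 summable_on_iff_abs_summable_on_real[of "\<lambda>z. hk x z s * P t (\<lambda>y. \<bar>g y\<bar>) z * \<mu> z" UNIV] by blast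
  qed
  hence "(\<lambda>(z, y). ?G z y) summable_on (UNIV \<times> UNIV)"
    by (rule Infinite_Sum.abs_summable_summable)
  hence "(\<Sum>\<^sub>\<infinity>z. \<Sum>\<^sub>\<infinity>y. ?G z y) = (\<Sum>\<^sub>\<infinity>y. \<Sum>\<^sub>\<infinity>z. ?G z y)"
    by (rule infsum_swap_banach)
  also have "(\<Sum>\<^sub>\<infinity>z. \<Sum>\<^sub>\<infinity>y. ?G z y) = P s (P t g) x"
  proof -
    have "?G z y = (hk x z s * \<mu> z) * (hk z y t * g y * \<mu> y)" for z y by simp
    hence "(\<Sum>\<^sub>\<infinity>y. ?G z y) = hk x z s * P t g z * \<mu> z" for z
      unfolding heat_semigroup_def by (simp only: infsum_cmult_right') simp
    thus ?thesis by (simp add: heat_semigroup_def)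
  qed
  also have "(\<Sum>\<^sub>\<infinity>y. \<Sum>\<^sub>\<infinity>z. ?G z y) = P (s + t) g x"
  proof -
    have "(\<Sum>\<^sub>\<infinity>z. ?G z y) = hk x y (s + t) * g y * \<mu> y" for y
      unfolding infsum_cmult_left' using st by (simp add: infsumI[OF kernel_semigroup])
    thus ?thesis by (simp add: heat_semigroup_def)
  qed
  finally show ?thesis .
qed

lemma P_P_bounded:
  assumes "0 < s" "0 < t" "\<And>y. \<bar>g y\<bar> \<le> C"
  shows "P s (P t g) x = P (s + t) g x"
proof (rule P_P[OF assms(1,2)])
  have abs: "\<bar>\<bar>g y\<bar>\<bar> \<le> C" for y using assms by simp
  show "(\<lambda>y. hk z y t * \<bar>g y\<bar> * \<mu> y) summable_on UNIV" for z
    by (rule P_summable[OF assms(2) abs])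
  show "(\<lambda>z. hk x z s * P t (\<lambda>y. \<bar>g y\<bar>) z * \<mu> z) summable_on UNIV"
    by (rule P_summable[OF assms(1) P_abs_le[OF assms(2) abs]])
qed

end

section \<open>Duhamel integrals\<close>

text \<open>A non-integrable \<open>F\<close> has integral 0 by convention, and \<open>w\<close> is
  nonnegative almost everywhere, so that case is covered too.\<close>

lemma abs_integral_le:
  fixes F w :: "'c \<Rightarrow> real"
  assumes "integrable M w" "AE s in M. \<bar>F s\<bar> \<le> w s"
  shows "\<bar>\<integral>s. F s \<partial>M\<bar> \<le> (\<integral>s. w s \<partial>M)"
proof (cases "integrable M F")
  case True
  have "\<bar>\<integral>s. F s \<partial>M\<bar> \<le> (\<integral>s. \<bar>F s\<bar> \<partial>M)"
    using integral_norm_bound[of M F] by simp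
  also have "\<dots> \<le> (\<integral>s. w s \<partial>M)"
    using True assms by (intro integral_mono_AE) auto
  finally show ?thesis .
next
  case False
  have "AE s in M. 0 \<le> w s"
    using assms(2) by eventually_elim linarith
  thus ?thesis
    using False by (simp add: not_integrable_integral_eq integral_nonneg_AE)
qed

section \<open>Lebesgue integrals over bounded open intervals\<close>

abbreviation lebesgue_Ioo :: "real \<Rightarrow> real \<Rightarrow> real measure" where
  "lebesgue_Ioo a b \<equiv> lebesgue_on {a<..<b}"

lemma finite_measure_Ioo: "finite_measure (lebesgue_Ioo a b)"
  by (rule finite_measureI) (cases "a \<le> b", auto simp: emeasure_restrict_space)

lemma integrable_const_Ioo: "integrable (lebesgue_Ioo a b) (\<lambda>_. C :: real)"
  by (rule finite_measure.integrable_const[OF finite_measure_Ioo])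

lemma integral_const_Ioo: "a \<le> b \<Longrightarrow> (\<integral>s. C \<partial>lebesgue_Ioo a b) = C * (b - a :: real)"
  by (simp add: measure_restrict_space)

lemma abs_integral_Ioo_le:
  fixes F :: "real \<Rightarrow> real"
  assumes "AE s in lebesgue_Ioo a b. \<bar>F s\<bar> \<le> C" "a \<le> b"
  shows "\<bar>\<integral>s. F s \<partial>lebesgue_Ioo a b\<bar> \<le> C * (b - a)"
  using abs_integral_le[OF integrable_const_Ioo assms(1)] unfolding integral_const_Ioo[OF assms(2)] .

lemma AE_IooI: "(\<And>s. a < s \<Longrightarrow> s < b \<Longrightarrow> Q s) \<Longrightarrow> AE s in lebesgue_Ioo a b. Q s"
  by (rule AE_I2) auto

lemma AE_Ioo_subset:
  assumes "AE s in lebesgue_Ioo a b. Q s" "c \<le> b"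
  shows "AE s in lebesgue_Ioo a c. Q s"
proof -
  have "AE s in lebesgue. s \<in> {a<..<b} \<longrightarrow> Q s"
    using assms(1) by (subst (asm) AE_restrict_space_iff) auto
  hence "AE s in lebesgue. s \<in> {a<..<c} \<longrightarrow> Q s"
    by eventually_elim (use assms(2) in auto)
  thus ?thesis by (subst AE_restrict_space_iff) auto
qed

lemma measurable_Ioo_subset:
  "f \<in> borel_measurable (lebesgue_Ioo a b) \<Longrightarrow> a \<le> c \<Longrightarrow> d \<le> b \<Longrightarrow>
    f \<in> borel_measurable (lebesgue_Ioo c d)"
  by (rule measurable_restrict_mono) auto

lemma continuous_imp_measurable_Ioo:
  fixes f :: "real \<Rightarrow> real"
  shows "continuous_on {a<..<b} f \<Longrightarrow> f \<in> borel_measurable (lebesgue_Ioo a b)"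
  by (rule continuous_imp_measurable_on_sets_lebesgue) auto

lemma integrable_Ioo_bounded:
  fixes f :: "real \<Rightarrow> real"
  assumes "f \<in> borel_measurable (lebesgue_Ioo a b)" "\<And>s. a < s \<Longrightarrow> s < b \<Longrightarrow> \<bar>f s\<bar> \<le> C"
  shows "integrable (lebesgue_Ioo a b) f"
  by (rule finite_measure.integrable_const_bound[OF finite_measure_Ioo _ assms(1), of C])
    (use assms in \<open>auto intro!: AE_IooI\<close>)

lemma integral_Ioo_eq:
  fixes f :: "real \<Rightarrow> real"
  assumes "integrable (lebesgue_Ioo a b) f"
  shows "(\<integral>s. f s \<partial>lebesgue_Ioo a b) = integral {a..b} f" "f integrable_on {a..b}"
proof -
  show "(\<integral>s. f s \<partial>lebesgue_Ioo a b) = integral {a..b} f"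
    using lebesgue_integral_eq_integral[OF assms] by (simp add: integral_open_interval_real)
  have "f integrable_on {a<..<b}"
    using has_integral_integral_lebesgue_on[OF assms] by (auto simp: integrable_on_def)
  thus "f integrable_on {a..b}"
    by (simp add: integrable_on_open_interval_real)
qed

lemma integrable_lebesgue_on_subset:
  fixes f :: "real \<Rightarrow> real"
  assumes "integrable (lebesgue_on A) f" "B \<subseteq> A" "A \<in> sets lebesgue" "B \<in> sets lebesgue"
  shows "integrable (lebesgue_on B) f"
proof -
  have "set_integrable lebesgue A f"
    using assms by (simp add: set_integrable_def integrable_restrict_space)
  hence "set_integrable lebesgue B f"
    by (rule set_integrable_subset) (use assms in auto)
  thus ?thesis
    using assms by (simp add: set_integrable_def integrable_restrict_space)
qed

lemma integrable_Ioo_subset: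
  fixes f :: "real \<Rightarrow> real"
  shows "integrable (lebesgue_Ioo a b) f \<Longrightarrow> a \<le> c \<Longrightarrow> d \<le> b \<Longrightarrow> integrable (lebesgue_Ioo c d) f"
  by (rule integrable_lebesgue_on_subset) auto

lemma integral_Ioo_combine:
  fixes f :: "real \<Rightarrow> real"
  assumes f: "integrable (lebesgue_Ioo a c) f" and abc: "a \<le> b" "b \<le> c"
  shows "(\<integral>s. f s \<partial>lebesgue_Ioo a c) = (\<integral>s. f s \<partial>lebesgue_Ioo a b) + (\<integral>s. f s \<partial>lebesgue_Ioo b c)"
proof -
  have "integrable (lebesgue_Ioo a b) f" "integrable (lebesgue_Ioo b c) f"
    using abc by (auto intro: integrable_Ioo_subset[OF f])
  thus ?thesis
    using Henstock_Kurzweil_Integration.integral_combine[OF abc integral_Ioo_eq(2)[OF f]] integral_Ioo_eq(1) f by simp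
qed

section \<open>Duhamel integrals of bounded sources\<close>

context complete_weighted_graph
begin

text \<open>The bound holds at every time and not just almost everywhere, so that each time slice is
  a bounded function on which the semigroup acts.\<close>

definition admissible :: "real \<Rightarrow> real \<Rightarrow> ('a \<Rightarrow> real \<Rightarrow> real) \<Rightarrow> bool" where
  "admissible \<tau> C g \<longleftrightarrow> (\<forall>y. g y \<in> borel_measurable (lebesgue_Ioo 0 \<tau>)) \<and>
     (\<forall>y s. 0 < s \<longrightarrow> s < \<tau> \<longrightarrow> \<bar>g y s\<bar> \<le> C)"

lemma admissible_bound_nonneg:
  assumes "admissible \<tau> C g" "0 < \<tau>"
  shows "0 \<le> C"
proof -
  have "\<bar>g undefined (\<tau> / 2)\<bar> \<le> C"
    using assms unfolding admissible_def by simp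
  thus ?thesis by linarith
qed

text \<open>The time \<open>r\<close> in the semigroup and the upper limit \<open>t\<close> are kept apart because applying
  \<open>P\<^sub>\<sigma>\<close> changes only the former.\<close>

definition duhamel :: "('a \<Rightarrow> real \<Rightarrow> real) \<Rightarrow> 'a \<Rightarrow> real \<Rightarrow> real \<Rightarrow> real" where
  "duhamel g x r t = (\<integral>s. P (r - s) (\<lambda>y. g y s) x \<partial>lebesgue_Ioo 0 t)"

lemma duhamel_eq:
  "(LINT s:{0<..<t}|lebesgue. (\<Sum>\<^sub>\<infinity>y. hk x y (r - s) * g y s * \<mu> y)) = duhamel g x r t"
  unfolding duhamel_def set_lebesgue_integral_def heat_semigroup_def
  by (subst integral_restrict_space) auto

lemma duhamel_integrand_measurable:
  assumes g: "admissible \<tau> C g" and t: "t \<le> \<tau>" "t \<le> r"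
  shows "(\<lambda>s. P (r - s) (\<lambda>y. g y s) x) \<in> borel_measurable (lebesgue_Ioo 0 t)"
  unfolding heat_semigroup_def
proof (rule borel_measurable_infsum[OF vertices_countable])
  fix y
  have "continuous_on {0<..<t} (\<lambda>s. hk x y (r - s))"
    by (rule continuous_on_compose2[OF kernel_continuous]) (use t in \<open>auto intro!: continuous_intros\<close>)
  hence "(\<lambda>s. hk x y (r - s)) \<in> borel_measurable (lebesgue_Ioo 0 t)"
    by (rule continuous_imp_measurable_Ioo)
  moreover have "g y \<in> borel_measurable (lebesgue_Ioo 0 t)"
    using g t unfolding admissible_def by (auto intro: measurable_Ioo_subset)
  ultimately show "(\<lambda>s. hk x y (r - s) * g y s * \<mu> y) \<in> borel_measurable (lebesgue_Ioo 0 t)"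
    by (intro borel_measurable_times borel_measurable_const)
next
  fix s assume "s \<in> space (lebesgue_Ioo 0 t)"
  thus "(\<lambda>y. hk x y (r - s) * g y s * \<mu> y) summable_on UNIV"
    using g t by (intro P_summable[where C = C]) (auto simp: admissible_def)
qed

lemma duhamel_integrand_le:
  assumes "admissible \<tau> C g" "0 < s" "s < t" "t \<le> \<tau>" "t \<le> r"
  shows "\<bar>P (r - s) (\<lambda>y. g y s) x\<bar> \<le> C"
  by (rule P_abs_le) (use assms in \<open>auto simp: admissible_def\<close>)

lemma duhamel_integrable:
  assumes g: "admissible \<tau> C g" and t: "t \<le> \<tau>" "t \<le> r"
  shows "integrable (lebesgue_Ioo 0 t) (\<lambda>s. P (r - s) (\<lambda>y. g y s) x)"
  by (rule integrable_Ioo_bounded[OF duhamel_integrand_measurable[OF assms], where C = C])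
    (use duhamel_integrand_le[OF g] t in auto)

lemma duhamel_abs_le:
  assumes "admissible \<tau> C g" "0 \<le> t" "t \<le> \<tau>" "t \<le> r"
  shows "\<bar>duhamel g x r t\<bar> \<le> C * t"
  unfolding duhamel_def
  using abs_integral_Ioo_le[where a = 0 and b = t and F = "\<lambda>s. P (r - s) (\<lambda>y. g y s) x" and C = C] assms duhamel_integrand_le[OF assms(1)]
  by (auto intro!: AE_IooI)

lemma duhamel_nonneg:
  assumes "\<And>y s. 0 < s \<Longrightarrow> s < t \<Longrightarrow> 0 \<le> g y s" "t \<le> r"
  shows "0 \<le> duhamel g x r t"
  unfolding duhamel_def
  by (rule integral_nonneg_AE) (use assms in \<open>auto intro!: AE_IooI P_nonneg\<close>)

lemma duhamel_cong:
  assumes "\<And>y s. 0 < s \<Longrightarrow> s < t \<Longrightarrow> g y s = k y s"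
  shows "duhamel g x r t = duhamel k x r t"
  unfolding duhamel_def
  by (rule Bochner_Integration.integral_cong) (use assms in auto)

lemma duhamel_diff_le:
  assumes g: "admissible \<tau> C g" "admissible \<tau> C' k" and t: "t \<le> \<tau>" "t \<le> r"
    and w: "integrable (lebesgue_Ioo 0 t) w"
      "\<And>y s. 0 < s \<Longrightarrow> s < t \<Longrightarrow> \<bar>g y s - k y s\<bar> \<le> w s"
  shows "\<bar>duhamel g x r t - duhamel k x r t\<bar> \<le> (\<integral>s. w s \<partial>lebesgue_Ioo 0 t)"
proof -
  have "duhamel g x r t - duhamel k x r t =
      (\<integral>s. P (r - s) (\<lambda>y. g y s) x - P (r - s) (\<lambda>y. k y s) x \<partial>lebesgue_Ioo 0 t)"
    unfolding duhamel_def
    by (rule Bochner_Integration.integral_diff[symmetric]; rule duhamel_integrable; fact)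
  also have "\<bar>\<dots>\<bar> \<le> (\<integral>s. w s \<partial>lebesgue_Ioo 0 t)"
  proof (rule abs_integral_le[OF w(1)], rule AE_IooI)
    fix s assume s: "0 < s" "s < t"
    have "P (r - s) (\<lambda>y. g y s) x - P (r - s) (\<lambda>y. k y s) x = P (r - s) (\<lambda>y. g y s - k y s) x"
    proof (rule P_diff[symmetric])
      show "(\<lambda>y. hk x y (r - s) * g y s * \<mu> y) summable_on UNIV"
        by (rule P_summable[where C = C]) (use g s t in \<open>auto simp: admissible_def\<close>)
      show "(\<lambda>y. hk x y (r - s) * k y s * \<mu> y) summable_on UNIV"
        by (rule P_summable[where C = C']) (use g s t in \<open>auto simp: admissible_def\<close>)
    qed
    also have "\<bar>\<dots>\<bar> \<le> w s"
      by (rule P_abs_le) (use s t w in auto)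
    finally show "\<bar>P (r - s) (\<lambda>y. g y s) x - P (r - s) (\<lambda>y. k y s) x\<bar> \<le> w s" .
  qed
  finally show ?thesis .
qed

text \<open>Split at \<open>t1\<close>. Before it only the semigroup time changes, at a cost of
  \<open>2 * C * deg x\<close> per unit of time shift; after it the integrand is at most
  \<open>C\<close>.\<close>

lemma duhamel_lipschitz:
  assumes g: "admissible \<tau> C g" and t: "0 \<le> t1" "t1 \<le> t2" "t2 \<le> \<tau>"
  shows "\<bar>duhamel g x t2 t2 - duhamel g x t1 t1\<bar> \<le> (C + 2 * C * deg x * \<tau>) * (t2 - t1)"
proof (cases "t1 < t2")
  case False
  thus ?thesis using t by simp
next
  case True
  have C: "0 \<le> C"
    by (rule admissible_bound_nonneg[OF g]) (use True t in auto)
  have i2: "integrable (lebesgue_Ioo 0 t2) (\<lambda>s. P (t2 - s) (\<lambda>y. g y s) x)"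
    by (rule duhamel_integrable[OF g]) (use t in auto)
  have i1: "integrable (lebesgue_Ioo 0 t1) (\<lambda>s. P (r - s) (\<lambda>y. g y s) x)" if "t1 \<le> r" for r
    by (rule duhamel_integrable[OF g]) (use t that in auto)
  have "duhamel g x t2 t2 - duhamel g x t1 t1 =
     (\<integral>s. P (t2 - s) (\<lambda>y. g y s) x - P (t1 - s) (\<lambda>y. g y s) x \<partial>lebesgue_Ioo 0 t1) +
     (\<integral>s. P (t2 - s) (\<lambda>y. g y s) x \<partial>lebesgue_Ioo t1 t2)"
    unfolding duhamel_def integral_Ioo_combine[OF i2 t(1,2)]
    using i1[of t2] i1[of t1] t by simp
  moreover have "\<bar>\<integral>s. P (t2 - s) (\<lambda>y. g y s) x - P (t1 - s) (\<lambda>y. g y s) x \<partial>lebesgue_Ioo 0 t1\<bar>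
      \<le> (2 * C * deg x * (t2 - t1)) * (t1 - 0)"
  proof (intro abs_integral_Ioo_le AE_IooI t)
    fix s assume s: "0 < s" "s < t1"
    have "\<bar>P (t2 - s) (\<lambda>y. g y s) x - P (t1 - s) (\<lambda>y. g y s) x\<bar> \<le> 2 * C * deg x * \<bar>(t2 - s) - (t1 - s)\<bar>"
      by (rule P_lipschitz) (use s t g in \<open>auto simp: admissible_def\<close>)
    thus "\<bar>P (t2 - s) (\<lambda>y. g y s) x - P (t1 - s) (\<lambda>y. g y s) x\<bar> \<le> 2 * C * deg x * (t2 - t1)"
      using t by simp
  qed
  moreover have "\<dots> \<le> (2 * C * deg x * (t2 - t1)) * \<tau>"
    using t C deg_nonneg[of x] by (intro mult_left_mono) auto
  moreover have "\<bar>\<integral>s. P (t2 - s) (\<lambda>y. g y s) x \<partial>lebesgue_Ioo t1 t2\<bar> \<le> C * (t2 - t1)"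
    by (intro abs_integral_Ioo_le AE_IooI duhamel_integrand_le[OF g, where t=t2]) (use t in auto)
  ultimately show ?thesis
    by (simp add: algebra_simps)
qed

lemma duhamel_continuous:
  assumes g: "admissible \<tau> C g"
  shows "continuous_on {0<..<\<tau>} (\<lambda>t. duhamel g x t t)"
proof (cases "0 < \<tau>")
  case True
  have C: "0 \<le> C"
    by (rule admissible_bound_nonneg[OF g]) (use True in auto)
  show ?thesis
  proof (rule lipschitz_on_continuous_on, rule lipschitz_onI)
    show "0 \<le> C + 2 * C * deg x * \<tau>"
      using C deg_nonneg[of x] True by simp
    fix s t assume "s \<in> {0<..<\<tau>}" "t \<in> {0<..<\<tau>}"
    thus "dist (duhamel g x s s) (duhamel g x t t) \<le> (C + 2 * C * deg x * \<tau>) * dist s t"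
      using duhamel_lipschitz[OF g, of s t x] duhamel_lipschitz[OF g, of t s x]
      by (cases "s \<le> t") (auto simp: dist_real_def abs_minus_commute)
  qed
qed simp

text \<open>The sum over vertices and the time integral are exchanged, with the constant
  \<open>C\<close> dominating because the kernel has mass 1; then the semigroup identity is applied
  under the integral.\<close>

lemma P_duhamel:
  assumes g: "admissible \<tau> C g" and t: "t \<le> \<tau>" "t \<le> r" and \<sigma>: "0 < \<sigma>"
  shows "P \<sigma> (\<lambda>y. duhamel g y r t) x = duhamel g x (r + \<sigma>) t"
proof (cases "0 < t")
  case False
  thus ?thesis using P_const[OF \<sigma>, of 0 x] by (simp add: duhamel_def)
next
  case True
  define F where "F y s = hk x y \<sigma> * P (r - s) (\<lambda>z. g z s) y * \<mu> y" for y s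
  have C: "0 \<le> C"
    by (rule admissible_bound_nonneg[OF g]) (use True t in auto)
  have "((\<lambda>y. \<integral>s. F y s \<partial>lebesgue_Ioo 0 t) has_sum (\<integral>s. (\<Sum>\<^sub>\<infinity>y. F y s) \<partial>lebesgue_Ioo 0 t)) UNIV"
  proof (rule has_sum_lebesgue_integral(1)[OF vertices_countable _ integrable_const_Ioo])
    show "F y \<in> borel_measurable (lebesgue_Ioo 0 t)" for y
      unfolding F_def
      by (intro borel_measurable_times borel_measurable_const duhamel_integrand_measurable[OF g t])
    fix A s assume "s \<in> space (lebesgue_Ioo 0 t)" and A: "finite (A :: 'a set)"
    hence s: "0 < s" "s < t" by auto
    have "(\<Sum>y\<in>A. \<bar>F y s\<bar>) \<le> (\<Sum>y\<in>A. C * (hk x y \<sigma> * \<mu> y))"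
    proof (rule sum_mono)
      fix y
      have "\<bar>F y s\<bar> = \<bar>P (r - s) (\<lambda>z. g z s) y\<bar> * (hk x y \<sigma> * \<mu> y)"
        using \<sigma> by (simp add: F_def abs_mult kernel_nonneg)
      also have "\<dots> \<le> C * (hk x y \<sigma> * \<mu> y)"
        using \<sigma> s t
        by (intro mult_right_mono duhamel_integrand_le[OF g, where t = t] mult_nonneg_nonneg kernel_nonneg) auto
      finally show "\<bar>F y s\<bar> \<le> C * (hk x y \<sigma> * \<mu> y)" .
    qed
    also have "\<dots> \<le> C * 1"
      unfolding sum_distrib_left[symmetric]
      by (intro mult_left_mono C finite_sum_le_has_sum[OF kernel_mass[OF \<sigma>] A] mult_nonneg_nonneg kernel_nonneg)
        (use \<sigma> in auto)
    finally show "(\<Sum>y\<in>A. \<bar>F y s\<bar>) \<le> C" by simp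
  qed
  hence "(\<Sum>\<^sub>\<infinity>y. \<integral>s. F y s \<partial>lebesgue_Ioo 0 t) = (\<integral>s. (\<Sum>\<^sub>\<infinity>y. F y s) \<partial>lebesgue_Ioo 0 t)"
    by (rule infsumI)
  moreover have "(\<integral>s. F y s \<partial>lebesgue_Ioo 0 t) = hk x y \<sigma> * duhamel g y r t * \<mu> y" for y
    unfolding F_def duhamel_def by simp
  moreover have "(\<integral>s. (\<Sum>\<^sub>\<infinity>y. F y s) \<partial>lebesgue_Ioo 0 t) = duhamel g x (r + \<sigma>) t"
    unfolding duhamel_def
  proof (rule Bochner_Integration.integral_cong)
    fix s assume "s \<in> space (lebesgue_Ioo 0 t)"
    hence s: "0 < s" "s < t" by auto
    have "(\<Sum>\<^sub>\<infinity>y. F y s) = P \<sigma> (P (r - s) (\<lambda>z. g z s)) x"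
      unfolding F_def heat_semigroup_def ..
    also have "\<dots> = P (\<sigma> + (r - s)) (\<lambda>z. g z s) x"
      by (rule P_P_bounded[where C = C]) (use \<sigma> s t g in \<open>auto simp: admissible_def\<close>)
    finally show "(\<Sum>\<^sub>\<infinity>y. F y s) = P (r + \<sigma> - s) (\<lambda>y. g y s) x"
      by (simp add: algebra_simps)
  qed simp
  ultimately show ?thesis
    by (simp add: heat_semigroup_def)
qed

end

section \<open>Mild solutions\<close>

lemma integral_exp_Ioo:
  fixes a :: real
  assumes "a \<noteq> 0" "0 \<le> t"
  shows "integrable (lebesgue_Ioo 0 t) (\<lambda>s. exp (a * s))"
    and "(\<integral>s. exp (a * s) \<partial>lebesgue_Ioo 0 t) = (exp (a * t) - 1) / a"
proof -
  show int: "integrable (lebesgue_Ioo 0 t) (\<lambda>s. exp (a * s))"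
    by (rule integrable_Ioo_bounded[where C = "exp (\<bar>a\<bar> * t)"])
      (auto intro!: continuous_imp_measurable_Ioo continuous_intros mult_mono)
  have "((\<lambda>s. exp (a * s)) has_integral (exp (a * t) / a - exp (a * 0) / a)) {0..t}"
    by (rule fundamental_theorem_of_calculus[OF assms(2)])
      (use assms in \<open>auto intro!: derivative_eq_intros simp flip: has_real_derivative_iff_has_vector_derivative\<close>)
  thus "(\<integral>s. exp (a * s) \<partial>lebesgue_Ioo 0 t) = (exp (a * t) - 1) / a"
    unfolding integral_Ioo_eq(1)[OF int] by (simp add: integral_unique diff_divide_distrib)
qed

text \<open>Compactness of the interval. The function is viewed as a time-independent vector field
  over a single time, which is the shape of the compactness theorem for
  \<open>local_lipschitz\<close>.\<close>

lemma local_lipschitz_imp_lipschitz_Icc: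
  fixes f :: "real \<Rightarrow> real"
  assumes "\<forall>s\<ge>0. \<exists>e>0. \<exists>L. L-lipschitz_on (cball s e \<inter> {0..}) f"
  shows "\<exists>L>0. L-lipschitz_on {0..R} f"
proof -
  have "local_lipschitz {0 :: real} {0..R} (\<lambda>_. f)"
    unfolding local_lipschitz_def
  proof (intro ballI)
    fix s t :: real assume "s \<in> {0..R}"
    then obtain e L where "e > 0" "L-lipschitz_on (cball s e \<inter> {0..}) f"
      using assms by auto
    hence "L-lipschitz_on (cball s e \<inter> {0..R}) f"
      by (rule_tac lipschitz_on_subset) auto
    thus "\<exists>u>0. \<exists>L. \<forall>t\<in>cball t u \<inter> {0}. L-lipschitz_on (cball s u \<inter> {0..R}) f"
      using \<open>e > 0\<close> by blast
  qed
  then obtain L where L: "L-lipschitz_on {0..R} f"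
    by (rule local_lipschitz_compact_implies_lipschitz) (auto intro!: continuous_intros)
  hence "(max L 1)-lipschitz_on {0..R} f"
    by (rule lipschitz_on_le) auto
  thus ?thesis by (intro exI[of _ "max L 1"]) auto
qed

section \<open>A priori bounds and uniqueness of mild solutions\<close>

locale mild_problem = complete_weighted_graph +
  fixes f :: "real \<Rightarrow> real" and u0 :: "'a \<Rightarrow> real" and U :: real
  assumes u0_nonneg: "0 \<le> u0 x" and u0_le: "u0 x \<le> U"
    and f_nonneg: "0 \<le> s \<Longrightarrow> 0 \<le> f s"
    and f_lipschitz: "\<exists>L > 0. L-lipschitz_on {0..R} f"
begin

abbreviation "mild \<equiv> mild_solution \<mu> \<omega> f u0"

lemma u0_abs_le: "\<bar>u0 x\<bar> \<le> U"
  using u0_nonneg u0_le by simp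

lemma f_lip_bound:
  obtains L where "L > 0" "\<And>a b. a \<in> {0..R} \<Longrightarrow> b \<in> {0..R} \<Longrightarrow> \<bar>f a - f b\<bar> \<le> L * \<bar>a - b\<bar>"
  using f_lipschitz[of R] by (auto simp: lipschitz_on_def dist_real_def)

lemma f_continuous: "continuous_on {0..} f"
proof (rule continuous_on_sequentiallyI)
  fix X :: "nat \<Rightarrow> real" and s assume X: "\<forall>n. X n \<in> {0..}" "X \<longlonglongrightarrow> s" "s \<in> {0..}"
  obtain L where L: "L-lipschitz_on {0..s + 1} f" using f_lipschitz by blast
  have ev: "eventually (\<lambda>n. X n \<in> {0..s + 1}) sequentially"
    using order_tendstoD(2)[OF X(2), of "s + 1"] X(1) by (auto elim!: eventually_mono simp: less_imp_le)
  have "continuous_on {0..s + 1} f" by (rule lipschitz_on_continuous_on[OF L])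
  from continuous_on_tendsto_compose[OF this X(2) _ ev] X(3)
  show "(\<lambda>n. f (X n)) \<longlonglongrightarrow> f s" by simp
qed

text \<open>The behaviour of \<open>f\<close> is controlled on [0,\<infinity>) alone; precomposing
  with \<open>max 0\<close> yields a Borel function on the whole line that agrees with
  \<open>f\<close> on nonnegative values.\<close>

lemma f_max_measurable: "(\<lambda>r. f (max 0 r)) \<in> borel_measurable borel"
  by (intro borel_measurable_continuous_onI continuous_on_compose2[OF f_continuous] continuous_intros) auto

lemma f_bound:
  obtains C where "C \<ge> 0" "\<And>a. a \<in> {0..R} \<Longrightarrow> f a \<le> C"
proof -
  have "compact (f ` {0..R})"
    by (intro compact_continuous_image continuous_on_subset[OF f_continuous]) auto
  hence "bdd_above (f ` {0..R})" by (simp add: bounded_imp_bdd_above compact_imp_bounded)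
  then obtain C where "\<And>a. a \<in> {0..R} \<Longrightarrow> f a \<le> C" unfolding bdd_above_def by blast
  thus ?thesis by (intro that[of "max C 0"]) (auto simp: le_max_iff_disj)
qed

lemma mild_iff:
  "mild \<tau> u \<longleftrightarrow> linf_linf \<tau> u \<and> (\<forall>x t. 0 < t \<longrightarrow> t < \<tau> \<longrightarrow> 0 \<le> u x t) \<and>
    (\<forall>x t. 0 < t \<longrightarrow> t < \<tau> \<longrightarrow> u x t = P t u0 x + duhamel (\<lambda>y s. f (u y s)) x t t)"
  unfolding mild_solution_def duhamel_eq heat_semigroup_def Ball_def greaterThanLessThan_iff by blast

lemma mild_measurable: "mild \<tau> u \<Longrightarrow> u x \<in> borel_measurable (lebesgue_Ioo 0 \<tau>)"
  by (simp add: mild_iff linf_linf_def)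

lemma mild_nonneg: "mild \<tau> u \<Longrightarrow> 0 < t \<Longrightarrow> t < \<tau> \<Longrightarrow> 0 \<le> u x t"
  unfolding mild_iff by blast

lemma mild_eq: "mild \<tau> u \<Longrightarrow> 0 < t \<Longrightarrow> t < \<tau> \<Longrightarrow> u x t = P t u0 x + duhamel (\<lambda>y s. f (u y s)) x t t"
  unfolding mild_iff by blast

lemma f_comp_measurable:
  assumes "w \<in> borel_measurable M" "\<And>s. s \<in> space M \<Longrightarrow> 0 \<le> w s"
  shows "(\<lambda>s. f (w s)) \<in> borel_measurable M"
proof -
  have "(\<lambda>s. f (max 0 (w s))) \<in> borel_measurable M"
    using measurable_compose[OF assms(1) f_max_measurable] .
  thus ?thesis
    by (rule measurable_cong[THEN iffD1, rotated]) (use assms in auto)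
qed

text \<open>The definition bounds a solution only for almost every time. Inserted under the Duhamel
  integral, which ignores null sets, that bound yields \<open>U + C0 * \<tau>\<close> at every
  time.\<close>

lemma mild_bounded:
  assumes u: "mild \<tau> u" and \<tau>: "0 < \<tau>"
  obtains M C where "0 \<le> M" "\<And>x t. 0 < t \<Longrightarrow> t < \<tau> \<Longrightarrow> u x t \<le> M" "admissible \<tau> C (\<lambda>y s. f (u y s))"
proof -
  obtain M0 where M0: "AE t in lebesgue_Ioo 0 \<tau>. \<forall>x. \<bar>u x t\<bar> \<le> M0"
    using u unfolding mild_iff linf_linf_def by auto
  obtain C0 where C0: "0 \<le> C0" "\<And>a. a \<in> {0..max M0 0} \<Longrightarrow> f a \<le> C0"
    using f_bound by blast
  have U: "0 \<le> U" using u0_nonneg[of undefined] u0_le[of undefined] by simp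
  define M where "M = U + C0 * \<tau>"
  have uM: "u x t \<le> M" if t: "0 < t" "t < \<tau>" for x t
  proof -
    have "\<bar>duhamel (\<lambda>y s. f (u y s)) x t t\<bar> \<le> C0 * (t - 0)"
      unfolding duhamel_def
    proof (rule abs_integral_Ioo_le)
      have "AE s in lebesgue_Ioo 0 t. 0 < s \<and> s < t"
        by (rule AE_IooI) simp
      with AE_Ioo_subset[OF M0 less_imp_le[OF t(2)]]
      show "AE s in lebesgue_Ioo 0 t. \<bar>P (t - s) (\<lambda>y. f (u y s)) x\<bar> \<le> C0"
      proof eventually_elim
        case (elim s)
        hence "0 \<le> u y s" "u y s \<le> M0" for y
          using t mild_nonneg[OF u, of s y] by (auto simp: abs_le_iff)
        hence "\<bar>f (u y s)\<bar> \<le> C0" for y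
          using f_nonneg[of "u y s"] C0(2)[of "u y s"] by (auto simp: le_max_iff_disj)
        thus ?case using elim by (intro P_abs_le) auto
      qed
    qed (use t in simp)
    moreover have "C0 * (t - 0) \<le> C0 * \<tau>" using C0 t by (intro mult_left_mono) auto
    moreover have "\<bar>P t u0 x\<bar> \<le> U" by (rule P_abs_le[OF t(1) u0_abs_le])
    ultimately show ?thesis unfolding M_def mild_eq[OF u t] by linarith
  qed
  obtain C where C: "0 \<le> C" "\<And>a. a \<in> {0..M} \<Longrightarrow> f a \<le> C"
    using f_bound by blast
  show thesis
  proof
    show "0 \<le> M" using U C0 \<tau> by (simp add: M_def)
    show "u x t \<le> M" if "0 < t" "t < \<tau>" for x t using uM[OF that] .
    show "admissible \<tau> C (\<lambda>y s. f (u y s))"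
      unfolding admissible_def
    proof (intro conjI allI impI)
      show "(\<lambda>s. f (u y s)) \<in> borel_measurable (lebesgue_Ioo 0 \<tau>)" for y
        by (rule f_comp_measurable[OF mild_measurable[OF u]]) (use mild_nonneg[OF u] in auto)
      show "\<bar>f (u y s)\<bar> \<le> C" if "0 < s" "s < \<tau>" for y s
        using uM[OF that] mild_nonneg[OF u that] f_nonneg[of "u y s"] C(2)[of "u y s"] by auto
    qed
  qed
qed

lemma mild_restrict:
  assumes "mild \<tau> u" "r \<le> \<tau>"
  shows "mild r u"
proof -
  obtain M0 where M0: "AE t in lebesgue_Ioo 0 \<tau>. \<forall>x. \<bar>u x t\<bar> \<le> M0"
    using assms unfolding mild_iff linf_linf_def by auto
  have "AE t in lebesgue_Ioo 0 r. \<forall>x. \<bar>u x t\<bar> \<le> M0"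
    by (rule AE_Ioo_subset[OF M0 assms(2)])
  moreover have "u x \<in> borel_measurable (lebesgue_Ioo 0 r)" for x
    by (rule measurable_Ioo_subset[OF mild_measurable[OF assms(1)]]) (use assms in auto)
  ultimately show ?thesis
    using assms unfolding mild_iff linf_linf_def by auto
qed

lemma mild_cong:
  assumes "mild \<tau> u" "\<And>x t. 0 < t \<Longrightarrow> t < \<tau> \<Longrightarrow> v x t = u x t"
  shows "mild \<tau> v"
proof -
  obtain M0 where M0: "AE t in lebesgue_Ioo 0 \<tau>. \<forall>x. \<bar>u x t\<bar> \<le> M0"
    using assms unfolding mild_iff linf_linf_def by auto
  hence "AE t in lebesgue_Ioo 0 \<tau>. \<forall>x. \<bar>v x t\<bar> \<le> M0"
    by (rule AE_mp) (use assms in \<open>auto intro!: AE_IooI\<close>)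
  moreover have "v x \<in> borel_measurable (lebesgue_Ioo 0 \<tau>)" for x
    by (rule measurable_cong[THEN iffD1, OF _ mild_measurable[OF assms(1)]]) (use assms in auto)
  moreover have "duhamel (\<lambda>y s. f (v y s)) x t t = duhamel (\<lambda>y s. f (u y s)) x t t" if "t < \<tau>" for x t
    by (rule duhamel_cong) (use assms that in auto)
  ultimately show ?thesis
    using assms unfolding mild_iff linf_linf_def by auto
qed

text \<open>In the norm weighted by exp(-2Lt) the Duhamel map contracts by 1/2 on an interval of any
  length, since the integral of L exp(2Ls) over (0,t) is at most exp(2Lt)/2.\<close>

lemma duhamel_contraction:
  assumes "admissible \<tau> C g" "admissible \<tau> C' k" and t: "0 \<le> t" "t \<le> \<tau>" and L: "0 < L" "0 \<le> D"
    and le: "\<And>y s. 0 < s \<Longrightarrow> s < t \<Longrightarrow> \<bar>g y s - k y s\<bar> \<le> L * (D * exp (2 * L * s))"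
  shows "\<bar>duhamel g x t t - duhamel k x t t\<bar> \<le> D / 2 * exp (2 * L * t)"
proof -
  have int: "integrable (lebesgue_Ioo 0 t) (\<lambda>s. exp (2 * L * s))"
    "(\<integral>s. exp (2 * L * s) \<partial>lebesgue_Ioo 0 t) = (exp (2 * L * t) - 1) / (2 * L)"
    using integral_exp_Ioo[of "2 * L" t] L t by auto
  have "\<bar>duhamel g x t t - duhamel k x t t\<bar> \<le> (\<integral>s. L * (D * exp (2 * L * s)) \<partial>lebesgue_Ioo 0 t)"
    by (rule duhamel_diff_le[OF assms(1,2) t(2)]) (use int le in auto)
  also have "\<dots> = D / 2 * exp (2 * L * t) - D / 2"
    unfolding integral_mult_right_zero int(2) using L by (simp add: field_simps)
  finally show ?thesis using L by simp
qed

text \<open>Gronwall by iteration: each pass through \<open>duhamel_contraction\<close> halves the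
  constant in front of exp(2Lt), and its initial value is a common bound of both solutions.\<close>

lemma mild_unique:
  assumes u: "mild \<tau> u" and v: "mild \<tau> v" and t: "0 < t" "t < \<tau>"
  shows "u x t = v x t"
proof -
  have \<tau>: "0 < \<tau>" using t by simp
  obtain Mu Cu where Mu: "0 \<le> Mu" "\<And>x t. 0 < t \<Longrightarrow> t < \<tau> \<Longrightarrow> u x t \<le> Mu"
    "admissible \<tau> Cu (\<lambda>y s. f (u y s))" using mild_bounded[OF u \<tau>] by blast
  obtain Mv Cv where Mv: "0 \<le> Mv" "\<And>x t. 0 < t \<Longrightarrow> t < \<tau> \<Longrightarrow> v x t \<le> Mv"
    "admissible \<tau> Cv (\<lambda>y s. f (v y s))" using mild_bounded[OF v \<tau>] by blast
  define M where "M = max Mu Mv"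
  obtain L where L: "L > 0" "\<And>a b. a \<in> {0..M} \<Longrightarrow> b \<in> {0..M} \<Longrightarrow> \<bar>f a - f b\<bar> \<le> L * \<bar>a - b\<bar>"
    using f_lip_bound by blast
  have M: "u x t \<in> {0..M}" "v x t \<in> {0..M}" if "0 < t" "t < \<tau>" for x t
    using Mu(2)[OF that, of x] Mv(2)[OF that, of x] mild_nonneg[OF u that] mild_nonneg[OF v that]
    by (auto simp: M_def)
  have est: "\<bar>u x t - v x t\<bar> \<le> M / 2 ^ n * exp (2 * L * t)" if "0 < t" "t < \<tau>" for x t n
    using that
  proof (induction n arbitrary: x t)
    case 0
    have "\<bar>u x t - v x t\<bar> \<le> M * 1" using M[OF 0, of x] by auto
    also have "\<dots> \<le> M * exp (2 * L * t)"
      by (rule mult_left_mono) (use Mu L 0 in \<open>auto simp: M_def\<close>)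
    finally show ?case by simp
  next
    case (Suc n)
    have "\<bar>u x t - v x t\<bar> =
      \<bar>duhamel (\<lambda>y s. f (u y s)) x t t - duhamel (\<lambda>y s. f (v y s)) x t t\<bar>"
      using mild_eq[OF u Suc.prems] mild_eq[OF v Suc.prems] by simp
    also have "\<dots> \<le> (M / 2 ^ n) / 2 * exp (2 * L * t)"
    proof (rule duhamel_contraction[OF Mu(3) Mv(3) _ _ L(1)])
      fix y s assume s: "0 < s" "s < t"
      hence s\<tau>: "s < \<tau>" using Suc by simp
      have "\<bar>f (u y s) - f (v y s)\<bar> \<le> L * \<bar>u y s - v y s\<bar>"
        by (rule L(2)) (use M[OF s(1) s\<tau>] in auto)
      also have "\<dots> \<le> L * (M / 2 ^ n * exp (2 * L * s))"
        by (intro mult_left_mono Suc.IH s s\<tau>) (use L in auto)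
      finally show "\<bar>f (u y s) - f (v y s)\<bar> \<le> L * (M / 2 ^ n * exp (2 * L * s))" .
    qed (use Suc Mu in \<open>auto simp: M_def\<close>)
    finally show ?case by simp
  qed
  have "(\<lambda>n. M * exp (2 * L * t) * (1 / 2) ^ n) \<longlonglongrightarrow> M * exp (2 * L * t) * 0"
    by (intro tendsto_intros LIMSEQ_power_zero) auto
  hence "\<bar>u x t - v x t\<bar> \<le> M * exp (2 * L * t) * 0"
    by (rule LIMSEQ_le_const) (use est[OF t, of x] in \<open>auto simp: power_divide mult_ac\<close>)
  thus ?thesis by simp
qed

text \<open>A free heat flow of duration \<sigma> after time \<open>t\<close> leaves the upper limit
  of the Duhamel integral unchanged. It is used to restart a solution at a positive time and, with
  \<sigma> = T - t, to identify the function \<Phi>.\<close>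

lemma P_mild:
  assumes u: "mild \<tau> u" and t: "0 < t" "t < \<tau>" and \<sigma>: "0 < \<sigma>"
  shows "P \<sigma> (\<lambda>y. u y t) x = P (t + \<sigma>) u0 x + duhamel (\<lambda>y s. f (u y s)) x (t + \<sigma>) t"
proof -
  obtain C where adm: "admissible \<tau> C (\<lambda>y s. f (u y s))"
    by (rule mild_bounded[OF u less_trans[OF t]])
  have "P \<sigma> (\<lambda>y. u y t) x = P \<sigma> (\<lambda>y. P t u0 y + duhamel (\<lambda>y s. f (u y s)) y t t) x"
    using mild_eq[OF u t] by simp
  also have "\<dots> = P \<sigma> (P t u0) x + P \<sigma> (\<lambda>y. duhamel (\<lambda>y s. f (u y s)) y t t) x"
  proof (rule P_add)
    show "(\<lambda>y. hk x y \<sigma> * P t u0 y * \<mu> y) summable_on UNIV"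
      by (rule P_summable[OF \<sigma> P_abs_le[OF t(1) u0_abs_le]])
    show "(\<lambda>y. hk x y \<sigma> * duhamel (\<lambda>y s. f (u y s)) y t t * \<mu> y) summable_on UNIV"
      by (rule P_summable[OF \<sigma> duhamel_abs_le[OF adm]]) (use t in auto)
  qed
  also have "P \<sigma> (P t u0) x = P (t + \<sigma>) u0 x"
    using P_P_bounded[where g = u0 and C = U, OF \<sigma> t(1) u0_abs_le] by (simp add: add.commute)
  also have "P \<sigma> (\<lambda>y. duhamel (\<lambda>y s. f (u y s)) y t t) x = duhamel (\<lambda>y s. f (u y s)) x (t + \<sigma>) t"
    by (rule P_duhamel[OF adm _ _ \<sigma>]) (use t in auto)
  finally show ?thesis .
qed

section \<open>Picard iteration for bounded, globally Lipschitz nonlinearities\<close>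

context
  fixes N :: "'a \<Rightarrow> real \<Rightarrow> real \<Rightarrow> real" and b C L :: real
  assumes b: "0 < b" and L: "0 < L"
    and N_meas: "\<And>w y. w \<in> borel_measurable (lebesgue_Ioo 0 b) \<Longrightarrow>
        (\<lambda>s. N y s (w s)) \<in> borel_measurable (lebesgue_Ioo 0 b)"
    and N_bound: "\<And>y s r. 0 < s \<Longrightarrow> s < b \<Longrightarrow> \<bar>N y s r\<bar> \<le> C"
    and N_lip: "\<And>y s r r'. 0 < s \<Longrightarrow> s < b \<Longrightarrow> \<bar>N y s r - N y s r'\<bar> \<le> L * \<bar>r - r'\<bar>"
begin

text \<open>The nonlinearity may depend on vertex and time because it will have to reproduce a
  prescribed solution on an initial interval.\<close>

primrec picard :: "nat \<Rightarrow> 'a \<Rightarrow> real \<Rightarrow> real" where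
  "picard 0 x t = P t u0 x"
| "picard (Suc n) x t = P t u0 x + duhamel (\<lambda>y s. N y s (picard n y s)) x t t"

lemma N_admissible:
  assumes "\<And>y. w y \<in> borel_measurable (lebesgue_Ioo 0 b)"
  shows "admissible b C (\<lambda>y s. N y s (w y s))"
  using assms N_bound unfolding admissible_def by (auto intro: N_meas)

lemma P_u0_measurable: "(\<lambda>t. P t u0 x) \<in> borel_measurable (lebesgue_Ioo 0 b)"
  by (rule continuous_imp_measurable_Ioo, rule continuous_on_subset[OF P_continuous[OF u0_abs_le]]) auto

lemma picard_measurable: "picard n x \<in> borel_measurable (lebesgue_Ioo 0 b)"
proof (induction n arbitrary: x)
  case 0
  thus ?case using P_u0_measurable[of x] by (simp cong: measurable_cong)
next
  case (Suc n)
  have "(\<lambda>t. duhamel (\<lambda>y s. N y s (picard n y s)) x t t) \<in> borel_measurable (lebesgue_Ioo 0 b)"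
    by (rule continuous_imp_measurable_Ioo[OF duhamel_continuous[OF N_admissible[OF Suc.IH]]])
  from borel_measurable_add[OF P_u0_measurable this] show ?case
    by (simp cong: measurable_cong)
qed

lemma picard_admissible: "admissible b C (\<lambda>y s. N y s (picard n y s))"
  by (rule N_admissible[OF picard_measurable])

lemma picard_bound_nonneg: "0 \<le> C"
  by (rule admissible_bound_nonneg[OF picard_admissible b])

lemma picard_step:
  "0 < t \<Longrightarrow> t < b \<Longrightarrow> \<bar>picard (Suc n) x t - picard n x t\<bar> \<le> C * b / 2 ^ n * exp (2 * L * t)"
proof (induction n arbitrary: x t)
  case 0
  have "\<bar>picard (Suc 0) x t - picard 0 x t\<bar> \<le> C * t"
    using duhamel_abs_le[OF picard_admissible[of 0], where t = t and r = t and x = x] 0 by simp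
  also have "\<dots> \<le> C * b * 1" using 0 picard_bound_nonneg by (simp add: mult_left_mono)
  also have "\<dots> \<le> C * b * exp (2 * L * t)"
    by (rule mult_left_mono) (use 0 L b picard_bound_nonneg in auto)
  finally show ?case by simp
next
  case (Suc n)
  have "\<bar>picard (Suc (Suc n)) x t - picard (Suc n) x t\<bar> =
      \<bar>duhamel (\<lambda>y s. N y s (picard (Suc n) y s)) x t t - duhamel (\<lambda>y s. N y s (picard n y s)) x t t\<bar>"
    by simp
  also have "\<dots> \<le> (C * b / 2 ^ n) / 2 * exp (2 * L * t)"
  proof (rule duhamel_contraction[OF picard_admissible picard_admissible _ _ L])
    fix y s assume s: "0 < s" "s < t"
    hence sb: "s < b" using Suc by simp
    have "\<bar>N y s (picard (Suc n) y s) - N y s (picard n y s)\<bar> \<le> L * \<bar>picard (Suc n) y s - picard n y s\<bar>"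
      by (rule N_lip[OF s(1) sb])
    also have "\<dots> \<le> L * (C * b / 2 ^ n * exp (2 * L * s))"
      by (intro mult_left_mono Suc.IH s sb) (use L in auto)
    finally show "\<bar>N y s (picard (Suc n) y s) - N y s (picard n y s)\<bar> \<le> L * (C * b / 2 ^ n * exp (2 * L * s))" .
  qed (use Suc b picard_bound_nonneg in auto)
  finally show ?case by simp
qed

definition picard_error :: real where
  "picard_error = C * b * exp (2 * L * b)"

lemma picard_error_nonneg: "0 \<le> picard_error"
  using picard_bound_nonneg b by (simp add: picard_error_def)

text \<open>A telescoped geometric series; keeping the negative term makes the induction on
  \<open>j\<close> close by adding one step.\<close>

lemma picard_cauchy:
  assumes t: "0 < t" "t < b"
  shows "\<bar>picard (n + j) x t - picard n x t\<bar> \<le> 2 * picard_error / 2 ^ n - 2 * picard_error / 2 ^ (n + j)"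
proof (induction j)
  case (Suc j)
  have "\<bar>picard (Suc (n + j)) x t - picard (n + j) x t\<bar> \<le> C * b / 2 ^ (n + j) * exp (2 * L * t)"
    by (rule picard_step[OF t])
  also have "\<dots> \<le> C * b / 2 ^ (n + j) * exp (2 * L * b)"
    by (intro mult_left_mono) (use t L picard_bound_nonneg b in auto)
  also have "\<dots> = picard_error / 2 ^ (n + j)"
    by (simp add: picard_error_def)
  also have "\<dots> = 2 * picard_error / 2 ^ (n + j) - 2 * picard_error / 2 ^ (n + Suc j)"
    by (simp add: field_simps)
  finally show ?case using Suc.IH by simp
qed simp

lemma picard_error_tendsto: "(\<lambda>n. 2 * picard_error / 2 ^ n) \<longlonglongrightarrow> 0"
proof -
  have "(\<lambda>n. 2 * picard_error * (1 / 2) ^ n) \<longlonglongrightarrow> 2 * picard_error * 0"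
    by (intro tendsto_intros LIMSEQ_power_zero) auto
  thus ?thesis by (simp add: power_divide)
qed

lemma picard_convergent:
  assumes t: "0 < t" "t < b"
  shows "(\<lambda>n. picard n x t) \<longlonglongrightarrow> lim (\<lambda>n. picard n x t)"
proof -
  have "Cauchy (\<lambda>n. picard n x t)"
  proof (rule CauchyI')
    fix e :: real assume "0 < e"
    with picard_error_tendsto have "eventually (\<lambda>n. 2 * picard_error / 2 ^ n < e) sequentially"
      by (rule order_tendstoD(2))
    then obtain K where K: "\<And>n. n \<ge> K \<Longrightarrow> 2 * picard_error / 2 ^ n < e"
      by (auto simp: eventually_sequentially)
    show "\<exists>K. \<forall>m\<ge>K. \<forall>n>m. dist (picard m x t) (picard n x t) < e"
    proof (intro exI allI impI)
      fix m n assume mn: "K \<le> m" "m < n"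
      have "0 \<le> 2 * picard_error / 2 ^ n" using picard_error_nonneg by simp
      hence "\<bar>picard n x t - picard m x t\<bar> \<le> 2 * picard_error / 2 ^ m"
        using picard_cauchy[OF t, of m "n - m" x] mn by simp
      also note K[OF mn(1)]
      finally show "dist (picard m x t) (picard n x t) < e"
        by (simp add: dist_real_def abs_minus_commute)
    qed
  qed
  thus ?thesis by (simp add: Cauchy_convergent_iff convergent_LIMSEQ_iff)
qed

text \<open>The rate is the same for all vertices and times, which is what allows the limit to pass
  through the Duhamel integral.\<close>

lemma picard_limit_error:
  assumes t: "0 < t" "t < b"
  shows "\<bar>picard n x t - lim (\<lambda>n. picard n x t)\<bar> \<le> 2 * picard_error / 2 ^ n"
proof -
  have "(\<lambda>j. \<bar>picard (n + j) x t - picard n x t\<bar>) \<longlonglongrightarrow> \<bar>lim (\<lambda>n. picard n x t) - picard n x t\<bar>"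
    using picard_convergent[OF t, of x] LIMSEQ_ignore_initial_segment[of _ _ n]
    by (intro tendsto_intros) (auto simp: add.commute)
  hence "\<bar>lim (\<lambda>n. picard n x t) - picard n x t\<bar> \<le> 2 * picard_error / 2 ^ n"
  proof (rule LIMSEQ_le_const2, intro exI allI impI)
    fix j
    have "0 \<le> 2 * picard_error / 2 ^ (n + j)" using picard_error_nonneg by simp
    thus "\<bar>picard (n + j) x t - picard n x t\<bar> \<le> 2 * picard_error / 2 ^ n"
      using picard_cauchy[OF t, of n j x] by linarith
  qed
  thus ?thesis by (simp add: abs_minus_commute)
qed

lemma picard_solution:
  shows "\<exists>w. (\<forall>x. w x \<in> borel_measurable (lebesgue_Ioo 0 b)) \<and>
    (\<forall>x t. 0 < t \<longrightarrow> t < b \<longrightarrow> w x t = P t u0 x + duhamel (\<lambda>y s. N y s (w y s)) x t t)"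
proof (intro exI conjI allI impI)
  let ?w = "\<lambda>x t. lim (\<lambda>n. picard n x t)"
  show w_meas: "?w x \<in> borel_measurable (lebesgue_Ioo 0 b)" for x
    by (rule borel_measurable_LIMSEQ_metric[OF picard_measurable]) (auto intro: picard_convergent)
  fix x t assume t: "0 < t" "t < b"
  have "(\<lambda>n. duhamel (\<lambda>y s. N y s (picard n y s)) x t t) \<longlonglongrightarrow> duhamel (\<lambda>y s. N y s (?w y s)) x t t"
  proof (rule LIM_zero_cancel, rule Lim_null_comparison)
    show "(\<lambda>n. L * (2 * picard_error / 2 ^ n) * t) \<longlonglongrightarrow> 0"
      using tendsto_mult[OF tendsto_mult[OF tendsto_const[of L] picard_error_tendsto] tendsto_const[of t]]
      by simp
    show "eventually (\<lambda>n. norm (duhamel (\<lambda>y s. N y s (picard n y s)) x t t - duhamel (\<lambda>y s. N y s (?w y s)) x t t)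
        \<le> L * (2 * picard_error / 2 ^ n) * t) sequentially"
    proof (intro always_eventually allI)
      fix n
      have "\<bar>duhamel (\<lambda>y s. N y s (picard n y s)) x t t - duhamel (\<lambda>y s. N y s (?w y s)) x t t\<bar>
          \<le> (\<integral>s. L * (2 * picard_error / 2 ^ n) \<partial>lebesgue_Ioo 0 t)"
      proof (rule duhamel_diff_le[OF picard_admissible N_admissible[OF w_meas] _ _ integrable_const_Ioo])
        fix y s assume s: "0 < s" "s < t"
        hence sb: "s < b" using t by simp
        have "\<bar>N y s (picard n y s) - N y s (?w y s)\<bar> \<le> L * \<bar>picard n y s - ?w y s\<bar>"
          by (rule N_lip[OF s(1) sb])
        also have "\<dots> \<le> L * (2 * picard_error / 2 ^ n)"
          by (intro mult_left_mono picard_limit_error s sb) (use L in auto)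
        finally show "\<bar>N y s (picard n y s) - N y s (?w y s)\<bar> \<le> L * (2 * picard_error / 2 ^ n)" .
      qed (use t in auto)
      thus "norm (duhamel (\<lambda>y s. N y s (picard n y s)) x t t - duhamel (\<lambda>y s. N y s (?w y s)) x t t)
        \<le> L * (2 * picard_error / 2 ^ n) * t"
        unfolding integral_const_Ioo[OF less_imp_le[OF t(1)]] by simp
    qed
  qed
  hence "(\<lambda>n. picard (Suc n) x t) \<longlonglongrightarrow> P t u0 x + duhamel (\<lambda>y s. N y s (?w y s)) x t t"
    unfolding picard.simps by (intro tendsto_intros)
  moreover have "(\<lambda>n. picard (Suc n) x t) \<longlonglongrightarrow> ?w x t"
    by (rule LIMSEQ_Suc[OF picard_convergent[OF t]])
  ultimately show "?w x t = P t u0 x + duhamel (\<lambda>y s. N y s (?w y s)) x t t"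
    by (rule LIMSEQ_unique[rotated])
qed

end

text \<open>The nonlinearity is frozen to the given solution up to time \<open>a\<close> and truncated at height \<open>K + 1\<close>
  afterwards. The Picard solution therefore contains the history before \<open>a\<close>, and no concatenation of
  solutions is needed.\<close>

lemma mild_extend:
  assumes K: "0 \<le> K"
  shows "\<exists>\<delta>>0. \<forall>\<tau> a w. mild \<tau> w \<longrightarrow> 0 < a \<longrightarrow> a < \<tau> \<longrightarrow> (\<forall>x. w x a \<le> K) \<longrightarrow>
    (\<exists>w'. mild (a + \<delta>) w')"
proof -
  obtain C1 where C1: "0 \<le> C1" "\<And>r. r \<in> {0..K + 1} \<Longrightarrow> f r \<le> C1"
    using f_bound by blast
  obtain L where L: "L > 0" "\<And>r r'. r \<in> {0..K + 1} \<Longrightarrow> r' \<in> {0..K + 1} \<Longrightarrow> \<bar>f r - f r'\<bar> \<le> L * \<bar>r - r'\<bar>"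
    using f_lip_bound by blast
  \<comment> \<open>During a time \<delta> a source of size at most \<open>C1\<close> raises the
    solution by at most 1, from \<open>K\<close> to the truncation height. The choice precedes the
    solution and depends on \<open>K\<close> alone; the added 1 keeps the denominator
    positive.\<close>
  define \<delta> where "\<delta> = 1 / (C1 + 1)"
  have \<delta>: "0 < \<delta>" "C1 * \<delta> \<le> 1" using C1 by (auto simp: \<delta>_def field_simps)
  have "\<exists>w'. mild (a + \<delta>) w'" if w: "mild \<tau> w" and a: "0 < a" "a < \<tau>" and wK: "\<And>x. w x a \<le> K" for \<tau> a w
  proof -
    have \<tau>: "0 < \<tau>" using a by simp
    obtain M C where M: "0 \<le> M" "\<And>x t. 0 < t \<Longrightarrow> t < \<tau> \<Longrightarrow> w x t \<le> M"
      and adm: "admissible \<tau> C (\<lambda>y s. f (w y s))"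
      using mild_bounded[OF w \<tau>] by blast
    define b where "b = a + \<delta>"
    have b: "0 < b" using a \<delta> by (simp add: b_def)
    \<comment> \<open>The new interval may reach beyond \<tau>, where nothing is known about
      \<open>w\<close>; cutting off by 0 gives a function measurable on the whole line.\<close>
    define v where "v y s = indicator {0<..<\<tau>} s *\<^sub>R w y s" for y s
    define clip where "clip r = max 0 (min r (K + 1))" for r
    define N where "N y s r = (if s \<le> a then f (max 0 (v y s)) else f (max 0 (clip r)))" for y s r
    have clip: "clip r \<in> {0..K + 1}" "max 0 (clip r) = clip r" for r
      using K by (auto simp: clip_def)
    have v_eq: "max 0 (v y s) = w y s" if "0 < s" "s \<le> a" for y s
      using that a mild_nonneg[OF w, of s y] by (simp add: v_def)
    have v_meas: "v y \<in> borel_measurable lebesgue" for y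
      using mild_measurable[OF w, of y] unfolding v_def
      by (subst (asm) borel_measurable_restrict_space_iff) auto
    have N_meas: "(\<lambda>s. N y s (z s)) \<in> borel_measurable (lebesgue_Ioo 0 b)"
      if "z \<in> borel_measurable (lebesgue_Ioo 0 b)" for y z
      unfolding N_def
    proof (rule measurable_If)
      show "(\<lambda>s. f (max 0 (v y s))) \<in> borel_measurable (lebesgue_Ioo 0 b)"
        by (rule measurable_restrict_space1[OF measurable_compose[OF v_meas f_max_measurable]])
      have "clip \<in> borel_measurable borel"
        unfolding clip_def by (intro borel_measurable_continuous_onI continuous_intros)
      from measurable_compose[OF measurable_compose[OF that this] f_max_measurable]
      show "(\<lambda>s. f (max 0 (clip (z s)))) \<in> borel_measurable (lebesgue_Ioo 0 b)" .
      have "{s \<in> space (lebesgue_Ioo 0 b). s \<le> a} = {0<..<b} \<inter> {..a}" by auto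
      thus "{s \<in> space (lebesgue_Ioo 0 b). s \<le> a} \<in> sets (lebesgue_Ioo 0 b)"
        by (auto simp: sets_restrict_space)
    qed
    have N_bound: "\<bar>N y s r\<bar> \<le> max C C1" if "0 < s" "s < b" for y s r
    proof (cases "s \<le> a")
      case True
      thus ?thesis
        using that a adm v_eq[of s y] unfolding N_def admissible_def by (auto simp: le_max_iff_disj)
    next
      case False
      thus ?thesis
        using clip[of r] C1(2)[OF clip(1), of r] f_nonneg[of "clip r"]
        by (auto simp: N_def le_max_iff_disj)
    qed
    have N_lip: "\<bar>N y s r - N y s r'\<bar> \<le> L * \<bar>r - r'\<bar>" for y s r r'
    proof (cases "s \<le> a")
      case True
      thus ?thesis using L by (simp add: N_def)
    next
      case False
      have "\<bar>f (clip r) - f (clip r')\<bar> \<le> L * \<bar>clip r - clip r'\<bar>"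
        by (rule L(2)[OF clip(1) clip(1)])
      also have "\<dots> \<le> L * \<bar>r - r'\<bar>"
        by (rule mult_left_mono) (use L in \<open>auto simp: clip_def\<close>)
      finally show ?thesis using False by (simp add: N_def clip)
    qed
    obtain w' where w'_meas: "\<And>x. w' x \<in> borel_measurable (lebesgue_Ioo 0 b)"
      and w'_eq: "\<And>x t. 0 < t \<Longrightarrow> t < b \<Longrightarrow> w' x t = P t u0 x + duhamel (\<lambda>y s. N y s (w' y s)) x t t"
      using picard_solution[where N = N and C = "max C C1", OF b L(1) N_meas N_bound N_lip] by auto
    have adm': "admissible b (max C C1) (\<lambda>y s. N y s (w' y s))"
      unfolding admissible_def using N_meas[OF w'_meas] N_bound by blast
    have N_eq: "N y s r = f (w y s)" if "0 < s" "s \<le> a" for y s r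
      using that v_eq[OF that, of y] by (simp add: N_def)
    have early: "w' x t = w x t" if t: "0 < t" "t \<le> a" for x t
    proof -
      have "duhamel (\<lambda>y s. N y s (w' y s)) x t t = duhamel (\<lambda>y s. f (w y s)) x t t"
        by (rule duhamel_cong) (use N_eq t in auto)
      thus ?thesis
        using w'_eq[of t x] mild_eq[OF w, of t x] t a \<delta> by (simp add: b_def)
    qed
    \<comment> \<open>After time \<open>a\<close> the history together with the initial datum
      contributes the heat flow of \<open>w\<close> at time \<open>a\<close>, at most
      \<open>K\<close>, and the new source at most 1. So the truncation is never active.\<close>
    have late: "0 \<le> w' x t \<and> w' x t \<le> K + 1" if t: "a < t" "t < b" for x t
    proof -
      have t0: "0 < t" using t a by simp
      have int: "integrable (lebesgue_Ioo 0 t) (\<lambda>s. P (t - s) (\<lambda>y. N y s (w' y s)) x)"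
        by (rule duhamel_integrable[OF adm']) (use t in auto)
      have "duhamel (\<lambda>y s. N y s (w' y s)) x t t =
          duhamel (\<lambda>y s. N y s (w' y s)) x t a + (\<integral>s. P (t - s) (\<lambda>y. N y s (w' y s)) x \<partial>lebesgue_Ioo a t)"
        unfolding duhamel_def by (rule integral_Ioo_combine[OF int]) (use a t in auto)
      also have "duhamel (\<lambda>y s. N y s (w' y s)) x t a = duhamel (\<lambda>y s. f (w y s)) x t a"
        by (rule duhamel_cong) (use N_eq in auto)
      finally have eq: "w' x t = P t u0 x + duhamel (\<lambda>y s. f (w y s)) x t a +
          (\<integral>s. P (t - s) (\<lambda>y. N y s (w' y s)) x \<partial>lebesgue_Ioo a t)"
        using w'_eq[OF t0 t(2), of x] by simp
      have wa: "\<bar>w x a\<bar> \<le> K" for x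
        using wK[of x] mild_nonneg[OF w a, of x] by simp
      have "P t u0 x + duhamel (\<lambda>y s. f (w y s)) x t a = P (t - a) (\<lambda>y. w y a) x"
        using P_mild[OF w a, of "t - a" x] t by simp
      moreover have "P (t - a) (\<lambda>y. w y a) x \<le> K"
        by (rule abs_le_D1[OF P_abs_le]) (use wa t in auto)
      moreover have "0 \<le> P (t - a) (\<lambda>y. w y a) x"
        by (rule P_nonneg) (use t mild_nonneg[OF w a] in auto)
      moreover have N1: "0 \<le> N y s r" "N y s r \<le> C1" if "a < s" for y s r
        using clip[of r] C1(2)[OF clip(1), of r] f_nonneg[of "clip r"] that by (auto simp: N_def)
      have "\<bar>\<integral>s. P (t - s) (\<lambda>y. N y s (w' y s)) x \<partial>lebesgue_Ioo a t\<bar> \<le> C1 * (t - a)"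
        by (intro abs_integral_Ioo_le AE_IooI P_abs_le) (use t N1 in auto)
      moreover have "C1 * (t - a) \<le> C1 * \<delta>"
        by (rule mult_left_mono) (use t C1 in \<open>auto simp: b_def\<close>)
      moreover have "0 \<le> (\<integral>s. P (t - s) (\<lambda>y. N y s (w' y s)) x \<partial>lebesgue_Ioo a t)"
        by (rule integral_nonneg_AE) (use t N1 in \<open>auto intro!: AE_IooI P_nonneg\<close>)
      ultimately show ?thesis
        using eq \<delta>(2) by linarith
    qed
    have nonneg: "0 \<le> w' x t" and bound: "w' x t \<le> max M (K + 1)" if "0 < t" "t < b" for x t
    proof -
      have "0 \<le> w' x t \<and> w' x t \<le> max M (K + 1)"
      proof (cases "t \<le> a")
        case True
        thus ?thesis
          using early[OF that(1) True, of x] mild_nonneg[OF w that(1), of x] M(2)[OF that(1), of x] a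
          by (auto simp: le_max_iff_disj)
      next
        case False
        thus ?thesis using late[of t x] that by (auto simp: le_max_iff_disj)
      qed
      thus "0 \<le> w' x t" "w' x t \<le> max M (K + 1)" by auto
    qed
    have Nf: "N y s (w' y s) = f (w' y s)" if "0 < s" "s < b" for y s
    proof (cases "s \<le> a")
      case True
      thus ?thesis using N_eq[OF that(1) True] early[OF that(1) True] by simp
    next
      case False
      hence "clip (w' y s) = w' y s" using late[of s y] that by (simp add: clip_def)
      thus ?thesis using False clip(2)[of "w' y s"] by (simp add: N_def)
    qed
    have "mild b w'"
      unfolding mild_iff linf_linf_def
    proof (intro conjI allI impI)
      show "\<exists>M. AE t in lebesgue_Ioo 0 b. \<forall>x. \<bar>w' x t\<bar> \<le> M"
        using nonneg bound by (intro exI[of _ "max M (K + 1)"] AE_IooI) auto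
      fix x t assume t: "0 < t" "t < b"
      have "duhamel (\<lambda>y s. N y s (w' y s)) x t t = duhamel (\<lambda>y s. f (w' y s)) x t t"
        by (rule duhamel_cong) (use Nf t in auto)
      thus "w' x t = P t u0 x + duhamel (\<lambda>y s. f (w' y s)) x t t"
        using w'_eq[OF t, of x] by simp
    qed (use w'_meas nonneg in auto)
    thus ?thesis unfolding b_def by blast
  qed
  thus ?thesis using \<delta>(1) by blast
qed

end

section \<open>The bound on the existence time\<close>

text \<open>By convexity and \<open>h 0 = 0\<close> the quotient h(r)/r is nondecreasing, so its
  limit at 0 is a lower bound for it.\<close>

lemma convex_ge_slope_at_zero:
  fixes h :: "real \<Rightarrow> real"
  assumes convex: "convex_on {0..} h" and zero: "h 0 = 0"
    and deriv: "(h has_real_derivative d) (at_right 0)" and s: "0 \<le> s"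
  shows "d * s \<le> h s"
proof (cases "s = 0")
  case False
  hence s: "0 < s" using s by simp
  have "((\<lambda>r. h r / r) \<longlongrightarrow> d) (at_right 0)"
    using deriv by (simp add: has_field_derivative_iff zero)
  moreover have "eventually (\<lambda>r. h r / r \<le> h s / s) (at_right 0)"
    using eventually_at_right_less[of 0] eventually_at_right_real[OF s]
  proof eventually_elim
    case (elim r)
    have "h ((1 - r / s) *\<^sub>R 0 + (r / s) *\<^sub>R s) \<le> (1 - r / s) * h 0 + r / s * h s"
      by (rule convex_onD[OF convex]) (use elim s in auto)
    thus ?case using elim s by (simp add: zero field_simps)
  qed
  ultimately have "d \<le> h s / s"
    by (rule tendsto_upperbound) simp
  thus ?thesis using s by (simp add: field_simps)
qed (simp add: zero)

lemma convex_supporting_line: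
  fixes h :: "real \<Rightarrow> real"
  assumes "convex_on {0..} h" "0 < a"
  shows "\<exists>m. \<forall>s\<ge>0. h a + m * (s - a) \<le> h s"
  using convex_le_Inf_differential[OF assms(1), of a] assms(2) by (auto simp: interior_real_atLeast)

text \<open>A function with \<open>\<Phi> \<ge> a + \<integral> h(\<Phi>)\<close> dominates the solution of \<open>y' = h(y)\<close>, \<open>y(0) = a\<close>, and
  the time which that solution needs to reach height \<open>b\<close> is \<open>\<integral>\<^sub>a\<^sup>b 1/h\<close>.\<close>

lemma integral_inequality_time_bound:
  fixes h \<Phi> :: "real \<Rightarrow> real"
  assumes a: "0 < a" and T: "0 \<le> T"
    and h_cont: "continuous_on {0<..} h" and h_pos: "\<And>s. 0 < s \<Longrightarrow> 0 < h s"
    and h_mono: "\<And>s t. 0 < s \<Longrightarrow> s \<le> t \<Longrightarrow> h s \<le> h t"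
    and \<Phi>_cont: "continuous_on {0..T} \<Phi>" and \<Phi>_pos: "\<And>t. t \<in> {0..T} \<Longrightarrow> 0 < \<Phi> t"
    and \<Phi>_ge: "\<And>t. t \<in> {0..T} \<Longrightarrow> a + integral {0..t} (\<lambda>s. h (\<Phi> s)) \<le> \<Phi> t"
  shows "\<exists>b\<ge>a. T \<le> integral {a..b} (\<lambda>s. 1 / h s)"
proof -
  have h\<Phi>_cont: "continuous_on {0..T} (\<lambda>s. h (\<Phi> s))"
    by (rule continuous_on_compose2[OF h_cont \<Phi>_cont]) (use \<Phi>_pos in auto)
  \<comment> \<open>The right-hand side of the inequality is differentiable even though \<Phi> is
    merely continuous, and \<Psi>' = h(\<Phi>) \<ge> h(\<Psi>) as \<open>h\<close> is
    nondecreasing.\<close>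
  define \<Psi> where "\<Psi> t = a + integral {0..t} (\<lambda>s. h (\<Phi> s))" for t
  have \<Psi>_deriv: "(\<Psi> has_real_derivative h (\<Phi> t)) (at t within {0..T})" if "t \<in> {0..T}" for t
    unfolding \<Psi>_def using integral_has_real_derivative[OF h\<Phi>_cont that]
    by (auto intro!: derivative_eq_intros)
  have \<Psi>_mono: "\<Psi> s \<le> \<Psi> t" if "0 \<le> s" "s \<le> t" "t \<le> T" for s t
  proof -
    have "integral {0..s} (\<lambda>s. h (\<Phi> s)) \<le> integral {0..t} (\<lambda>s. h (\<Phi> s))"
    proof (rule integral_subset_le)
      show "(\<lambda>s. h (\<Phi> s)) integrable_on {0..s}" "(\<lambda>s. h (\<Phi> s)) integrable_on {0..t}"
        using that by (auto intro!: integrable_continuous_real continuous_on_subset[OF h\<Phi>_cont])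
      show "\<forall>s\<in>{0..t}. 0 \<le> h (\<Phi> s)" using that h_pos[OF \<Phi>_pos] by (auto simp: less_imp_le)
    qed (use that in auto)
    thus ?thesis by (simp add: \<Psi>_def)
  qed
  have \<Psi>_range: "\<Psi> t \<in> {a..\<Psi> T}" if "t \<in> {0..T}" for t
    using \<Psi>_mono[of 0 t] \<Psi>_mono[of t T] that by (auto simp: \<Psi>_def)
  have ne: "h s \<noteq> 0" if "0 < s" for s using h_pos[OF that] by simp
  have inv_cont: "continuous_on {a..\<Psi> T} (\<lambda>s. 1 / h s)"
    by (intro continuous_intros continuous_on_subset[OF h_cont]) (use a ne in auto)
  define J where "J b = integral {a..b} (\<lambda>s. 1 / h s)" for b
  have J_deriv: "(J has_real_derivative 1 / h b) (at b within {a..\<Psi> T})" if "b \<in> {a..\<Psi> T}" for b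
    unfolding J_def by (rule integral_has_real_derivative[OF inv_cont that])
  have J\<Psi>_deriv: "((\<lambda>t. J (\<Psi> t) - t) has_real_derivative (1 / h (\<Psi> t) * h (\<Phi> t) - 1)) (at t within {0..T})"
    if t: "t \<in> {0..T}" for t
  proof -
    have "(J has_real_derivative 1 / h (\<Psi> t)) (at (\<Psi> t) within \<Psi> ` {0..T})"
      by (rule DERIV_subset[OF J_deriv[OF \<Psi>_range[OF t]]]) (use \<Psi>_range in auto)
    from DERIV_image_chain[OF this \<Psi>_deriv[OF t]]
    show ?thesis by (auto intro!: derivative_eq_intros simp: o_def)
  qed
  \<comment> \<open>The derivative h(\<Phi>)/h(\<Psi>) - 1 is nonnegative, and
    \<open>J (\<Psi> 0)\<close> is an integral over a single point.\<close>
  have "J (\<Psi> 0) - 0 \<le> J (\<Psi> T) - T"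
  proof (rule DERIV_nonneg_imp_increasing_open[OF T])
    fix t assume t: "0 < t" "t < T"
    have "h (\<Psi> t) \<le> h (\<Phi> t)"
      using \<Phi>_ge[of t] \<Psi>_range[of t] t a by (intro h_mono) (auto simp: \<Psi>_def)
    moreover have "0 < h (\<Psi> t)"
      using \<Psi>_range[of t] t a by (intro h_pos) auto
    ultimately have "0 \<le> 1 / h (\<Psi> t) * h (\<Phi> t) - 1" by (simp add: field_simps)
    moreover have "at t within {0..T} = at t" by (rule at_within_Icc_at[OF t])
    ultimately show "\<exists>y. DERIV (\<lambda>t. J (\<Psi> t) - t) t :> y \<and> 0 \<le> y"
      using J\<Psi>_deriv[of t] t by auto
  next
    show "continuous_on {0..T} (\<lambda>t. J (\<Psi> t) - t)"
      by (rule DERIV_continuous_on[OF J\<Psi>_deriv])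
  qed
  hence "T \<le> J (\<Psi> T)" by (simp add: \<Psi>_def J_def)
  thus ?thesis
    unfolding J_def using \<Psi>_range[of T] T by auto
qed

text \<open>The number \<open>d\<close> stands for the right derivative h'(0), kept in the form of
  the slope inequality \<open>d * s \<le> h s\<close>.\<close>

locale blowup_problem = mild_problem +
  fixes h :: "real \<Rightarrow> real" and d :: real
  assumes d: "0 < d"
    and f_ge_h: "0 \<le> s \<Longrightarrow> h s \<le> f s"
    and h_ge: "0 \<le> s \<Longrightarrow> d * s \<le> h s"
    and h_zero: "h 0 = 0"
    and h_mono: "mono_on {0..} h"
    and h_convex: "convex_on {0..} h"
    and h_integrable: "set_integrable lborel {1..} (\<lambda>s. 1 / h s)"
begin

lemma h_pos: "0 < s \<Longrightarrow> 0 < h s"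
  using h_ge[of s] d by (smt (verit) mult_pos_pos)

lemma h_continuous: "continuous_on {0<..} h"
  by (rule convex_on_continuous[OF open_greaterThan convex_on_subset[OF h_convex]])
    (auto simp: convex_real_interval)

text \<open>The weights have total mass 1, so averaging a supporting line at the mean reproduces the
  value of \<open>h\<close> there. Supporting lines are available at positive points; a mean equal
  to 0 is settled by \<open>h 0 = 0\<close>.\<close>

lemma jensen:
  assumes t: "0 < t" and g: "\<And>y. 0 \<le> g y" "\<And>y. g y \<le> M" and C: "\<And>y. \<bar>f (g y)\<bar> \<le> C"
  shows "h (P t g x) \<le> P t (\<lambda>y. f (g y)) x"
proof -
  have gM: "\<bar>g y\<bar> \<le> M" for y using g[of y] by simp
  have nonneg: "0 \<le> P t g x" by (rule P_nonneg) (use t g in auto)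
  show ?thesis
  proof (cases "P t g x = 0")
    case True
    have "0 \<le> P t (\<lambda>y. f (g y)) x"
      by (rule P_nonneg) (use t g f_nonneg in auto)
    thus ?thesis using True h_zero by simp
  next
    case False
    define a where "a = P t g x"
    have a: "0 < a" using False nonneg by (simp add: a_def)
    obtain m where m: "\<And>s. 0 \<le> s \<Longrightarrow> h a + m * (s - a) \<le> h s"
      using convex_supporting_line[OF h_convex a] by auto
    have fsum: "(\<lambda>y. hk x y t * f (g y) * \<mu> y) summable_on UNIV"
      by (rule P_summable[OF t C])
    have lin: "\<bar>m * g y\<bar> \<le> \<bar>m\<bar> * M" for y
      unfolding abs_mult by (rule mult_left_mono[OF gM]) simp
    have cst: "\<bar>h a - m * a\<bar> \<le> \<bar>h a - m * a\<bar>" by simp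
    have lsum: "(\<lambda>y. hk x y t * (h a - m * a + m * g y) * \<mu> y) summable_on UNIV"
      using summable_on_add[OF P_summable[where g="\<lambda>_. h a - m * a", OF t cst] P_summable[where g = "\<lambda>y. m * g y", OF t lin]]
      by (simp add: distrib_left distrib_right)
    have "h a = P t (\<lambda>y. h a - m * a + m * g y) x"
    proof -
      have "P t (\<lambda>y. (h a - m * a) + m * g y) x = P t (\<lambda>y. h a - m * a) x + P t (\<lambda>y. m * g y) x"
        by (rule P_add[OF P_summable[where g="\<lambda>_. h a - m * a", OF t cst] P_summable[where g = "\<lambda>y. m * g y", OF t lin]])
      also have "\<dots> = h a"
        unfolding P_const[OF t] P_cmult by (simp add: a_def)
      finally show ?thesis ..
    qed
    also have "\<dots> \<le> P t (\<lambda>y. f (g y)) x"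
      unfolding heat_semigroup_def
    proof (rule infsum_mono[OF lsum fsum])
      fix y
      have "h a - m * a + m * g y \<le> f (g y)"
        using m[OF g(1)[of y]] f_ge_h[OF g(1)[of y]] by (simp add: algebra_simps)
      thus "hk x y t * (h a - m * a + m * g y) * \<mu> y \<le> hk x y t * f (g y) * \<mu> y"
        using t by (intro mult_right_mono mult_left_mono kernel_nonneg) auto
    qed
    finally show ?thesis by (simp add: a_def)
  qed
qed

lemma mild_time_bound:
  assumes u: "mild \<tau> u" and T: "0 < T" "T < \<tau>" and pos: "0 < P T u0 x"
  shows "\<exists>b\<ge>P T u0 x. T \<le> integral {P T u0 x..b} (\<lambda>s. 1 / h s)"
proof -
  have \<tau>: "0 < \<tau>" using T by simp
  obtain M C where M: "0 \<le> M" "\<And>x t. 0 < t \<Longrightarrow> t < \<tau> \<Longrightarrow> u x t \<le> M"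
    and adm: "admissible \<tau> C (\<lambda>y s. f (u y s))"
    using mild_bounded[OF u \<tau>] by blast
  define a where "a = P T u0 x"
  define m where "m s = P (T - s) (\<lambda>y. f (u y s)) x" for s
  \<comment> \<open>Written as a Duhamel integral, the function also makes sense at the endpoints
    and is continuous as an indefinite integral; inside (0,T) it is the heat flow of
    \<open>u\<close> at time \<open>t\<close> over the remaining time T - t.\<close>
  define \<Phi> where "\<Phi> t = a + duhamel (\<lambda>y s. f (u y s)) x T t" for t
  have C: "0 \<le> C" by (rule admissible_bound_nonneg[OF adm \<tau>])
  have m_int: "integrable (lebesgue_Ioo 0 T) m"
    unfolding m_def by (rule duhamel_integrable[OF adm]) (use T in auto)
  have \<Phi>_eq: "\<Phi> t = a + integral {0..t} m" if "t \<le> T" for t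
    unfolding \<Phi>_def duhamel_def m_def[symmetric]
    using integral_Ioo_eq(1)[OF integrable_Ioo_subset[OF m_int]] that by simp
  have \<Phi>_cont: "continuous_on {0..T} \<Phi>"
  proof -
    have "continuous_on {0..T} (\<lambda>t. a + integral {0..t} m)"
      by (intro continuous_intros indefinite_integral_continuous_1 integral_Ioo_eq(2)[OF m_int])
    thus ?thesis
      by (rule continuous_on_eq) (simp add: \<Phi>_eq)
  qed
  have \<Phi>_ge_a: "a \<le> \<Phi> t" if "t \<in> {0..T}" for t
    unfolding \<Phi>_def using that T mild_nonneg[OF u]
    by (auto intro!: duhamel_nonneg f_nonneg)
  have \<Phi>_P: "\<Phi> t = P (T - t) (\<lambda>y. u y t) x" if t: "0 < t" "t < T" for t
    using P_mild[OF u t(1), of "T - t" x] t T by (simp add: \<Phi>_def a_def)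
  have "\<exists>b\<ge>a. T \<le> integral {a..b} (\<lambda>s. 1 / h s)"
  proof (rule integral_inequality_time_bound[OF _ _ h_continuous h_pos _ \<Phi>_cont])
    show a0: "0 < a" using pos by (simp add: a_def)
    show "0 < \<Phi> t" if "t \<in> {0..T}" for t
      using \<Phi>_ge_a[OF that] a0 by simp
    show "h s \<le> h t" if "0 < s" "s \<le> t" for s t
      using monotone_onD[OF h_mono] that by auto
    show "a + integral {0..t} (\<lambda>s. h (\<Phi> s)) \<le> \<Phi> t" if t: "t \<in> {0..T}" for t
    proof -
      have "(\<lambda>s. h (\<Phi> s)) integrable_on {0..t}"
        by (intro integrable_continuous_real continuous_on_compose2[OF h_continuous
              continuous_on_subset[OF \<Phi>_cont]])
          (use t a0 \<Phi>_ge_a in \<open>force+\<close>)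
      moreover have "m integrable_on {0..t}"
        by (rule integral_Ioo_eq(2)[OF integrable_Ioo_subset[OF m_int]]) (use t in auto)
      \<comment> \<open>Open intervals, because Jensen's inequality is available only strictly
        between 0 and T.\<close>
      ultimately have "integral {0<..<t} (\<lambda>s. h (\<Phi> s)) \<le> integral {0<..<t} m"
      proof (intro integral_le)
        fix s assume s: "s \<in> {0<..<t}"
        hence sT: "0 < s" "s < T" using t by auto
        hence s\<tau>: "s < \<tau>" using T by simp
        have "h (P (T - s) (\<lambda>y. u y s) x) \<le> P (T - s) (\<lambda>y. f (u y s)) x"
          by (rule jensen[where M = M and C = C])
            (use sT s\<tau> mild_nonneg[OF u] M adm in \<open>auto simp: admissible_def\<close>)
        thus "h (\<Phi> s) \<le> m s" by (simp add: \<Phi>_P[OF sT] m_def)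
      qed (simp_all add: integrable_on_open_interval_real)
      thus ?thesis using t by (simp add: \<Phi>_eq integral_open_interval_real)
    qed
  qed (use T in auto)
  thus ?thesis by (simp add: a_def)
qed

section \<open>The time to infinity of the comparison equation\<close>

lemma inverse_h_integrable:
  assumes r: "0 < r"
  shows "(\<lambda>s. 1 / h s) integrable_on {r..b}"
proof -
  have ne: "h s \<noteq> 0" if "0 < s" for s using h_pos[OF that] by simp
  show ?thesis
    by (intro integrable_continuous_real continuous_intros continuous_on_subset[OF h_continuous])
      (use r ne in auto)
qed

definition tail :: real where
  "tail = integral {1..} (\<lambda>s. 1 / h s)"

lemma integral_le_tail:
  assumes "1 \<le> a"
  shows "integral {a..b} (\<lambda>s. 1 / h s) \<le> tail"
  unfolding tail_def
  by (rule integral_subset_le)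
    (use assms inverse_h_integrable set_borel_integral_eq_integral(1)[OF h_integrable] h_pos
      in \<open>auto simp: less_imp_le\<close>)

text \<open>Below height 1 the slope inequality gives a logarithm divided by \<open>d\<close>, above
  it the integral is at most \<open>tail\<close>. This is how h'(0) becomes a decay rate.\<close>

lemma integral_inverse_h_le:
  assumes a: "0 < a" "a \<le> 1"
  shows "integral {a..b} (\<lambda>s. 1 / h s) \<le> - ln a / d + tail"
proof -
  define B where "B = max b 1"
  have nonneg: "0 \<le> 1 / h s" if "0 < s" for s using h_pos[OF that] by simp
  have "integral {a..b} (\<lambda>s. 1 / h s) \<le> integral {a..B} (\<lambda>s. 1 / h s)"
    by (rule integral_subset_le) (use a nonneg inverse_h_integrable in \<open>auto simp: B_def\<close>)
  also have "\<dots> = integral {a..1} (\<lambda>s. 1 / h s) + integral {1..B} (\<lambda>s. 1 / h s)"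
    by (rule Henstock_Kurzweil_Integration.integral_combine[symmetric])
      (use a inverse_h_integrable in \<open>auto simp: B_def\<close>)
  also have "integral {1..B} (\<lambda>s. 1 / h s) \<le> tail"
    by (rule integral_le_tail) simp
  also have "integral {a..1} (\<lambda>s. 1 / h s) \<le> - ln a / d"
  proof (rule has_integral_le)
    show "((\<lambda>s. 1 / h s) has_integral integral {a..1} (\<lambda>s. 1 / h s)) {a..1}"
      using inverse_h_integrable[OF a(1)] by (rule integrable_integral)
    have "((\<lambda>s. 1 / (d * s)) has_integral (ln 1 / d - ln a / d)) {a..1}"
      by (rule fundamental_theorem_of_calculus[OF a(2)])
        (use a d in \<open>auto intro!: derivative_eq_intros simp: field_simps simp flip: has_real_derivative_iff_has_vector_derivative\<close>)
    thus "((\<lambda>s. 1 / (d * s)) has_integral - ln a / d) {a..1}" by simp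
    fix s assume "s \<in> {a..1}"
    thus "1 / h s \<le> 1 / (d * s)"
      using a d h_ge[of s] by (intro divide_left_mono mult_pos_pos h_pos) auto
  qed
  finally show ?thesis by simp
qed

lemma P_u0_decay:
  assumes u: "mild \<tau> u" and T: "0 < T" "T < \<tau>" "tail < T"
  shows "P T u0 x \<le> exp (d * tail) * exp (- d * T)"
proof (cases "0 < P T u0 x")
  case True
  define a where "a = P T u0 x"
  have a: "0 < a" using True by (simp add: a_def)
  obtain b where b: "T \<le> integral {a..b} (\<lambda>s. 1 / h s)"
    using mild_time_bound[OF u T(1,2) True] by (auto simp: a_def)
  \<comment> \<open>A start above height 1 would limit the time to \<open>tail\<close>, contrary to
    \<open>tail < T\<close>.\<close>
  have "a \<le> 1"
    using integral_le_tail[of a b] b T(3) by linarith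
  hence "T \<le> - ln a / d + tail"
    using integral_inverse_h_le[OF a, of b] b by linarith
  hence "ln a \<le> d * tail - d * T"
    using d by (simp add: field_simps)
  hence "exp (ln a) \<le> exp (d * tail - d * T)" by (simp only: exp_le_cancel_iff)
  thus ?thesis using a by (simp add: a_def exp_diff exp_minus field_simps)
next
  case False
  hence "P T u0 x \<le> 0" by simp
  also have "0 \<le> exp (d * tail) * exp (- d * T)" by simp
  finally show ?thesis .
qed

end

section \<open>Decay of the semigroup on square-summable functions\<close>

text \<open>If the claim failed at \<open>t\<close> by a factor \<open>q > 1\<close>, the excess
  would be squared at each doubling and reach q^(2^n) at time 2^n t, outgrowing the fixed constant
  \<open>C\<close>.\<close>

lemma doubling_decay:
  fixes \<phi> :: "real \<Rightarrow> real"
  assumes pos: "0 < \<phi>0" and double: "\<And>t. 0 < t \<Longrightarrow> (\<phi> t)\<^sup>2 \<le> \<phi>0 * \<phi> (2 * t)"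
    and decay: "\<And>t. B \<le> t \<Longrightarrow> \<phi> t \<le> C * exp (- d * t)" and t: "0 < t"
  shows "\<phi> t \<le> \<phi>0 * exp (- d * t)"
proof (rule ccontr)
  assume neg: "\<not> \<phi> t \<le> \<phi>0 * exp (- d * t)"
  define q where "q = \<phi> t / (\<phi>0 * exp (- d * t))"
  have q: "1 < q" using neg pos by (simp add: q_def)
  have ge: "\<phi>0 * exp (- d * (2 ^ n * t)) * q ^ (2 ^ n) \<le> \<phi> (2 ^ n * t)" for n
  proof (induction n)
    case 0
    thus ?case using pos by (simp add: q_def)
  next
    case (Suc n)
    have "(\<phi>0 * exp (- d * (2 ^ n * t)) * q ^ (2 ^ n))\<^sup>2 \<le> (\<phi> (2 ^ n * t))\<^sup>2"
      using Suc pos q by (intro power_mono) auto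
    also have "\<dots> \<le> \<phi>0 * \<phi> (2 * (2 ^ n * t))"
      by (rule double) (use t in simp)
    finally have "(\<phi>0 * exp (- d * (2 ^ n * t)) * q ^ (2 ^ n))\<^sup>2 \<le> \<phi>0 * \<phi> (2 ^ Suc n * t)"
      by (simp add: mult.assoc)
    moreover have "(\<phi>0 * exp (- d * (2 ^ n * t)) * q ^ (2 ^ n))\<^sup>2 =
        \<phi>0 * (\<phi>0 * exp (- d * (2 ^ Suc n * t)) * q ^ (2 ^ Suc n))"
    proof -
      have "(exp (- d * (2 ^ n * t)))\<^sup>2 = exp (- d * (2 ^ Suc n * t))"
        by (simp add: exp_double[symmetric] algebra_simps)
      moreover have "(q ^ (2 ^ n))\<^sup>2 = q ^ (2 ^ Suc n)"
        by (simp add: power_mult[symmetric] mult.commute)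
      ultimately show ?thesis by (simp add: power_mult_distrib power2_eq_square[of \<phi>0])
    qed
    ultimately show ?case using pos by simp
  qed
  obtain m where m: "C / \<phi>0 < q ^ m" using real_arch_pow[OF q] by blast
  obtain k :: nat where k: "B / t < real k" using reals_Archimedean2 by blast
  \<comment> \<open>Large enough both for the excess to exceed \<open>C / \<phi>0\<close> and for
    the time to pass \<open>B\<close>, where the decay hypothesis starts.\<close>
  define n where "n = max m k"
  have n2: "n \<le> 2 ^ n" using less_exp[of n] by simp
  have "B \<le> real k * t" using k t by (simp add: field_simps)
  also have "\<dots> \<le> 2 ^ n * t"
  proof (rule mult_right_mono)
    have "real k \<le> real (2 ^ n)" using n2 by (simp only: of_nat_le_iff) (simp add: n_def)
    thus "real k \<le> 2 ^ n" by simp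
  qed (use t in simp)
  finally have "\<phi> (2 ^ n * t) \<le> C * exp (- d * (2 ^ n * t))" by (rule decay)
  from order_trans[OF ge[of n] this]
  have "(\<phi>0 * q ^ (2 ^ n)) * exp (- d * (2 ^ n * t)) \<le> C * exp (- d * (2 ^ n * t))"
    by (simp only: mult_ac)
  hence "\<phi>0 * q ^ (2 ^ n) \<le> C"
    by (rule mult_right_le_imp_le) simp
  moreover have "q ^ m \<le> q ^ (2 ^ n)"
    using n2 q by (intro power_increasing) (auto simp: n_def)
  hence "\<phi>0 * q ^ m \<le> \<phi>0 * q ^ (2 ^ n)"
    by (rule mult_left_mono) (use pos in simp)
  ultimately have "\<phi>0 * q ^ m \<le> C" by linarith
  thus False using m pos by (simp add: field_simps)
qed

lemma has_sum_finite_sum: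
  fixes f :: "'i \<Rightarrow> 'b \<Rightarrow> real"
  assumes "finite I" "\<And>i. i \<in> I \<Longrightarrow> (f i has_sum s i) A"
  shows "((\<lambda>x. \<Sum>i\<in>I. f i x) has_sum (\<Sum>i\<in>I. s i)) A"
  using assms by (induction I rule: finite_induct) (auto intro!: has_sum_add)

section \<open>The weighted space of square-summable functions\<close>

context weighted_graph
begin

abbreviation "nrm \<equiv> ell2_norm \<mu>"

text \<open>The factor \<open>sqrt (\<mu> x)\<close> reduces the weighted norm on a finite set to
  \<open>L2_set\<close>, whose triangle and Cauchy-Schwarz inequalities then apply.\<close>

definition partial_norm :: "('a \<Rightarrow> real) \<Rightarrow> 'a set \<Rightarrow> real" where
  "partial_norm g F = L2_set (\<lambda>x. g x * sqrt (\<mu> x)) F"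

lemma partial_norm_eq: "partial_norm g F = sqrt (\<Sum>x\<in>F. (g x)\<^sup>2 * \<mu> x)"
  by (simp add: partial_norm_def L2_set_def power_mult_distrib)

lemma partial_norm_nonneg [simp]: "0 \<le> partial_norm g F"
  by (simp add: partial_norm_def)

lemma partial_norm_square: "(partial_norm g F)\<^sup>2 = (\<Sum>x\<in>F. (g x)\<^sup>2 * \<mu> x)"
  unfolding partial_norm_eq by (simp add: sum_nonneg)

lemma ell2_norm_nonneg [simp]: "0 \<le> nrm g"
  by (simp add: ell2_norm_def infsum_nonneg)

lemma partial_norm_le:
  assumes "g \<in> ell2 \<mu>" "finite F"
  shows "partial_norm g F \<le> nrm g"
  unfolding partial_norm_eq ell2_norm_def
  by (rule real_sqrt_le_mono, rule finite_sum_le_infsum) (use assms in \<open>auto simp: ell2_def\<close>)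

lemma ell2I:
  assumes "\<And>F. finite F \<Longrightarrow> partial_norm g F \<le> B"
  shows "g \<in> ell2 \<mu>" "nrm g \<le> B"
proof -
  have B: "0 \<le> B" using assms[of "{}"] by (simp add: partial_norm_eq)
  have le: "(\<Sum>x\<in>F. (g x)\<^sup>2 * \<mu> x) \<le> B\<^sup>2" if "finite F" for F
    unfolding partial_norm_square[symmetric] using assms[OF that] by (intro power_mono) auto
  have summ: "(\<lambda>x. (g x)\<^sup>2 * \<mu> x) summable_on UNIV"
    by (rule nonneg_bdd_above_summable_on) (auto intro!: bdd_aboveI2[where M = "B\<^sup>2"] le)
  thus "g \<in> ell2 \<mu>" by (simp add: ell2_def)
  have "(\<Sum>\<^sub>\<infinity>x. (g x)\<^sup>2 * \<mu> x) \<le> B\<^sup>2"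
    by (rule infsum_le_finite_sums[OF summ le])
  hence "nrm g \<le> sqrt (B\<^sup>2)" unfolding ell2_norm_def by (rule real_sqrt_le_mono)
  thus "nrm g \<le> B" using B by simp
qed

lemma ell2_add:
  assumes "g \<in> ell2 \<mu>" "k \<in> ell2 \<mu>"
  shows "(\<lambda>x. g x + k x) \<in> ell2 \<mu>" "nrm (\<lambda>x. g x + k x) \<le> nrm g + nrm k"
proof -
  have "partial_norm (\<lambda>x. g x + k x) F \<le> nrm g + nrm k" if "finite F" for F
  proof -
    have "partial_norm (\<lambda>x. g x + k x) F \<le> partial_norm g F + partial_norm k F"
      unfolding partial_norm_def distrib_right by (rule L2_set_triangle_ineq)
    thus ?thesis using partial_norm_le[OF assms(1) that] partial_norm_le[OF assms(2) that] by simp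
  qed
  thus "(\<lambda>x. g x + k x) \<in> ell2 \<mu>" "nrm (\<lambda>x. g x + k x) \<le> nrm g + nrm k"
    using ell2I by blast+
qed

lemma ell2_cmult:
  assumes "g \<in> ell2 \<mu>"
  shows "(\<lambda>x. c * g x) \<in> ell2 \<mu>" "nrm (\<lambda>x. c * g x) = \<bar>c\<bar> * nrm g"
proof -
  show "(\<lambda>x. c * g x) \<in> ell2 \<mu>"
    using assms summable_on_cmult_right[of "\<lambda>x. (g x)\<^sup>2 * \<mu> x" UNIV "c\<^sup>2"]
    by (simp add: ell2_def power_mult_distrib mult.assoc)
  show "nrm (\<lambda>x. c * g x) = \<bar>c\<bar> * nrm g"
    unfolding ell2_norm_def power_mult_distrib mult.assoc infsum_cmult_right'
    by (simp add: real_sqrt_mult)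
qed

lemma ell2_diff:
  assumes "g \<in> ell2 \<mu>" "k \<in> ell2 \<mu>"
  shows "(\<lambda>x. g x - k x) \<in> ell2 \<mu>" "nrm (\<lambda>x. g x - k x) \<le> nrm g + nrm k"
  using ell2_add[OF assms(1) ell2_cmult(1)[OF assms(2), of "-1"]] ell2_cmult(2)[OF assms(2), of "-1"]
  by auto

lemma ell2_zero: "(\<lambda>x. 0) \<in> ell2 \<mu>" "nrm (\<lambda>x. 0) = 0"
  by (simp_all add: ell2_def ell2_norm_def)

lemma ell2_sum:
  assumes "finite I" "\<And>i. i \<in> I \<Longrightarrow> k i \<in> ell2 \<mu>"
  shows "(\<lambda>x. \<Sum>i\<in>I. c i * k i x) \<in> ell2 \<mu> \<and> nrm (\<lambda>x. \<Sum>i\<in>I. c i * k i x) \<le> (\<Sum>i\<in>I. \<bar>c i\<bar> * nrm (k i))"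
  using assms
proof (induction I rule: finite_induct)
  case empty
  thus ?case by (simp add: ell2_zero)
next
  case (insert i I)
  have k: "k i \<in> ell2 \<mu>" using insert by simp
  from insert have IH: "(\<lambda>x. \<Sum>i\<in>I. c i * k i x) \<in> ell2 \<mu>"
    "nrm (\<lambda>x. \<Sum>i\<in>I. c i * k i x) \<le> (\<Sum>i\<in>I. \<bar>c i\<bar> * nrm (k i))" by auto
  show ?case
    using insert.hyps ell2_add[OF ell2_cmult(1)[OF k, of "c i"] IH(1)] ell2_cmult(2)[OF k, of "c i"] IH(2)
    by simp
qed

lemma ell2_abs: "g \<in> ell2 \<mu> \<Longrightarrow> (\<lambda>x. \<bar>g x\<bar>) \<in> ell2 \<mu>"
  by (simp add: ell2_def)

lemma ell2_point_bound:
  assumes "g \<in> ell2 \<mu>"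
  shows "\<bar>g x\<bar> \<le> nrm g / sqrt (\<mu> x)"
proof -
  have "\<bar>g x\<bar> * sqrt (\<mu> x) = partial_norm g {x}"
    by (simp add: partial_norm_def L2_set_def abs_mult)
  also have "\<dots> \<le> nrm g" by (rule partial_norm_le) (use assms in auto)
  finally show ?thesis using measure_pos[of x] by (simp add: field_simps)
qed

lemma sum_mult_le_partial_norm:
  "(\<Sum>x\<in>F. \<bar>g x * k x * \<mu> x\<bar>) \<le> partial_norm g F * partial_norm k F"
proof -
  have "(\<Sum>x\<in>F. \<bar>g x * k x * \<mu> x\<bar>) = (\<Sum>x\<in>F. \<bar>g x * sqrt (\<mu> x)\<bar> * \<bar>k x * sqrt (\<mu> x)\<bar>)"
    by (intro sum.cong refl) (simp add: abs_mult mult_ac)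
  also have "\<dots> \<le> partial_norm g F * partial_norm k F"
    unfolding partial_norm_def by (rule L2_set_mult_ineq)
  finally show ?thesis .
qed

text \<open>Minkowski's integral inequality, obtained by testing the integral against itself.\<close>

lemma ell2_integral:
  assumes w: "integrable M w"
    and int: "\<And>x. integrable M (\<lambda>t. F t x)"
    and F: "\<And>t. t \<in> space M \<Longrightarrow> F t \<in> ell2 \<mu>" "\<And>t. t \<in> space M \<Longrightarrow> nrm (F t) \<le> w t"
  shows "(\<lambda>x. \<integral>t. F t x \<partial>M) \<in> ell2 \<mu>" "nrm (\<lambda>x. \<integral>t. F t x \<partial>M) \<le> (\<integral>t. w t \<partial>M)"
proof -
  define G where "G x = (\<integral>t. F t x \<partial>M)" for x
  have "partial_norm G E \<le> (\<integral>t. w t \<partial>M)" if E: "finite E" for E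
  proof (cases "partial_norm G E = 0")
    case True
    have "0 \<le> w t" if "t \<in> space M" for t
      using F(2)[OF that] ell2_norm_nonneg[of "F t"] by linarith
    hence "0 \<le> (\<integral>t. w t \<partial>M)" by (intro Bochner_Integration.integral_nonneg) auto
    thus ?thesis using True by simp
  next
    case False
    have "(partial_norm G E)\<^sup>2 = (\<Sum>x\<in>E. G x * \<mu> x * (\<integral>t. F t x \<partial>M))"
      unfolding partial_norm_square by (simp add: G_def power2_eq_square mult_ac)
    also have "\<dots> = (\<integral>t. (\<Sum>x\<in>E. G x * \<mu> x * F t x) \<partial>M)"
      using int by simp
    also have "\<dots> \<le> (\<integral>t. partial_norm G E * w t \<partial>M)"
    proof (rule integral_mono)
      fix t assume t: "t \<in> space M"
      have "(\<Sum>x\<in>E. G x * \<mu> x * F t x) \<le> (\<Sum>x\<in>E. \<bar>G x * F t x * \<mu> x\<bar>)"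
        by (intro sum_mono order_trans[OF _ abs_ge_self]) (simp add: mult_ac)
      also have "\<dots> \<le> partial_norm G E * partial_norm (F t) E"
        by (rule sum_mult_le_partial_norm)
      also have "\<dots> \<le> partial_norm G E * w t"
        using partial_norm_le[OF F(1)[OF t] E] F(2)[OF t] by (intro mult_left_mono) auto
      finally show "(\<Sum>x\<in>E. G x * \<mu> x * F t x) \<le> partial_norm G E * w t" .
    qed (use int w in auto)
    also have "\<dots> = partial_norm G E * (\<integral>t. w t \<partial>M)" by simp
    finally have "partial_norm G E * partial_norm G E \<le> partial_norm G E * (\<integral>t. w t \<partial>M)"
      by (simp add: power2_eq_square)
    moreover have "0 < partial_norm G E" using False partial_norm_nonneg[of G E] by linarith
    ultimately show ?thesis by simp
  qed
  from ell2I[OF this] show "(\<lambda>x. \<integral>t. F t x \<partial>M) \<in> ell2 \<mu>"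
      "nrm (\<lambda>x. \<integral>t. F t x \<partial>M) \<le> (\<integral>t. w t \<partial>M)"
    by (simp_all add: G_def[abs_def])
qed

end

section \<open>The semigroup acting on square-summable functions\<close>

context complete_weighted_graph
begin

text \<open>By symmetry and the semigroup identity the squares of a kernel row sum to
  \<open>hk x x (2 * t)\<close>. By Cauchy-Schwarz, the semigroup is then given by absolutely
  convergent sums on square-summable functions.\<close>

lemma partial_norm_kernel_le:
  assumes t: "0 < t" and F: "finite F"
  shows "partial_norm (\<lambda>y. hk x y t) F \<le> sqrt (hk x x (2 * t))"
proof -
  have "(\<Sum>y\<in>F. (hk x y t)\<^sup>2 * \<mu> y) = (\<Sum>y\<in>F. hk x y t * hk y x t * \<mu> y)"
    using kernel_sym[of t] t by (intro sum.cong) (auto simp: power2_eq_square)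
  also have "\<dots> \<le> hk x x (t + t)"
    by (rule finite_sum_le_has_sum[OF kernel_semigroup F])
      (use t kernel_nonneg[of t] in \<open>auto intro!: mult_nonneg_nonneg\<close>)
  finally show ?thesis unfolding partial_norm_eq by (intro real_sqrt_le_mono) simp
qed

lemma sum_P_ell2_le:
  assumes t: "0 < t" and g: "g \<in> ell2 \<mu>" and F: "finite F"
  shows "(\<Sum>y\<in>F. \<bar>hk x y t * g y * \<mu> y\<bar>) \<le> sqrt (hk x x (2 * t)) * nrm g"
proof -
  have "(\<Sum>y\<in>F. \<bar>hk x y t * g y * \<mu> y\<bar>) \<le> partial_norm (\<lambda>y. hk x y t) F * partial_norm g F"
    by (rule sum_mult_le_partial_norm)
  also have "\<dots> \<le> sqrt (hk x x (2 * t)) * nrm g"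
    using t by (intro mult_mono partial_norm_kernel_le partial_norm_le g F) (auto simp: kernel_nonneg)
  finally show ?thesis .
qed

lemma P_summable_ell2:
  assumes "0 < t" "g \<in> ell2 \<mu>"
  shows "(\<lambda>y. hk x y t * g y * \<mu> y) summable_on UNIV"
proof -
  have "(\<lambda>y. \<bar>hk x y t * g y * \<mu> y\<bar>) summable_on UNIV"
    by (rule nonneg_bdd_above_summable_on)
      (auto intro!: bdd_aboveI2[where M = "sqrt (hk x x (2 * t)) * nrm g"] sum_P_ell2_le assms)
  thus ?thesis using summable_on_iff_abs_summable_on_real[of "\<lambda>y. hk x y t * g y * \<mu> y" UNIV] by simp
qed

text \<open>With \<open>c\<close> equal to g\<mu> this is
  \<parallel>\<open>P t g\<close>\<parallel>^2 = \<langle>\<open>P (2 * t) g\<close>, g\<rangle> for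
  \<open>g\<close> supported in \<open>F\<close>.\<close>

lemma P_finite_support_square:
  assumes t: "0 < t" and F: "finite F"
  shows "((\<lambda>x. (\<Sum>y\<in>F. hk x y t * c y)\<^sup>2 * \<mu> x) has_sum
    (\<Sum>y\<in>F. \<Sum>z\<in>F. c y * c z * hk y z (2 * t))) UNIV"
proof -
  have "((\<lambda>x. \<Sum>y\<in>F. \<Sum>z\<in>F. c y * c z * (hk y x t * hk x z t * \<mu> x)) has_sum
    (\<Sum>y\<in>F. \<Sum>z\<in>F. c y * c z * hk y z (t + t))) UNIV"
    by (intro has_sum_finite_sum F has_sum_cmult_right kernel_semigroup) (use t in auto)
  moreover have "(\<Sum>y\<in>F. \<Sum>z\<in>F. c y * c z * (hk y x t * hk x z t * \<mu> x)) =
      (\<Sum>y\<in>F. hk x y t * c y)\<^sup>2 * \<mu> x" for x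
    unfolding power2_eq_square sum_product unfolding sum_distrib_right
    using kernel_sym[of t _ x] t by (intro sum.cong refl) (simp add: mult_ac)
  ultimately show ?thesis by simp
qed

end

text \<open>The vertex \<open>y\<close> is universally quantified outside the existential:
  \<open>C\<close> and \<open>T0\<close> may vary with \<open>y\<close> but are uniform in
  \<open>x\<close>.\<close>

locale decaying_graph = complete_weighted_graph +
  fixes d :: real
  assumes d: "0 < d" and decay: "\<exists>C T0. \<forall>x t. T0 \<le> t \<longrightarrow> hk x y t \<le> C * exp (- d * t)"
begin

lemma finite_decay:
  assumes "finite F"
  shows "\<exists>C T0. \<forall>t\<ge>T0. (\<Sum>y\<in>F. \<Sum>z\<in>F. c y * c z * hk y z t) \<le> C * exp (- d * t)"
proof -
  obtain C T0 where C: "\<And>y x t. T0 y \<le> t \<Longrightarrow> hk x y t \<le> C y * exp (- d * t)"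
    using decay by metis
  \<comment> \<open>Inserting 0 makes the maximum exist for empty \<open>F\<close> and keeps the
    times nonnegative, as \<open>kernel_nonneg\<close> requires.\<close>
  define T1 where "T1 = Max (insert 0 (T0 ` F))"
  have T1: "0 \<le> T1" "\<And>y. y \<in> F \<Longrightarrow> T0 y \<le> T1"
    using assms by (auto simp: T1_def)
  have "(\<Sum>y\<in>F. \<Sum>z\<in>F. c y * c z * hk y z t) \<le> (\<Sum>y\<in>F. \<Sum>z\<in>F. \<bar>c y * c z\<bar> * C z) * exp (- d * t)"
    if t: "T1 \<le> t" for t
    unfolding sum_distrib_right
  proof (intro sum_mono)
    fix y z assume "z \<in> F"
    hence hk: "hk y z t \<le> C z * exp (- d * t)" using T1(2)[of z] t by (intro C) auto
    have hk0: "0 \<le> hk y z t" using T1 t by (intro kernel_nonneg) auto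
    have "c y * c z * hk y z t \<le> \<bar>c y * c z\<bar> * hk y z t"
      by (intro mult_right_mono hk0) simp
    also have "\<dots> \<le> \<bar>c y * c z\<bar> * (C z * exp (- d * t))"
      by (intro mult_left_mono hk) simp
    finally show "c y * c z * hk y z t \<le> \<bar>c y * c z\<bar> * C z * exp (- d * t)" by simp
  qed
  thus ?thesis by blast
qed

text \<open>For \<phi>(t) = \<langle>\<open>P t g\<close>, g\<rangle>, Cauchy-Schwarz gives
  \<phi>(s)^2 \<le> \<parallel>g\<parallel>^2 \<phi>(2s). \<open>doubling_decay\<close> removes the
  constant of the crude decay, and \<phi>(2t) bounds the squared norm of the flow at time t.\<close>

lemma finite_support_contraction:
  assumes t: "0 < t" and F: "finite F" and E: "finite E"
  shows "partial_norm (\<lambda>x. \<Sum>y\<in>F. hk x y t * g y * \<mu> y) E \<le> exp (- d * t) * partial_norm g F"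
proof -
  define c where "c y = g y * \<mu> y" for y
  define \<phi> where "\<phi> t = (\<Sum>y\<in>F. \<Sum>z\<in>F. c y * c z * hk y z t)" for t
  have sq: "(partial_norm (\<lambda>x. \<Sum>y\<in>F. hk x y s * g y * \<mu> y) E)\<^sup>2 \<le> \<phi> (2 * s)"
    if s: "0 < s" and E: "finite E" for s E
    unfolding partial_norm_square \<phi>_def
    by (rule finite_sum_le_has_sum[OF _ E])
      (use P_finite_support_square[OF s F, of c] in \<open>auto simp: c_def mult.assoc\<close>)
  obtain C T0 where C: "\<And>t. T0 \<le> t \<Longrightarrow> \<phi> t \<le> C * exp (- d * t)"
    using finite_decay[OF F, of c] by (auto simp: \<phi>_def)
  have double: "(\<phi> s)\<^sup>2 \<le> (partial_norm g F)\<^sup>2 * \<phi> (2 * s)" if s: "0 < s" for s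
  proof -
    have "\<phi> s = (\<Sum>x\<in>F. g x * (\<Sum>y\<in>F. hk x y s * g y * \<mu> y) * \<mu> x)"
      unfolding \<phi>_def c_def sum_distrib_left sum_distrib_right by (simp add: mult_ac)
    hence "\<bar>\<phi> s\<bar> \<le> (\<Sum>x\<in>F. \<bar>g x * (\<Sum>y\<in>F. hk x y s * g y * \<mu> y) * \<mu> x\<bar>)"
      by (simp only: sum_abs)
    also have "\<dots> \<le> partial_norm g F * partial_norm (\<lambda>x. \<Sum>y\<in>F. hk x y s * g y * \<mu> y) F"
      by (rule sum_mult_le_partial_norm)
    finally have "\<bar>\<phi> s\<bar>\<^sup>2 \<le> (partial_norm g F * partial_norm (\<lambda>x. \<Sum>y\<in>F. hk x y s * g y * \<mu> y) F)\<^sup>2"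
      by (intro power_mono) auto
    also have "\<dots> \<le> (partial_norm g F)\<^sup>2 * \<phi> (2 * s)"
      unfolding power_mult_distrib by (intro mult_left_mono sq s F) auto
    finally show ?thesis by simp
  qed
  show ?thesis
  proof (cases "partial_norm g F = 0")
    case True
    hence "(\<phi> (2 * t))\<^sup>2 \<le> 0" using double[of "2 * t"] t by simp
    hence "(partial_norm (\<lambda>x. \<Sum>y\<in>F. hk x y t * g y * \<mu> y) E)\<^sup>2 \<le> 0"
      using sq[OF t E] by simp
    thus ?thesis using True by simp
  next
    case False
    have "\<phi> (2 * t) \<le> (partial_norm g F)\<^sup>2 * exp (- d * (2 * t))"
    proof (rule doubling_decay[where B = T0 and C = C])
      show "0 < (partial_norm g F)\<^sup>2" using False by simp
    qed (use double C t in auto)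
    also have "\<dots> = (exp (- d * t) * partial_norm g F)\<^sup>2"
      by (simp add: power_mult_distrib exp_double[symmetric] algebra_simps)
    finally have "\<phi> (2 * t) \<le> (exp (- d * t) * partial_norm g F)\<^sup>2" .
    from order_trans[OF sq[OF t E] this] show ?thesis
      by (rule power2_le_imp_le) simp
  qed
qed

text \<open>Testing the norm on a fixed finite set \<open>E\<close> requires only pointwise
  convergence of the truncated sums, so the estimate for finite support passes to the limit.\<close>

lemma P_contraction:
  assumes t: "0 < t" and g: "g \<in> ell2 \<mu>"
  shows P_ell2: "P t g \<in> ell2 \<mu>" and nrm_P_le: "nrm (P t g) \<le> exp (- d * t) * nrm g"
proof -
  have "partial_norm (P t g) E \<le> exp (- d * t) * nrm g" if E: "finite E" for E
  proof (rule tendsto_le[OF finite_subsets_at_top_neq_bot tendsto_const])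
    have "((\<lambda>F. \<Sum>y\<in>F. hk x y t * g y * \<mu> y) \<longlongrightarrow> P t g x) (finite_subsets_at_top UNIV)" for x
      unfolding heat_semigroup_def using has_sum_infsum[OF P_summable_ell2[OF t g]]
      by (simp add: has_sum_def)
    thus "((\<lambda>F. partial_norm (\<lambda>x. \<Sum>y\<in>F. hk x y t * g y * \<mu> y) E) \<longlongrightarrow> partial_norm (P t g) E)
        (finite_subsets_at_top UNIV)"
      unfolding partial_norm_eq by (intro tendsto_intros)
    show "\<forall>\<^sub>F F in finite_subsets_at_top UNIV.
        partial_norm (\<lambda>x. \<Sum>y\<in>F. hk x y t * g y * \<mu> y) E \<le> exp (- d * t) * nrm g"
      using eventually_superset[OF finite.emptyI]
    proof eventually_elim
      case (elim F)
      hence F: "finite F" by simp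
      show ?case
        by (rule order_trans[OF finite_support_contraction[OF t F E]])
          (intro mult_left_mono partial_norm_le g F, simp)
    qed
  qed
  from ell2I[OF this] show "P t g \<in> ell2 \<mu>" "nrm (P t g) \<le> exp (- d * t) * nrm g" by auto
qed

lemma P_P_ell2:
  assumes "0 < s" "0 < t" and g: "g \<in> ell2 \<mu>"
  shows "P s (P t g) x = P (s + t) g x"
  by (rule P_P[OF assms(1,2) P_summable_ell2[OF assms(2) ell2_abs[OF g]]
        P_summable_ell2[OF assms(1) P_ell2[OF assms(2) ell2_abs[OF g]]]])

end

section \<open>The resolvent\<close>

abbreviation half_line :: "real measure" where
  "half_line \<equiv> lebesgue_on {0<..}"

lemma half_line_exp_integrable:
  assumes "0 < c"
  shows "integrable half_line (\<lambda>t. exp (- c * t))"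
proof -
  have "(\<lambda>t. exp (- c * t)) absolutely_integrable_on {0..}"
    by (rule nonnegative_absolutely_integrable_1[OF integrable_on_exp_minus_to_infinity[OF assms]]) simp
  hence "(\<lambda>t. exp (- c * t)) absolutely_integrable_on {0<..}"
    by (rule set_integrable_subset) auto
  thus ?thesis by (simp add: set_integrable_def integrable_restrict_space)
qed

lemma half_line_shift:
  fixes F :: "real \<Rightarrow> real"
  assumes F: "integrable half_line F" and s: "0 \<le> s"
  shows "(\<integral>t. F (s + t) \<partial>half_line) = (\<integral>t. F t \<partial>half_line) - (\<integral>t. F t \<partial>lebesgue_Ioo 0 s)"
proof -
  have int: "set_integrable lebesgue {0<..} F"
    using F by (simp add: set_integrable_def integrable_restrict_space)
  have i1: "set_integrable lebesgue {0<..<s} F" and i2: "set_integrable lebesgue {s<..} F"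
    by (rule set_integrable_subset[OF int]; use s in auto)+
  have "(\<integral>t. F (s + t) \<partial>half_line) = (\<integral>t. indicator {s<..} (s + 1 * t) *\<^sub>R F (s + 1 * t) \<partial>lebesgue)"
    by (subst integral_restrict_space) (auto intro!: Bochner_Integration.integral_cong simp: indicator_def)
  also have "\<dots> = (\<integral>t. indicator {s<..} t *\<^sub>R F t \<partial>lebesgue)"
    by (subst lebesgue_integral_real_affine[where c = 1 and t = s and f = "\<lambda>t. indicator {s<..} t *\<^sub>R F t"]) auto
  finally have shift: "(\<integral>t. F (s + t) \<partial>half_line) = (\<integral>t. indicator {s<..} t *\<^sub>R F t \<partial>lebesgue)" .
  have "AE t in lebesgue. t \<noteq> s"
    by (rule AE_completion[OF AE_lborel_singleton])
  hence ae: "AE t in lebesgue. indicator {0<..} t *\<^sub>R F t =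
      indicator {0<..<s} t *\<^sub>R F t + indicator {s<..} t *\<^sub>R F t"
    by eventually_elim (use s in \<open>auto simp: indicator_def\<close>)
  have "(\<integral>t. F t \<partial>half_line) = (\<integral>t. indicator {0<..} t *\<^sub>R F t \<partial>lebesgue)"
    by (subst integral_restrict_space) auto
  also have "\<dots> = (\<integral>t. indicator {0<..<s} t *\<^sub>R F t + indicator {s<..} t *\<^sub>R F t \<partial>lebesgue)"
    by (rule integral_cong_AE[OF _ _ ae])
      (use int i1 i2 in \<open>auto simp: set_integrable_def intro!: borel_measurable_add\<close>)
  also have "\<dots> = (\<integral>t. indicator {0<..<s} t *\<^sub>R F t \<partial>lebesgue) + (\<integral>t. indicator {s<..} t *\<^sub>R F t \<partial>lebesgue)"
    by (rule Bochner_Integration.integral_add) (use i1 i2 in \<open>auto simp: set_integrable_def\<close>)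
  also have "(\<integral>t. indicator {0<..<s} t *\<^sub>R F t \<partial>lebesgue) = (\<integral>t. F t \<partial>lebesgue_Ioo 0 s)"
    by (subst integral_restrict_space) auto
  finally show ?thesis using shift by simp
qed

section \<open>Finitely supported functions and strong continuity at time zero\<close>

context weighted_graph
begin

definition delta :: "'a \<Rightarrow> 'a \<Rightarrow> real" where
  "delta y z = (if z = y then 1 else 0)"

definition restricted :: "('a \<Rightarrow> real) \<Rightarrow> 'a set \<Rightarrow> 'a \<Rightarrow> real" where
  "restricted g F x = (\<Sum>y\<in>F. g y * delta y x)"

lemma restricted_eq:
  assumes "finite F"
  shows "restricted g F x = (if x \<in> F then g x else 0)"
proof -
  have "restricted g F x = (\<Sum>y\<in>F. if x = y then g y else 0)"
    unfolding restricted_def delta_def by (intro sum.cong) auto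
  thus ?thesis using assms by simp
qed

lemma delta_ell2: "delta y \<in> ell2 \<mu>"
proof -
  have "(\<lambda>x. (delta y x)\<^sup>2 * \<mu> x) summable_on UNIV \<longleftrightarrow>
      (\<lambda>x. (delta y x)\<^sup>2 * \<mu> x) summable_on {y}"
    by (rule summable_on_cong_neutral) (auto simp: delta_def)
  thus ?thesis by (simp add: ell2_def)
qed

lemma restricted_ell2: "finite F \<Longrightarrow> restricted g F \<in> ell2 \<mu>"
  using ell2_sum[of F delta g] delta_ell2 by (simp add: restricted_def[abs_def])

lemma ell2_finite_approximation:
  assumes g: "g \<in> ell2 \<mu>" and e: "0 < e"
  shows "\<exists>F. finite F \<and> nrm (\<lambda>x. g x - restricted g F x) < e"
proof -
  let ?f = "\<lambda>x. (g x)\<^sup>2 * \<mu> x"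
  define S where "S = infsum ?f UNIV"
  have hs: "(?f has_sum S) UNIV" using g by (simp add: ell2_def S_def)
  hence "(sum ?f \<longlongrightarrow> S) (finite_subsets_at_top UNIV)" by (simp add: has_sum_def)
  hence "eventually (\<lambda>F. S - e\<^sup>2 < sum ?f F) (finite_subsets_at_top UNIV)"
    by (rule order_tendstoD) (use e in simp)
  from eventually_happens'[OF finite_subsets_at_top_neq_bot
      eventually_conj[OF eventually_superset[OF finite.emptyI] this]]
  obtain F where F: "finite F" "S - e\<^sup>2 < sum ?f F" by blast
  have "((\<lambda>x. if x \<in> F then ?f x else 0) has_sum sum ?f F) UNIV"
    by (rule has_sum_finite_neutralI[OF F(1)]) auto
  from has_sum_diff_real[OF hs this]
  have "((\<lambda>x. (g x - restricted g F x)\<^sup>2 * \<mu> x) has_sum (S - sum ?f F)) UNIV"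
    by (rule has_sum_cong[THEN iffD1, rotated]) (auto simp: restricted_eq[OF F(1)])
  hence "nrm (\<lambda>x. g x - restricted g F x) = sqrt (S - sum ?f F)"
    unfolding ell2_norm_def by (simp add: infsumI)
  also have "\<dots> < sqrt (e\<^sup>2)" using F by (intro real_sqrt_less_mono) simp
  finally show ?thesis using F e by auto
qed

end

context complete_weighted_graph
begin

lemma P_delta: "P t (delta y) x = hk x y t * \<mu> y"
proof -
  have "P t (delta y) x = (\<Sum>\<^sub>\<infinity>z\<in>{y}. hk x z t * delta y z * \<mu> z)"
    unfolding heat_semigroup_def by (rule infsum_cong_neutral) (auto simp: delta_def)
  thus ?thesis by (simp add: delta_def)
qed

lemma P_restricted:
  assumes "finite F"
  shows "P t (restricted g F) x = (\<Sum>y\<in>F. g y * P t (delta y) x)"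
proof -
  have "P t (restricted g F) x = (\<Sum>\<^sub>\<infinity>y\<in>F. hk x y t * g y * \<mu> y)"
    unfolding heat_semigroup_def
    by (rule infsum_cong_neutral) (auto simp: restricted_eq[OF assms])
  thus ?thesis using assms by (simp add: P_delta mult_ac)
qed

text \<open>The square expands to \<mu>^2 p(y,y,2t) - 2 \<mu>^2 p(y,y,t) + \<mu>, with \<mu> taken
  at \<open>y\<close>. The first term is at most \<mu>, and \<open>exp_deg_le_kernel\<close> makes
  what remains of order t.\<close>

lemma nrm_P_delta_diff:
  assumes t: "0 < t"
  shows "nrm (\<lambda>x. P t (delta y) x - delta y x) \<le> sqrt (2 * \<mu> y * deg y * t)"
    "(\<lambda>x. P t (delta y) x - delta y x) \<in> ell2 \<mu>"
proof -
  let ?k = "\<lambda>x. P t (delta y) x - delta y x"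
  have "((\<lambda>x. (\<mu> y)\<^sup>2 * (hk y x t * hk x y t * \<mu> x)) has_sum ((\<mu> y)\<^sup>2 * hk y y (t + t))) UNIV"
    by (intro has_sum_cmult_right kernel_semigroup) (use t in auto)
  moreover have "((\<lambda>x. if x = y then (1 - 2 * (hk y y t * \<mu> y)) * \<mu> y else 0) has_sum
      (1 - 2 * (hk y y t * \<mu> y)) * \<mu> y) UNIV"
    by (rule has_sum_finite_neutralI[of "{y}"]) auto
  ultimately have "((\<lambda>x. (\<mu> y)\<^sup>2 * (hk y x t * hk x y t * \<mu> x) +
      (if x = y then (1 - 2 * (hk y y t * \<mu> y)) * \<mu> y else 0)) has_sum
      ((\<mu> y)\<^sup>2 * hk y y (t + t) + (1 - 2 * (hk y y t * \<mu> y)) * \<mu> y)) UNIV"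
    by (rule has_sum_add)
  moreover have "(\<mu> y)\<^sup>2 * (hk y x t * hk x y t * \<mu> x) +
      (if x = y then (1 - 2 * (hk y y t * \<mu> y)) * \<mu> y else 0) = (?k x)\<^sup>2 * \<mu> x" for x
    using kernel_sym[of t y x] t
    by (auto simp: P_delta delta_def power2_eq_square algebra_simps)
  ultimately have hs: "((\<lambda>x. (?k x)\<^sup>2 * \<mu> x) has_sum
      ((\<mu> y)\<^sup>2 * hk y y (t + t) + (1 - 2 * (hk y y t * \<mu> y)) * \<mu> y)) UNIV"
    by simp
  show "?k \<in> ell2 \<mu>" using has_sum_imp_summable[OF hs] by (simp add: ell2_def)
  have "hk y y (t + t) \<le> 1 / \<mu> y" using t by (intro kernel_le) simp
  hence "hk y y (t + t) * \<mu> y \<le> 1" using measure_pos[of y] by (simp add: field_simps)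
  hence "(\<mu> y)\<^sup>2 * hk y y (t + t) \<le> \<mu> y"
    using mult_left_mono[of "hk y y (t + t) * \<mu> y" 1 "\<mu> y"] by (simp add: power2_eq_square mult_ac)
  moreover have "1 - hk y y t * \<mu> y \<le> deg y * t"
    using exp_deg_le_kernel[of t y] exp_ge_add_one_self[of "- deg y * t"] t by simp
  hence "2 * \<mu> y * (1 - hk y y t * \<mu> y) \<le> 2 * \<mu> y * (deg y * t)"
    by (rule mult_left_mono) simp
  ultimately have "(\<mu> y)\<^sup>2 * hk y y (t + t) + (1 - 2 * (hk y y t * \<mu> y)) * \<mu> y \<le> 2 * \<mu> y * deg y * t"
    by (simp add: algebra_simps)
  thus "nrm ?k \<le> sqrt (2 * \<mu> y * deg y * t)"
    unfolding ell2_norm_def infsumI[OF hs] by (rule real_sqrt_le_mono)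
qed

end

context decaying_graph
begin

lemma nrm_P_le_nrm:
  assumes "0 < t" "g \<in> ell2 \<mu>"
  shows "nrm (P t g) \<le> nrm g"
proof -
  have "exp (- d * t) \<le> 1" using d assms by simp
  thus ?thesis
    using nrm_P_le[OF assms] mult_right_mono[of "exp (- d * t)" 1 "nrm g"] by simp
qed

lemma P_ell2_diff:
  assumes "0 < t" "g \<in> ell2 \<mu>" "k \<in> ell2 \<mu>"
  shows "P t (\<lambda>y. g y - k y) x = P t g x - P t k x"
  by (rule P_diff; rule P_summable_ell2; fact)

text \<open>Known for point masses, hence for finite combinations; contractivity extends it to
  everything they approximate. Three errors of at most \<open>e / 4\<close> each stay strictly below
  \<open>e\<close>.\<close>

lemma P_strongly_continuous:
  assumes g: "g \<in> ell2 \<mu>"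
  shows "((\<lambda>t. nrm (\<lambda>x. P t g x - g x)) \<longlongrightarrow> 0) (at_right 0)"
proof (rule order_tendstoI)
  fix e :: real assume "e < 0"
  thus "\<forall>\<^sub>F t in at_right 0. e < nrm (\<lambda>x. P t g x - g x)"
    by (intro always_eventually allI less_le_trans[OF _ ell2_norm_nonneg])
next
  fix e :: real assume e: "0 < e"
  obtain F where F: "finite F" "nrm (\<lambda>x. g x - restricted g F x) < e / 4"
    using ell2_finite_approximation[OF g, of "e / 4"] e by auto
  let ?r = "restricted g F"
  have r: "?r \<in> ell2 \<mu>" by (rule restricted_ell2[OF F(1)])
  have gr: "(\<lambda>x. g x - ?r x) \<in> ell2 \<mu>" by (rule ell2_diff(1)[OF g r])
  have "((\<lambda>t. \<Sum>y\<in>F. \<bar>g y\<bar> * sqrt (2 * \<mu> y * deg y * t)) \<longlongrightarrow> (\<Sum>y\<in>F. \<bar>g y\<bar> * sqrt (2 * \<mu> y * deg y * 0))) (at_right 0)"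
    by (intro tendsto_intros)
  hence ev2: "eventually (\<lambda>t. (\<Sum>y\<in>F. \<bar>g y\<bar> * sqrt (2 * \<mu> y * deg y * t)) < e / 4) (at_right 0)"
    by (rule order_tendstoD) (use e in simp)
  show "\<forall>\<^sub>F t in at_right 0. nrm (\<lambda>x. P t g x - g x) < e"
    using ev2 eventually_at_right_less[of 0]
  proof eventually_elim
    case (elim t)
    hence t: "0 < t" by simp
    have eq: "P t g x - g x = (P t (\<lambda>y. g y - ?r y) x + (P t ?r x - ?r x)) - (g x - ?r x)" for x
      by (simp add: P_ell2_diff[OF t g r])
    have rd: "(\<lambda>x. P t ?r x - ?r x) = (\<lambda>x. \<Sum>y\<in>F. g y * (P t (delta y) x - delta y x))"
      unfolding P_restricted[OF F(1)] unfolding restricted_def by (simp add: sum_subtractf right_diff_distrib)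
    have sum: "(\<lambda>x. P t ?r x - ?r x) \<in> ell2 \<mu>"
      "nrm (\<lambda>x. P t ?r x - ?r x) \<le> (\<Sum>y\<in>F. \<bar>g y\<bar> * nrm (\<lambda>x. P t (delta y) x - delta y x))"
      unfolding rd
      using ell2_sum[OF F(1), of "\<lambda>y x. P t (delta y) x - delta y x" g]
        nrm_P_delta_diff(2)[OF t] by auto
    have "(\<Sum>y\<in>F. \<bar>g y\<bar> * nrm (\<lambda>x. P t (delta y) x - delta y x)) \<le>
        (\<Sum>y\<in>F. \<bar>g y\<bar> * sqrt (2 * \<mu> y * deg y * t))"
      by (intro sum_mono mult_left_mono nrm_P_delta_diff(1)[OF t]) simp
    hence b2: "nrm (\<lambda>x. P t ?r x - ?r x) < e / 4" using sum(2) elim by linarith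
    have b1: "nrm (P t (\<lambda>y. g y - ?r y)) \<le> nrm (\<lambda>y. g y - ?r y)"
      by (rule nrm_P_le_nrm[OF t gr])
    note a1 = ell2_add[OF P_ell2[OF t gr] sum(1)]
    have "nrm (\<lambda>x. P t g x - g x) \<le> (nrm (P t (\<lambda>y. g y - ?r y)) + nrm (\<lambda>x. P t ?r x - ?r x)) + nrm (\<lambda>x. g x - ?r x)"
      unfolding eq using ell2_diff(2)[OF a1(1) gr] a1(2) by linarith
    thus ?case using b1 b2 F(2) e by linarith
  qed
qed

text \<open>Contractivity makes the modulus of continuity at time 0 valid from every base time.
  Exchanging the roles of the two times then gives continuity from the left as well.\<close>

lemma P_ell2_continuous:
  assumes g: "g \<in> ell2 \<mu>"
  shows "continuous_on {0<..} (\<lambda>t. P t g x)"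
proof (rule continuous_onI)
  have diff: "\<bar>P (s + h) g x - P s g x\<bar> \<le> nrm (\<lambda>x. P h g x - g x) / sqrt (\<mu> x)" if "0 < s" "0 < h" for s h
  proof -
    have k: "(\<lambda>x. P h g x - g x) \<in> ell2 \<mu>"
      by (rule ell2_diff(1)[OF P_ell2[OF that(2) g] g])
    have "P (s + h) g x - P s g x = P s (P h g) x - P s g x"
      by (simp add: P_P_ell2[OF that g])
    also have "\<dots> = P s (\<lambda>x. P h g x - g x) x"
      by (rule P_ell2_diff[OF that(1) P_ell2[OF that(2) g] g, symmetric])
    finally have "\<bar>P (s + h) g x - P s g x\<bar> \<le> nrm (P s (\<lambda>x. P h g x - g x)) / sqrt (\<mu> x)"
      using ell2_point_bound[OF P_ell2[OF that(1) k]] by simp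
    also have "\<dots> \<le> nrm (\<lambda>x. P h g x - g x) / sqrt (\<mu> x)"
      by (intro divide_right_mono nrm_P_le_nrm that k) simp
    finally show ?thesis .
  qed
  fix t e :: real assume t: "t \<in> {0<..}" and e: "0 < e"
  have "eventually (\<lambda>h. nrm (\<lambda>x. P h g x - g x) < e * sqrt (\<mu> x)) (at_right 0)"
    by (rule order_tendstoD(2)[OF P_strongly_continuous[OF g]]) (use e measure_pos in auto)
  then obtain b where b: "0 < b" "\<And>h. 0 < h \<Longrightarrow> h < b \<Longrightarrow> nrm (\<lambda>x. P h g x - g x) < e * sqrt (\<mu> x)"
    unfolding eventually_at_right_field by auto
  have close: "\<bar>P (s + h) g x - P s g x\<bar> \<le> e" if "0 < s" "0 < h" "h < b" for s h
  proof -
    have "nrm (\<lambda>x. P h g x - g x) / sqrt (\<mu> x) \<le> e"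
      using b(2)[OF that(2,3)] measure_pos[of x] by (simp add: field_simps)
    thus ?thesis using diff[OF that(1,2)] by linarith
  qed
  have "dist (P s g x) (P t g x) \<le> e" if s: "0 < s" "dist s t < b" for s
    using close[of s "t - s"] close[of t "s - t"] s t e
    by (cases s t rule: linorder_cases) (auto simp: dist_real_def abs_minus_commute)
  thus "\<exists>\<delta>>0. \<forall>s\<in>{0<..}. dist s t < \<delta> \<longrightarrow> dist (P s g x) (P t g x) \<le> e"
    using b(1) by auto
qed

end

lemma exp_difference_quotient: "((\<lambda>t. (exp (c * t) - 1) / t) \<longlongrightarrow> c) (at_right (0 :: real))"
proof -
  have "((\<lambda>t. exp (c * t)) has_real_derivative c) (at 0)"
    by (auto intro!: derivative_eq_intros)
  hence "((\<lambda>t. (exp (c * t) - 1) / t) \<longlongrightarrow> c) (at 0)"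
    by (simp add: has_field_derivative_iff)
  thus ?thesis
    by (rule tendsto_mono[rotated]) (simp add: at_le)
qed

section \<open>Coercivity of the generator\<close>

context decaying_graph
begin

abbreviation "generator \<equiv> neg_generator \<mu> \<omega>"

lemma difference_quotient_ell2:
  assumes "0 < t" "g \<in> ell2 \<mu>" "k \<in> ell2 \<mu>"
  shows "(\<lambda>x. (P t g x - g x) / t + k x) \<in> ell2 \<mu>"
  unfolding divide_inverse mult.commute[of _ "inverse t"]
  by (intro ell2_add(1) ell2_cmult(1) ell2_diff(1) P_ell2 assms)

lemma generator_diff:
  assumes "(g1, k1) \<in> generator" "(g2, k2) \<in> generator"
  shows "(\<lambda>x. g1 x - g2 x, \<lambda>x. k1 x - k2 x) \<in> generator"
proof -
  note A = assms[unfolded neg_generator_def, simplified]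
  have g: "g1 \<in> ell2 \<mu>" "g2 \<in> ell2 \<mu>" "k1 \<in> ell2 \<mu>" "k2 \<in> ell2 \<mu>" using A by auto
  define e1 where "e1 t x = (P t g1 x - g1 x) / t + k1 x" for t x
  define e2 where "e2 t x = (P t g2 x - g2 x) / t + k2 x" for t x
  have lim: "((\<lambda>t. nrm (e1 t)) \<longlongrightarrow> 0) (at_right 0)" "((\<lambda>t. nrm (e2 t)) \<longlongrightarrow> 0) (at_right 0)"
    using A by (simp_all add: e1_def[abs_def] e2_def[abs_def])
  have ell: "e1 t \<in> ell2 \<mu>" "e2 t \<in> ell2 \<mu>" if t: "0 < t" for t
    unfolding e1_def[abs_def] e2_def[abs_def] by (intro difference_quotient_ell2 g t)+
  have "((\<lambda>t. nrm (\<lambda>x. (P t (\<lambda>x. g1 x - g2 x) x - (g1 x - g2 x)) / t + (k1 x - k2 x))) \<longlongrightarrow> 0) (at_right 0)"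
  proof (rule Lim_null_comparison)
    show "((\<lambda>t. nrm (e1 t) + nrm (e2 t)) \<longlongrightarrow> 0) (at_right 0)"
      using tendsto_add[OF lim] by simp
    show "\<forall>\<^sub>F t in at_right 0. norm (nrm (\<lambda>x. (P t (\<lambda>x. g1 x - g2 x) x - (g1 x - g2 x)) / t + (k1 x - k2 x)))
        \<le> nrm (e1 t) + nrm (e2 t)"
      using eventually_at_right_less[of 0]
    proof eventually_elim
      case (elim t)
      have "(P t (\<lambda>x. g1 x - g2 x) x - (g1 x - g2 x)) / t + (k1 x - k2 x) = e1 t x - e2 t x" for x
        unfolding P_ell2_diff[OF elim g(1,2)] e1_def e2_def by (simp add: diff_divide_distrib)
      thus ?case using ell2_diff(2)[OF ell[OF elim]] by simp
    qed
  qed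
  thus ?thesis
    unfolding neg_generator_def using g by (auto intro!: ell2_diff(1) P_ell2)
qed

text \<open>Write (1 - tz) g = \<open>P t g\<close> + t w - t e(t), with \<open>w\<close> the
  right-hand side and e(t) the vanishing error of the difference quotient. Take norms, use the decay
  of the semigroup, divide by t and let t tend to 0; no inner product is needed.\<close>

lemma generator_coercive:
  assumes gk: "(g, k) \<in> generator" and z: "z < d"
  shows "(d - z) * nrm g \<le> nrm (\<lambda>x. k x - z * g x)"
proof -
  note A = gk[unfolded neg_generator_def, simplified]
  have g: "g \<in> ell2 \<mu>" "k \<in> ell2 \<mu>" using A by auto
  define e where "e t x = (P t g x - g x) / t + k x" for t x
  define w where "w x = k x - z * g x" for x
  have lim: "((\<lambda>t. nrm (e t)) \<longlongrightarrow> 0) (at_right 0)"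
    using A by (simp add: e_def[abs_def])
  have ell: "e t \<in> ell2 \<mu>" if t: "0 < t" for t
    unfolding e_def[abs_def] by (intro difference_quotient_ell2 g t)
  have w: "w \<in> ell2 \<mu>"
    unfolding w_def[abs_def] by (intro ell2_diff(1) ell2_cmult(1) g)
  have bound: "((1 - exp (- d * t)) / t - z) * nrm g \<le> nrm w + nrm (e t)" if t: "0 < t" for t
  proof -
    have "(1 - t * z) * g x = (P t g x + t * w x) - t * e t x" for x
      using t by (simp add: e_def w_def field_simps)
    hence "\<bar>1 - t * z\<bar> * nrm g = nrm (\<lambda>x. (P t g x + t * w x) - t * e t x)"
      using ell2_cmult(2)[OF g(1), of "1 - t * z"] by simp
    also have "\<dots> \<le> nrm (P t g) + \<bar>t\<bar> * nrm w + \<bar>t\<bar> * nrm (e t)"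
      using ell2_diff(2)[OF ell2_add(1)[OF P_ell2[OF t g(1)] ell2_cmult(1)[OF w, of t]] ell2_cmult(1)[OF ell[OF t], of t]]
        ell2_add(2)[OF P_ell2[OF t g(1)] ell2_cmult(1)[OF w, of t]]
      unfolding ell2_cmult(2)[OF w] ell2_cmult(2)[OF ell[OF t]] by linarith
    also have "nrm (P t g) \<le> exp (- d * t) * nrm g" by (rule nrm_P_le[OF t g(1)])
    finally have "\<bar>1 - t * z\<bar> * nrm g \<le> exp (- d * t) * nrm g + t * nrm w + t * nrm (e t)"
      using t by simp
    moreover have "(1 - t * z) * nrm g \<le> \<bar>1 - t * z\<bar> * nrm g"
      by (intro mult_right_mono) auto
    ultimately have "(1 - t * z) * nrm g \<le> exp (- d * t) * nrm g + t * nrm w + t * nrm (e t)"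
      by linarith
    hence "((1 - exp (- d * t)) - t * z) * nrm g \<le> t * (nrm w + nrm (e t))"
      by (simp add: algebra_simps)
    hence "((1 - exp (- d * t)) - t * z) * nrm g / t \<le> nrm w + nrm (e t)"
      using t by (simp add: divide_le_eq mult.commute)
    moreover have "((1 - exp (- d * t)) - t * z) * nrm g / t = ((1 - exp (- d * t)) / t - z) * nrm g"
      using t by (simp add: field_simps)
    ultimately show ?thesis by simp
  qed
  from tendsto_minus[OF exp_difference_quotient[of "- d"]] have "((\<lambda>t. (1 - exp (- d * t)) / t) \<longlongrightarrow> d) (at_right 0)"
    by (simp add: minus_divide_left)
  hence "((\<lambda>t. ((1 - exp (- d * t)) / t - z) * nrm g) \<longlongrightarrow> (d - z) * nrm g) (at_right 0)"
    by (intro tendsto_intros)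
  moreover have "((\<lambda>t. nrm w + nrm (e t)) \<longlongrightarrow> nrm w + 0) (at_right 0)"
    by (intro tendsto_intros lim)
  moreover have "\<forall>\<^sub>F t in at_right 0. ((1 - exp (- d * t)) / t - z) * nrm g \<le> nrm w + nrm (e t)"
    using eventually_at_right_less[of 0] by eventually_elim (rule bound)
  ultimately have "(d - z) * nrm g \<le> nrm w + 0"
    by (intro tendsto_le[OF _ _ _, of "at_right 0"]) auto
  thus ?thesis by (simp add: w_def[abs_def])
qed

section \<open>The resolvent as a Laplace transform\<close>

context
  fixes z :: real and r :: "'a \<Rightarrow> real"
  assumes z: "z < d" and r: "r \<in> ell2 \<mu>"
begin

definition flow :: "real \<Rightarrow> 'a \<Rightarrow> real" where
  "flow t x = exp (z * t) * P t r x"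

definition resolvent :: "'a \<Rightarrow> real" where
  "resolvent x = (\<integral>t. flow t x \<partial>half_line)"

lemma flow_ell2: "0 < t \<Longrightarrow> flow t \<in> ell2 \<mu>"
  unfolding flow_def[abs_def] by (intro ell2_cmult(1) P_ell2 r)

lemma nrm_flow_le:
  assumes "0 < t"
  shows "nrm (flow t) \<le> nrm r * exp (- (d - z) * t)"
proof -
  have "nrm (flow t) = exp (z * t) * nrm (P t r)"
    unfolding flow_def[abs_def] using ell2_cmult(2)[OF P_ell2[OF assms r]] by simp
  also have "\<dots> \<le> exp (z * t) * (exp (- d * t) * nrm r)"
    by (intro mult_left_mono nrm_P_le assms r) simp
  also have "exp (z * t) * (exp (- d * t) * nrm r) = nrm r * (exp (z * t) * exp (- d * t))"
    by simp
  also have "\<dots> = nrm r * exp (- (d - z) * t)"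
    unfolding mult_exp_exp by (simp add: algebra_simps)
  finally show ?thesis .
qed

lemma flow_continuous: "continuous_on {0<..} (\<lambda>t. flow t x)"
  unfolding flow_def by (intro continuous_intros P_ell2_continuous r)

lemma flow_measurable: "(\<lambda>t. flow t x) \<in> borel_measurable half_line"
  by (rule continuous_imp_measurable_on_sets_lebesgue[OF flow_continuous]) auto

lemma exp_weight_integrable: "integrable half_line (\<lambda>t. c * exp (- (d - z) * t))"
  by (intro integrable_mult_right half_line_exp_integrable) (use z in simp)

lemma flow_integrable: "integrable half_line (\<lambda>t. flow t x)"
proof (rule Bochner_Integration.integrable_bound[OF exp_weight_integrable[of "nrm r / sqrt (\<mu> x)"] flow_measurable])
  show "AE t in half_line. norm (flow t x) \<le> norm (nrm r / sqrt (\<mu> x) * exp (- (d - z) * t))"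
  proof (rule AE_I2)
    fix t assume "t \<in> space half_line"
    hence t: "0 < t" by simp
    have "\<bar>flow t x\<bar> \<le> nrm (flow t) / sqrt (\<mu> x)"
      by (rule ell2_point_bound[OF flow_ell2[OF t]])
    also have "\<dots> \<le> nrm r * exp (- (d - z) * t) / sqrt (\<mu> x)"
      by (intro divide_right_mono nrm_flow_le t) simp
    finally show "norm (flow t x) \<le> norm (nrm r / sqrt (\<mu> x) * exp (- (d - z) * t))"
      by (simp add: abs_mult)
  qed
qed

lemma flow_integrable_Ioo: "integrable (lebesgue_Ioo 0 s) (\<lambda>t. flow t x)"
  by (rule integrable_lebesgue_on_subset[OF flow_integrable]) auto

lemma resolvent_ell2: "resolvent \<in> ell2 \<mu>"
  unfolding resolvent_def[abs_def]
  by (rule ell2_integral(1)[OF exp_weight_integrable flow_integrable, of _ "nrm r"])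
    (use flow_ell2 nrm_flow_le in simp_all)

lemma P_flow:
  assumes "0 < s" "0 < t"
  shows "P s (flow t) x = exp (- z * s) * flow (s + t) x"
proof -
  have "P s (flow t) x = exp (z * t) * P (s + t) r x"
    unfolding flow_def[abs_def] P_cmult P_P_ell2[OF assms r] ..
  also have "exp (z * t) = exp (- z * s) * exp (z * (s + t))"
    unfolding mult_exp_exp by (simp add: algebra_simps)
  also have "\<dots> * P (s + t) r x = exp (- z * s) * flow (s + t) x"
    by (simp add: flow_def)
  finally show ?thesis .
qed

text \<open>Applying the semigroup shifts the Laplace integral, up to the factor exp(-zs). The
  result is written through the missing piece over (0,s), ready for differentiation at s =
  0.\<close>

lemma P_resolvent:
  assumes s: "0 < s"
  shows "P s resolvent x = exp (- z * s) * (resolvent x - (\<integral>t. flow t x \<partial>lebesgue_Ioo 0 s))"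
proof -
  define F where "F y t = hk x y s * flow t y * \<mu> y" for y t
  define K where "K = sqrt (hk x x (2 * s))"
  have "((\<lambda>y. \<integral>t. F y t \<partial>half_line) has_sum (\<integral>t. (\<Sum>\<^sub>\<infinity>y. F y t) \<partial>half_line)) UNIV"
  proof (rule has_sum_lebesgue_integral(1)[OF vertices_countable _ exp_weight_integrable[of "K * nrm r"]])
    show "F y \<in> borel_measurable half_line" for y
      unfolding F_def by (intro borel_measurable_times borel_measurable_const flow_measurable)
    fix A t assume "t \<in> space half_line" and A: "finite (A :: 'a set)"
    hence t: "0 < t" by simp
    have "(\<Sum>y\<in>A. \<bar>F y t\<bar>) \<le> K * nrm (flow t)"
      unfolding F_def K_def by (rule sum_P_ell2_le[OF s flow_ell2[OF t] A])
    also have "\<dots> \<le> K * (nrm r * exp (- (d - z) * t))"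
      by (intro mult_left_mono nrm_flow_le t) (use s in \<open>simp add: K_def kernel_nonneg\<close>)
    finally show "(\<Sum>y\<in>A. \<bar>F y t\<bar>) \<le> K * nrm r * exp (- (d - z) * t)" by simp
  qed
  hence "(\<Sum>\<^sub>\<infinity>y. \<integral>t. F y t \<partial>half_line) = (\<integral>t. (\<Sum>\<^sub>\<infinity>y. F y t) \<partial>half_line)"
    by (rule infsumI)
  moreover have "(\<integral>t. F y t \<partial>half_line) = hk x y s * resolvent y * \<mu> y" for y
    unfolding F_def resolvent_def by simp
  moreover have "(\<integral>t. (\<Sum>\<^sub>\<infinity>y. F y t) \<partial>half_line) = (\<integral>t. exp (- z * s) * flow (s + t) x \<partial>half_line)"
  proof (rule Bochner_Integration.integral_cong)
    fix t assume "t \<in> space half_line"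
    hence t: "0 < t" by simp
    show "(\<Sum>\<^sub>\<infinity>y. F y t) = exp (- z * s) * flow (s + t) x"
      unfolding F_def P_flow[OF s t, symmetric] heat_semigroup_def ..
  qed simp
  ultimately have "P s resolvent x = exp (- z * s) * (\<integral>t. flow (s + t) x \<partial>half_line)"
    by (simp add: heat_semigroup_def)
  also have "(\<integral>t. flow (s + t) x \<partial>half_line) = resolvent x - (\<integral>t. flow t x \<partial>lebesgue_Ioo 0 s)"
    unfolding resolvent_def by (rule half_line_shift[OF flow_integrable]) (use s in simp)
  finally show ?thesis .
qed

lemma flow_at_zero: "((\<lambda>t. nrm (\<lambda>x. flow t x - r x)) \<longlongrightarrow> 0) (at_right 0)"
proof (rule Lim_null_comparison)
  have "((\<lambda>t. exp (z * t) * nrm (\<lambda>x. P t r x - r x) + \<bar>exp (z * t) - 1\<bar> * nrm r) \<longlongrightarrow>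
      exp (z * 0) * 0 + \<bar>exp (z * 0) - 1\<bar> * nrm r) (at_right 0)"
    by (intro tendsto_intros P_strongly_continuous r)
  thus "((\<lambda>t. exp (z * t) * nrm (\<lambda>x. P t r x - r x) + \<bar>exp (z * t) - 1\<bar> * nrm r) \<longlongrightarrow> 0) (at_right 0)"
    by simp
  show "\<forall>\<^sub>F t in at_right 0. norm (nrm (\<lambda>x. flow t x - r x)) \<le>
      exp (z * t) * nrm (\<lambda>x. P t r x - r x) + \<bar>exp (z * t) - 1\<bar> * nrm r"
    using eventually_at_right_less[of 0]
  proof eventually_elim
    case (elim t)
    have k: "(\<lambda>x. P t r x - r x) \<in> ell2 \<mu>" by (rule ell2_diff(1)[OF P_ell2[OF elim r] r])
    have "flow t x - r x = exp (z * t) * (P t r x - r x) + (exp (z * t) - 1) * r x" for x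
      by (simp add: flow_def algebra_simps)
    thus ?case
      using ell2_add(2)[OF ell2_cmult(1)[OF k, of "exp (z * t)"] ell2_cmult(1)[OF r, of "exp (z * t) - 1"]]
      unfolding ell2_cmult(2)[OF k] ell2_cmult(2)[OF r] by simp
  qed
qed

text \<open>Subtracting \<open>r\<close> isolates the part of the mean of the flow that vanishes in
  norm as \<open>s\<close> tends to 0.\<close>

definition flow_average :: "real \<Rightarrow> 'a \<Rightarrow> real" where
  "flow_average s x = (\<integral>t. flow t x - r x \<partial>lebesgue_Ioo 0 s) / s"

lemma flow_average_ell2:
  assumes s: "0 < s" and e: "\<And>t. 0 < t \<Longrightarrow> t < s \<Longrightarrow> nrm (\<lambda>x. flow t x - r x) \<le> e"
  shows "flow_average s \<in> ell2 \<mu>" "nrm (flow_average s) \<le> e"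
proof -
  have int: "integrable (lebesgue_Ioo 0 s) (\<lambda>t. flow t x - r x)" for x
    by (intro Bochner_Integration.integrable_diff flow_integrable_Ioo integrable_const_Ioo)
  note M = ell2_integral[where F = "\<lambda>t x. flow t x - r x", OF integrable_const_Ioo[of 0 s e] int]
  have 1: "(\<lambda>x. \<integral>t. flow t x - r x \<partial>lebesgue_Ioo 0 s) \<in> ell2 \<mu>"
    by (rule M(1)) (use e in \<open>auto intro!: ell2_diff(1) flow_ell2 r\<close>)
  have "nrm (\<lambda>x. \<integral>t. flow t x - r x \<partial>lebesgue_Ioo 0 s) \<le> (\<integral>t. e \<partial>lebesgue_Ioo 0 s)"
    by (rule M(2)) (use e in \<open>auto intro!: ell2_diff(1) flow_ell2 r\<close>)
  hence 2: "nrm (\<lambda>x. \<integral>t. flow t x - r x \<partial>lebesgue_Ioo 0 s) \<le> e * s"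
    unfolding integral_const_Ioo[OF less_imp_le[OF s]] by simp
  have eq: "flow_average s = (\<lambda>x. (1 / s) * (\<integral>t. flow t x - r x \<partial>lebesgue_Ioo 0 s))"
    by (simp add: flow_average_def[abs_def])
  show "flow_average s \<in> ell2 \<mu>" unfolding eq by (rule ell2_cmult(1)[OF 1])
  show "nrm (flow_average s) \<le> e"
    unfolding eq ell2_cmult(2)[OF 1] using 2 s by (simp add: field_simps)
qed

lemma flow_average_tendsto:
  "\<forall>\<^sub>F s in at_right 0. flow_average s \<in> ell2 \<mu>"
  "((\<lambda>s. nrm (flow_average s)) \<longlongrightarrow> 0) (at_right 0)"
proof -
  have *: "\<forall>\<^sub>F s in at_right 0. flow_average s \<in> ell2 \<mu> \<and> nrm (flow_average s) \<le> e" if e: "0 < e" for e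
  proof -
    have "eventually (\<lambda>t. nrm (\<lambda>x. flow t x - r x) < e) (at_right 0)"
      by (rule order_tendstoD(2)[OF flow_at_zero e])
    then obtain b where b: "0 < b" "\<And>t. 0 < t \<Longrightarrow> t < b \<Longrightarrow> nrm (\<lambda>x. flow t x - r x) < e"
      unfolding eventually_at_right_field by auto
    show ?thesis
      using eventually_at_right_real[OF b(1)]
    proof eventually_elim
      case (elim s)
      have s: "0 < s" using elim by simp
      have "nrm (\<lambda>x. flow t x - r x) \<le> e" if "0 < t" "t < s" for t
        using b(2)[of t] that elim by simp
      from flow_average_ell2[OF s this] show ?case by blast
    qed
  qed
  show "\<forall>\<^sub>F s in at_right 0. flow_average s \<in> ell2 \<mu>"
    using *[of 1] by (auto elim: eventually_mono)
  show "((\<lambda>s. nrm (flow_average s)) \<longlongrightarrow> 0) (at_right 0)"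
  proof (rule order_tendstoI)
    fix e :: real assume "e < 0"
    thus "\<forall>\<^sub>F s in at_right 0. e < nrm (flow_average s)"
      by (intro always_eventually allI less_le_trans[OF _ ell2_norm_nonneg])
  next
    fix e :: real assume "0 < e"
    thus "\<forall>\<^sub>F s in at_right 0. nrm (flow_average s) < e"
      using *[of "e / 2"] by (auto elim!: eventually_mono)
  qed
qed

text \<open>By \<open>P_resolvent\<close> the error of the difference quotient splits into a
  multiple of \<open>resolvent\<close>, a multiple of \<open>flow_average\<close> and a multiple of
  \<open>r\<close>. The first and third coefficients tend to 0, and in the middle term the average
  itself does.\<close>

lemma resolvent_in_generator: "(resolvent, \<lambda>x. r x + z * resolvent x) \<in> generator"
proof -
  have "((\<lambda>s. nrm (\<lambda>x. (P s resolvent x - resolvent x) / s + (r x + z * resolvent x))) \<longlongrightarrow> 0) (at_right 0)"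
  proof (rule Lim_null_comparison)
    have "((\<lambda>s. \<bar>(exp (- z * s) - 1) / s + z\<bar> * nrm resolvent + exp (- z * s) * nrm (flow_average s)
        + \<bar>1 - exp (- z * s)\<bar> * nrm r) \<longlongrightarrow>
      \<bar>- z + z\<bar> * nrm resolvent + exp (- z * 0) * 0 + \<bar>1 - exp (- z * 0)\<bar> * nrm r) (at_right 0)"
      by (intro tendsto_intros flow_average_tendsto exp_difference_quotient)
    thus "((\<lambda>s. \<bar>(exp (- z * s) - 1) / s + z\<bar> * nrm resolvent + exp (- z * s) * nrm (flow_average s)
        + \<bar>1 - exp (- z * s)\<bar> * nrm r) \<longlongrightarrow> 0) (at_right 0)"
      by simp
    show "\<forall>\<^sub>F s in at_right 0. norm (nrm (\<lambda>x. (P s resolvent x - resolvent x) / s + (r x + z * resolvent x)))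
        \<le> \<bar>(exp (- z * s) - 1) / s + z\<bar> * nrm resolvent + exp (- z * s) * nrm (flow_average s)
        + \<bar>1 - exp (- z * s)\<bar> * nrm r"
      using eventually_at_right_less[of 0] flow_average_tendsto(1)
    proof eventually_elim
      case (elim s)
      hence s: "0 < s" and avg: "flow_average s \<in> ell2 \<mu>" by auto
      let ?a = "(exp (- z * s) - 1) / s + z" and ?b = "exp (- z * s)"
      have "(P s resolvent x - resolvent x) / s + (r x + z * resolvent x) =
          (?a * resolvent x - ?b * flow_average s x) + (1 - ?b) * r x" for x
      proof -
        have "(\<integral>t. flow t x - r x \<partial>lebesgue_Ioo 0 s) = (\<integral>t. flow t x \<partial>lebesgue_Ioo 0 s) - r x * s"
          using integral_const_Ioo[of 0 s "r x"] s
          by (subst Bochner_Integration.integral_diff[OF flow_integrable_Ioo integrable_const_Ioo]) simp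
        hence "s * flow_average s x = (\<integral>t. flow t x \<partial>lebesgue_Ioo 0 s) - r x * s"
          using s by (simp add: flow_average_def)
        hence avg_eq: "(\<integral>t. flow t x \<partial>lebesgue_Ioo 0 s) = s * (flow_average s x + r x)"
          by (simp add: algebra_simps)
        show ?thesis
          unfolding P_resolvent[OF s] avg_eq using s by (simp add: field_simps)
      qed
      hence "nrm (\<lambda>x. (P s resolvent x - resolvent x) / s + (r x + z * resolvent x)) =
          nrm (\<lambda>x. (?a * resolvent x - ?b * flow_average s x) + (1 - ?b) * r x)"
        by simp
      also have "\<dots> \<le> \<bar>?a\<bar> * nrm resolvent + ?b * nrm (flow_average s) + \<bar>1 - ?b\<bar> * nrm r"
      proof -
        note res = ell2_cmult[OF resolvent_ell2, of ?a] and av = ell2_cmult[OF avg, of ?b]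
          and rr = ell2_cmult[OF r, of "1 - ?b"]
        show ?thesis
          using ell2_add(2)[OF ell2_diff(1)[OF res(1) av(1)] rr(1)] ell2_diff(2)[OF res(1) av(1)]
            res(2) av(2) rr(2) by simp
      qed
      finally show ?case by simp
    qed
  qed
  thus ?thesis
    unfolding neg_generator_def
    by (auto intro!: resolvent_ell2 ell2_add(1) ell2_cmult(1) r P_ell2)
qed

end

text \<open>The Laplace transform gives existence; coercivity, applied to differences for
  uniqueness, gives the rest with \<open>C = 1 / (d - z)\<close>.\<close>

lemma mem_resolvent_set:
  assumes z: "z < d"
  shows "z \<in> resolvent_set \<mu> generator"
proof -
  have "\<exists>!g. \<exists>k. (g, k) \<in> generator \<and> (\<forall>x. k x - z * g x = r x)" if r: "r \<in> ell2 \<mu>" for r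
  proof (rule ex_ex1I)
    show "\<exists>g k. (g, k) \<in> generator \<and> (\<forall>x. k x - z * g x = r x)"
      using resolvent_in_generator[OF z r] by fastforce
    fix g1 g2
    assume "\<exists>k. (g1, k) \<in> generator \<and> (\<forall>x. k x - z * g1 x = r x)"
      and "\<exists>k. (g2, k) \<in> generator \<and> (\<forall>x. k x - z * g2 x = r x)"
    then obtain k1 k2 where 1: "(g1, k1) \<in> generator" "\<And>x. k1 x - z * g1 x = r x"
      and 2: "(g2, k2) \<in> generator" "\<And>x. k2 x - z * g2 x = r x" by blast
    have "(\<lambda>x. (k1 x - k2 x) - z * (g1 x - g2 x)) = (\<lambda>x. 0)"
      using 1(2) 2(2) by (auto simp: fun_eq_iff algebra_simps)
    hence "(d - z) * nrm (\<lambda>x. g1 x - g2 x) \<le> 0"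
      using generator_coercive[OF generator_diff[OF 1(1) 2(1)] z] by (simp add: ell2_zero)
    hence zero: "nrm (\<lambda>x. g1 x - g2 x) \<le> 0" using z by (simp add: mult_le_0_iff)
    have ell: "(\<lambda>x. g1 x - g2 x) \<in> ell2 \<mu>"
      using 1(1) 2(1) by (auto simp: neg_generator_def intro!: ell2_diff(1))
    have "\<bar>g1 x - g2 x\<bar> \<le> 0" for x
      by (rule order_trans[OF ell2_point_bound[OF ell]])
        (use zero measure_pos[of x] in \<open>auto simp: divide_le_0_iff\<close>)
    thus "g1 = g2" by (auto simp: fun_eq_iff)
  qed
  moreover have "nrm g \<le> 1 / (d - z) * nrm (\<lambda>x. k x - z * g x)" if "(g, k) \<in> generator" for g k
    using generator_coercive[OF that z] z by (simp add: field_simps)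
  hence "\<exists>C. \<forall>(g, k)\<in>generator. nrm g \<le> C * nrm (\<lambda>x. k x - z * g x)"
    by (intro exI[of _ "1 / (d - z)"]) auto
  ultimately show ?thesis unfolding resolvent_set_def by blast
qed

lemma lambda1_ge: "ereal d \<le> lambda1 \<mu> \<omega>"
  unfolding lambda1_def
proof (rule INF_greatest)
  fix z assume "z \<in> spectrum \<mu> generator"
  hence "\<not> z < d" using mem_resolvent_set by (auto simp: spectrum_def)
  thus "ereal d \<le> ereal z" by simp
qed

end

section \<open>Blow-up\<close>

context blowup_problem
begin

text \<open>As u0 dominates \<open>u0 y0\<close> times the point mass at \<open>y0\<close>, its
  decay bounds the kernel column of \<open>y0\<close> uniformly in \<open>x\<close>. The other
  columns follow from p(x,y,t) p(y,y0,1) \<mu>(y) \<le> p(x,y0,t+1) and positivity of the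
  kernel.\<close>

lemma global_existence_imp_lambda1_ge:
  assumes global: "\<And>R. \<exists>r v. R < r \<and> mild r v" and y0: "u0 y0 \<noteq> 0"
  shows "ereal d \<le> lambda1 \<mu> \<omega>"
proof -
  have u0y: "0 < u0 y0" using y0 u0_nonneg[of y0] by simp
  define C where "C = exp (d * tail) / (u0 y0 * \<mu> y0)"
  have base: "hk x y0 T \<le> C * exp (- d * T)" if T: "0 < T" "tail < T" for x T
  proof -
    obtain r v where r: "T < r" "mild r v" using global by blast
    have "(\<Sum>y\<in>{y0}. hk x y T * u0 y * \<mu> y) \<le> P T u0 x"
      unfolding heat_semigroup_def
      by (rule finite_sum_le_infsum[OF P_summable[OF T(1) u0_abs_le]])
        (use T u0_nonneg in \<open>auto intro!: mult_nonneg_nonneg kernel_nonneg\<close>)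
    also have "\<dots> \<le> exp (d * tail) * exp (- d * T)"
      by (rule P_u0_decay[OF r(2) T(1) r(1) T(2)])
    finally show ?thesis
      using u0y measure_pos[of y0] by (simp add: C_def field_simps)
  qed
  interpret decaying_graph \<mu> \<omega> d
  proof
    show "0 < d" by (rule d)
    fix y
    define c where "c = hk y y0 1 * \<mu> y"
    have c: "0 < c" using kernel_pos[of 1 y y0] measure_pos[of y] by (simp add: c_def)
    have "hk x y t \<le> C * exp (- d) / c * exp (- d * t)" if t: "max 1 (tail + 1) \<le> t" for x t
    proof -
      have "hk x y t * hk y y0 1 * \<mu> y \<le> hk x y0 (t + 1)"
        by (rule kernel_semigroup_ge) (use t in auto)
      also have "\<dots> \<le> C * exp (- d * (t + 1))"
        by (rule base) (use t in auto)
      also have "\<dots> = C * exp (- d) * exp (- d * t)"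
        unfolding mult.assoc mult_exp_exp by (simp add: algebra_simps)
      finally show ?thesis using c by (simp add: c_def field_simps)
    qed
    thus "\<exists>C T0. \<forall>x t. T0 \<le> t \<longrightarrow> hk x y t \<le> C * exp (- d * t)" by blast
  qed
  show ?thesis by (rule lambda1_ge)
qed

end

section \<open>Continuation to the maximal solution\<close>

context mild_problem
begin

lemma blowup_alternative:
  assumes sol: "solution \<mu> \<omega> f u0 T u" and bdd: "\<And>r v. mild r v \<Longrightarrow> r \<le> B"
  shows "\<exists>\<tau> v. 0 < \<tau> \<and> T \<le> ereal \<tau> \<and> agree_before T u v \<and>
    maximal_solution \<mu> \<omega> f u0 (ereal \<tau>) v \<and>
    filterlim (\<lambda>t. linf_norm (\<lambda>x. v x t)) at_top (at_left \<tau>)"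
proof -
  have T: "0 < T" and u: "\<And>r. 0 < r \<Longrightarrow> ereal r < T \<Longrightarrow> mild r u"
    using sol by (auto simp: solution_def)
  define S where "S = {r. 0 < r \<and> (\<exists>v. mild r v)}"
  define \<tau> where "\<tau> = Sup S"
  have S_bdd: "bdd_above S" using bdd by (auto simp: S_def bdd_above_def)
  obtain r0 where r0: "0 < r0" "ereal r0 < T" using ereal_dense2[OF T] by auto
  have r0S: "r0 \<in> S" using u[OF r0] r0 by (auto simp: S_def)
  have S_le: "r \<le> \<tau>" if "r \<in> S" for r
    unfolding \<tau>_def by (rule cSup_upper[OF that S_bdd])
  have \<tau>: "0 < \<tau>" using S_le[OF r0S] r0 by simp
  have above: "\<exists>r\<in>S. t < r" if "t < \<tau>" for t
    using that less_cSup_iff[OF _ S_bdd, of t] r0S unfolding \<tau>_def by blast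
  define radius where "radius t = (SOME r. r \<in> S \<and> t < r)" for t
  \<comment> \<open>At each time some solution living beyond it is chosen. By uniqueness the value
    does not depend on the choice, so the pieces fit together.\<close>
  define v where "v x t = (SOME w. mild (radius t) w) x t" for x t
  have v_eq: "v x t = w x t" if w: "mild r w" and t: "0 < t" "t < r" for r w x t
  proof -
    have "r \<in> S" using w t by (auto simp: S_def)
    hence rad: "radius t \<in> S" "t < radius t"
      unfolding radius_def using someI[of "\<lambda>r. r \<in> S \<and> t < r" r] t by auto
    define w' where "w' = (SOME w. mild (radius t) w)"
    have "\<exists>w. mild (radius t) w" using rad(1) by (simp add: S_def)
    hence w': "mild (radius t) w'" unfolding w'_def by (rule someI_ex)
    have "w' x t = w x t"
      by (rule mild_unique[of "min (radius t) r"], rule mild_restrict[OF w'], simp,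
          rule mild_restrict[OF w], simp, use t rad in simp_all)
    thus ?thesis by (simp add: v_def w'_def)
  qed
  have v_mild: "mild r v" if r: "r < \<tau>" for r
  proof -
    obtain r' w where w: "r < r'" "mild r' w" using above[OF r] by (auto simp: S_def)
    have "mild r' v" by (rule mild_cong[OF w(2)]) (use v_eq[OF w(2)] in auto)
    thus ?thesis by (rule mild_restrict) (use w in simp)
  qed
  have "T \<le> ereal \<tau>"
  proof (rule ccontr)
    assume "\<not> T \<le> ereal \<tau>"
    then obtain r where r: "ereal \<tau> < ereal r" "ereal r < T" using ereal_dense2[of "ereal \<tau>" T] by (auto simp: not_le)
    hence "r \<in> S" using u[of r] \<tau> by (auto simp: S_def)
    thus False using S_le r by fastforce
  qed
  moreover have "agree_before T u v"
    unfolding agree_before_def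
  proof (intro allI impI)
    fix x t assume t: "0 < t \<and> ereal t < T"
    then obtain r where r: "ereal t < ereal r" "ereal r < T" using ereal_dense2[of "ereal t" T] by auto
    show "u x t = v x t"
      using v_eq[OF u[of r], of t x] r t by auto
  qed
  moreover have "maximal_solution \<mu> \<omega> f u0 (ereal \<tau>) v"
    unfolding maximal_solution_def
  proof (intro conjI notI)
    show "solution \<mu> \<omega> f u0 (ereal \<tau>) v"
      using \<tau> v_mild by (auto simp: solution_def)
    assume "\<exists>T' w. ereal \<tau> < T' \<and> solution \<mu> \<omega> f u0 T' w \<and> agree_before (ereal \<tau>) v w"
    then obtain T' w where T': "ereal \<tau> < T'" "solution \<mu> \<omega> f u0 T' w" by blast
    then obtain r where r: "ereal \<tau> < ereal r" "ereal r < T'" using ereal_dense2 by blast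
    hence "0 < r" "mild r w" using T'(2) \<tau> by (auto simp: solution_def)
    hence "r \<in> S" by (auto simp: S_def)
    thus False using S_le r by fastforce
  qed
  moreover have "filterlim (\<lambda>t. linf_norm (\<lambda>x. v x t)) at_top (at_left \<tau>)"
    unfolding filterlim_at_top
  proof
    fix Z :: real
    \<comment> \<open>Since \<delta> depends on \<open>Z\<close> alone, a norm below
      \<open>Z\<close> at any time in (\<tau> - \<delta>, \<tau>) would allow a continuation past
      \<tau>. Hence a genuine limit and not just an unbounded norm.\<close>
    obtain \<delta> where \<delta>: "0 < \<delta>" and extend: "\<And>r a w. mild r w \<Longrightarrow> 0 < a \<Longrightarrow> a < r \<Longrightarrow>
        (\<And>x. w x a \<le> max Z 0) \<Longrightarrow> \<exists>w'. mild (a + \<delta>) w'"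
      using mild_extend[of "max Z 0"] by auto
    have "max 0 (\<tau> - \<delta>) < \<tau>" using \<tau> \<delta> by simp
    from eventually_at_left_real[OF this]
    show "\<forall>\<^sub>F t in at_left \<tau>. Z \<le> linf_norm (\<lambda>x. v x t)"
    proof eventually_elim
      case (elim t)
      hence t: "0 < t" "\<tau> - \<delta> < t" "t < \<tau>" by auto
      define r where "r = (t + \<tau>) / 2"
      have r: "t < r" "r < \<tau>" using t by (auto simp: r_def)
      obtain M C where M: "0 \<le> M" "\<And>x t. 0 < t \<Longrightarrow> t < r \<Longrightarrow> v x t \<le> M" "admissible r C (\<lambda>y s. f (v y s))"
        using mild_bounded[OF v_mild[OF r(2)]] t r by (metis less_trans)
      have nonneg: "0 \<le> v x t" for x using mild_nonneg[OF v_mild[OF r(2)] t(1) r(1)] .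
      \<comment> \<open>\<open>SUP\<close> is informative only for sets bounded above; the bound on
        (0,r) with t < r < \<tau> secures this before pointwise bounds are read off
        \<open>linf_norm\<close>.\<close>
      have bdd: "bdd_above (range (\<lambda>x. \<bar>v x t\<bar>))"
        using M(2)[OF t(1) r(1)] nonneg by (intro bdd_aboveI2[where M = M]) simp
      show ?case
      proof (rule ccontr)
        assume "\<not> Z \<le> linf_norm (\<lambda>x. v x t)"
        hence "v x t \<le> max Z 0" for x
          using cSUP_upper[OF UNIV_I bdd, of x] nonneg[of x] by (simp add: linf_norm_def)
        from extend[OF v_mild[OF r(2)] t(1) r(1) this]
        have "t + \<delta> \<in> S" using t \<delta> by (auto simp: S_def)
        thus False using S_le t by fastforce
      qed
    qed
  qed
  ultimately show ?thesis using \<tau> by blast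
qed

end

theorem theorem3p2:
  fixes \<mu> :: "'a \<Rightarrow> real" and \<omega> :: "'a \<Rightarrow> 'a \<Rightarrow> real"
    and u0 :: "'a \<Rightarrow> real" and f h :: "real \<Rightarrow> real" and dh0 :: real
    and T :: ereal and u :: "'a \<Rightarrow> real \<Rightarrow> real"
  assumes graph: "weighted_graph \<mu> \<omega>"
    and complete: "stochastically_complete \<mu> \<omega>"
    and lambda1_pos: "lambda1 \<mu> \<omega> > 0"
    and u0_bounded: "bounded (range u0)"
    and u0_nonneg: "\<forall>x. u0 x \<ge> 0"
    and u0_nonzero: "\<exists>x. u0 x \<noteq> 0"
    and f_nonneg: "\<forall>s\<ge>0. f s \<ge> 0"
    and f_lipschitz: "\<forall>s\<ge>0. \<exists>e>0. \<exists>L. L-lipschitz_on (cball s e \<inter> {0..}) f"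
    and f_ge_h: "\<forall>s\<ge>0. f s \<ge> h s"
    and h_incr: "mono_on {0..} h"
    and h_convex: "convex_on {0..} h"
    and h_zero: "h 0 = 0"
    and h_integrable: "set_integrable lborel {1..} (\<lambda>s. 1 / h s)"
    and h_deriv: "(h has_real_derivative dh0) (at_right 0)"
    and h_deriv_gt: "ereal dh0 > lambda1 \<mu> \<omega>"
    and sol: "solution \<mu> \<omega> f u0 T u"
  shows "\<exists>\<tau> v. 0 < \<tau> \<and> T \<le> ereal \<tau> \<and> agree_before T u v \<and>
           maximal_solution \<mu> \<omega> f u0 (ereal \<tau>) v \<and>
           filterlim (\<lambda>t. linf_norm (\<lambda>x. v x t)) at_top (at_left \<tau>)"
proof -
  interpret weighted_graph \<mu> \<omega> by (rule graph)
  obtain U where U: "\<And>x. norm (u0 x) \<le> U" using u0_bounded by (auto simp: bounded_iff)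
  have "0 < ereal dh0" using lambda1_pos h_deriv_gt by (rule less_trans)
  hence dh0: "0 < dh0" by simp
  interpret blowup_problem \<mu> \<omega> f u0 U h dh0
  proof
    show "u0 x \<le> U" for x using U[of x] by simp
    show "\<exists>L>0. L-lipschitz_on {0..R} f" for R
      by (rule local_lipschitz_imp_lipschitz_Icc[OF f_lipschitz])
    show "dh0 * s \<le> h s" if "0 \<le> s" for s
      by (rule convex_ge_slope_at_zero[OF h_convex h_zero h_deriv that])
  qed (use assms dh0 in auto)
  \<comment> \<open>The negation supplies solutions on arbitrarily long intervals, possibly
    different ones for different lengths, which is the form that
    \<open>global_existence_imp_lambda1_ge\<close> accepts.\<close>
  have "\<exists>B. \<forall>r v. mild r v \<longrightarrow> r \<le> B"
  proof (rule ccontr)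
    assume "\<not> (\<exists>B. \<forall>r v. mild r v \<longrightarrow> r \<le> B)"
    hence "\<exists>r v. R < r \<and> mild r v" for R by (meson not_le)
    hence "ereal dh0 \<le> lambda1 \<mu> \<omega>"
      using u0_nonzero global_existence_imp_lambda1_ge by blast
    thus False using h_deriv_gt by simp
  qed
  then obtain B where "\<And>r v. mild r v \<Longrightarrow> r \<le> B" by blast
  from blowup_alternative[OF sol this] show ?thesis .
qed

end
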